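(* Let $q\in[0,1)$ and $\alpha,\beta>0$ be fixed, and assume that $\max(u,v)<1$, where $u=\frac{1-q}{\alpha}-1$ and $v=\frac{1-q}{\beta}-1$ (the maximal current phase). For each $N$ let $I=\{a,a+1,\dots,b\}\subseteq\{1,\dots,N\}$ with $a=a(N)$ and $b=b(N)$ be an interval such that $\min(a,N-b)\gg\max(|I|,\log^2(N))$. Then $$\lim_{N\to\infty}\left\|\mu_I-\mathrm{Ber}_I\left(\tfrac12\right)\right\|_{\mathrm{TV}}=0 .$$
   Context: The open ASEP with parameters $(q,\alpha,\beta)$ on $\{1,\dots,N\}$ is the continuous-time Markov chain on $\Omega_N=\{0,1\}^N$ with generator $$\mathcal{L}f(\eta)=\sum_{x=1}^{N-1}\big(\eta(x)(1-\eta(x+1))+q\,\eta(x+1)(1-\eta(x))\big)[f(\eta^{x,x+1})-f(\eta)]+\alpha(1-\eta(1))[f(\eta^1)-f(\eta)]+\beta\eta(N)[f(\eta^N)-f(\eta)],$$ where $\eta^{x,y}$ is $\eta$ with the values at $x$ and $y$ swapped and $\eta^{w}$ is $\eta$ with the value at $w$ flipped. It has a unique stationary distribution $\mu=\mu^{N,q,\alpha,\beta}$. For an interval $I$, $\mu_I$ denotes the projection (marginal) of $\mu$ onto the coordinates in $I$, viewed as a probability measure on $\{0,1\}^{|I|}$, and $\mathrm{Ber}_I(\rho)$ denotes the Bernoulli-$\rho$ product measure on $\{0,1\}^{|I|}$. $\|\nu-\nu'\|_{\mathrm{TV}}=\frac12\sum_x|\nu(x)-\nu'(x)|$. For functions $f,g$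 of $N$, $f\gg g$ means $\liminf_{N\to\infty}f(N)/g(N)=\infty$. *)

theory Defs
  imports "HOL-Probability.Probability"
begin

section \<open>Configurations\<close>

text \<open>A configuration on a set \<open>S\<close> of sites is a function \<open>nat \<Rightarrow> bool\<close> (\<open>True\<close> = particle)
  that takes the default value \<open>False\<close> off \<open>S\<close>. This is the convention of \<^const>\<open>PiE_dflt\<close>
  and \<^const>\<open>Pi_pmf\<close>.\<close>

definition configs :: "nat set \<Rightarrow> (nat \<Rightarrow> bool) set" where
  "configs S = PiE_dflt S False (\<lambda>_. UNIV)"

definition swap_sites :: "nat \<Rightarrow> nat \<Rightarrow> (nat \<Rightarrow> bool) \<Rightarrow> nat \<Rightarrow> bool" where
  "swap_sites x y \<eta> = \<eta>(x := \<eta> y, y := \<eta> x)"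

definition flip_site :: "nat \<Rightarrow> (nat \<Rightarrow> bool) \<Rightarrow> nat \<Rightarrow> bool" where
  "flip_site w \<eta> = \<eta>(w := \<not> \<eta> w)"

section \<open>The open ASEP and its stationary distribution\<close>

definition asep_gen ::
  "nat \<Rightarrow> real \<Rightarrow> real \<Rightarrow> real \<Rightarrow> ((nat \<Rightarrow> bool) \<Rightarrow> real) \<Rightarrow> (nat \<Rightarrow> bool) \<Rightarrow> real" where
  "asep_gen N q \<alpha> \<beta> f \<eta> =
     (\<Sum>x\<in>{1..<N}. (of_bool (\<eta> x) * (1 - of_bool (\<eta> (x + 1)))
                     + q * of_bool (\<eta> (x + 1)) * (1 - of_bool (\<eta> x)))
                    * (f (swap_sites x (x + 1) \<eta>) - f \<eta>))
     + \<alpha> * (1 - of_bool (\<eta> 1)) * (f (flip_site 1 \<eta>) - f \<eta>)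
     + \<beta> * of_bool (\<eta> N) * (f (flip_site N \<eta>) - f \<eta>)"

text \<open>The transition semigroup \<open>exp (t L)\<close> of the chain, i.e. \<open>f \<mapsto> (\<eta> \<mapsto> E\<^sub>\<eta> [f (\<eta>\<^sub>t)])\<close>. The
  series converges because a configuration has only finitely many successors.\<close>

definition asep_semigroup ::
  "nat \<Rightarrow> real \<Rightarrow> real \<Rightarrow> real \<Rightarrow> real \<Rightarrow> ((nat \<Rightarrow> bool) \<Rightarrow> real) \<Rightarrow> (nat \<Rightarrow> bool) \<Rightarrow> real" where
  "asep_semigroup N q \<alpha> \<beta> t f \<eta> =
     (\<Sum>n. t ^ n / fact n * (asep_gen N q \<alpha> \<beta> ^^ n) f \<eta>)"

definition asep_stationary ::
  "nat \<Rightarrow> real \<Rightarrow> real \<Rightarrow> real \<Rightarrow> (nat \<Rightarrow> bool) pmf \<Rightarrow> bool" where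
  "asep_stationary N q \<alpha> \<beta> \<mu> \<longleftrightarrow>
     set_pmf \<mu> \<subseteq> configs {1..N} \<and>
     (\<forall>t\<ge>0. \<forall>f. measure_pmf.expectation \<mu> (asep_semigroup N q \<alpha> \<beta> t f)
                 = measure_pmf.expectation \<mu> f)"

section \<open>Marginals, Bernoulli product measures, total variation\<close>

text \<open>Measures on \<open>{0,1}\<^bsup>|I|\<^esup>\<close> are indexed by the sites of \<open>I\<close> themselves, without relabelling
  them as \<open>1, \<dots>, |I|\<close>.\<close>

definition marginal :: "nat set \<Rightarrow> (nat \<Rightarrow> bool) pmf \<Rightarrow> (nat \<Rightarrow> bool) pmf" where
  "marginal I \<mu> = map_pmf (\<lambda>\<eta> x. if x \<in> I then \<eta> x else False) \<mu>"

definition Ber :: "nat set \<Rightarrow> real \<Rightarrow> (nat \<Rightarrow> bool) pmf" where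
  "Ber I \<rho> = Pi_pmf I False (\<lambda>_. bernoulli_pmf \<rho>)"

definition tv_dist :: "nat set \<Rightarrow> (nat \<Rightarrow> bool) pmf \<Rightarrow> (nat \<Rightarrow> bool) pmf \<Rightarrow> real" where
  "tv_dist I \<nu> \<nu>' = 1 / 2 * (\<Sum>\<xi>\<in>configs I. \<bar>pmf \<nu> \<xi> - pmf \<nu>' \<xi>\<bar>)"

definition much_greater :: "(nat \<Rightarrow> real) \<Rightarrow> (nat \<Rightarrow> real) \<Rightarrow> bool" where
  "much_greater f g \<longleftrightarrow> liminf (\<lambda>N. ereal (f N / g N)) = \<infinity>"

section \<open>Stationarity in terms of the generator\<close>

lemma finite_configs: "finite S \<Longrightarrow> finite (configs S)"
  by (auto simp: configs_def)

lemma swap_sites_in_configs: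
  "\<eta> \<in> configs S \<Longrightarrow> x \<in> S \<Longrightarrow> y \<in> S \<Longrightarrow> swap_sites x y \<eta> \<in> configs S"
  by (auto simp: configs_def PiE_dflt_def swap_sites_def)

lemma flip_site_in_configs: "\<eta> \<in> configs S \<Longrightarrow> w \<in> S \<Longrightarrow> flip_site w \<eta> \<in> configs S"
  by (auto simp: configs_def PiE_dflt_def flip_site_def)

definition asep_gen_bound :: "nat \<Rightarrow> real \<Rightarrow> real \<Rightarrow> real \<Rightarrow> real" where
  "asep_gen_bound N q \<alpha> \<beta> = real N * ((1 + \<bar>q\<bar>) * 2) + \<bar>\<alpha>\<bar> * 2 + \<bar>\<beta>\<bar> * 2"

lemma asep_gen_bound_nonneg: "0 \<le> asep_gen_bound N q \<alpha> \<beta>"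
  by (simp add: asep_gen_bound_def)

lemma asep_gen_abs_le:
  assumes N: "N \<ge> 1" and f: "\<And>\<eta>. \<eta> \<in> configs {1..N} \<Longrightarrow> \<bar>f \<eta>\<bar> \<le> M"
    and \<eta>: "\<eta> \<in> configs {1..N}"
  shows "\<bar>asep_gen N q \<alpha> \<beta> f \<eta>\<bar> \<le> asep_gen_bound N q \<alpha> \<beta> * M"
proof -
  have M: "0 \<le> M" using f[OF \<eta>] by linarith
  have term_le: "\<bar>c * (f \<xi> - f \<eta>)\<bar> \<le> C * (2 * M)"
    if "\<bar>c\<bar> \<le> C" "\<xi> \<in> configs {1..N}" for c C \<xi>
  proof -
    have "\<bar>f \<xi> - f \<eta>\<bar> \<le> 2 * M"
      using f[OF that(2)] f[OF \<eta>] by linarith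
    then show ?thesis
      using that(1) M by (auto simp: abs_mult intro!: mult_mono)
  qed
  have "\<bar>\<Sum>x\<in>{1..<N}. (of_bool (\<eta> x) * (1 - of_bool (\<eta> (x + 1)))
                     + q * of_bool (\<eta> (x + 1)) * (1 - of_bool (\<eta> x)))
                    * (f (swap_sites x (x + 1) \<eta>) - f \<eta>)\<bar>
        \<le> (\<Sum>x\<in>{1..<N}. (1 + \<bar>q\<bar>) * (2 * M))"
    by (rule order_trans[OF sum_abs], rule sum_mono, rule term_le)
       (auto intro!: swap_sites_in_configs \<eta>[unfolded One_nat_def])
  also have "\<dots> \<le> real N * ((1 + \<bar>q\<bar>) * (2 * M))"
    unfolding sum_constant by (rule mult_right_mono) (use M in auto)
  finally have 1: "\<bar>\<Sum>x\<in>{1..<N}. (of_bool (\<eta> x) * (1 - of_bool (\<eta> (x + 1)))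
                     + q * of_bool (\<eta> (x + 1)) * (1 - of_bool (\<eta> x)))
                    * (f (swap_sites x (x + 1) \<eta>) - f \<eta>)\<bar> \<le> real N * ((1 + \<bar>q\<bar>) * (2 * M))" .
  have 2: "\<bar>\<alpha> * (1 - of_bool (\<eta> 1)) * (f (flip_site 1 \<eta>) - f \<eta>)\<bar> \<le> \<bar>\<alpha>\<bar> * (2 * M)"
    by (rule term_le) (use N \<eta> in \<open>auto intro!: flip_site_in_configs\<close>)
  have 3: "\<bar>\<beta> * of_bool (\<eta> N) * (f (flip_site N \<eta>) - f \<eta>)\<bar> \<le> \<bar>\<beta>\<bar> * (2 * M)"
    by (rule term_le) (use N \<eta> in \<open>auto intro!: flip_site_in_configs\<close>)
  have "\<bar>asep_gen N q \<alpha> \<beta> f \<eta>\<bar>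
      \<le> real N * ((1 + \<bar>q\<bar>) * (2 * M)) + \<bar>\<alpha>\<bar> * (2 * M) + \<bar>\<beta>\<bar> * (2 * M)"
    unfolding asep_gen_def using 1 2 3 by linarith
  also have "\<dots> = asep_gen_bound N q \<alpha> \<beta> * M"
    by (simp add: asep_gen_bound_def algebra_simps)
  finally show ?thesis .
qed

lemma asep_gen_pow_abs_le:
  assumes N: "N \<ge> 1" and f: "\<And>\<eta>. \<eta> \<in> configs {1..N} \<Longrightarrow> \<bar>f \<eta>\<bar> \<le> M"
    and \<eta>: "\<eta> \<in> configs {1..N}"
  shows "\<bar>(asep_gen N q \<alpha> \<beta> ^^ n) f \<eta>\<bar> \<le> asep_gen_bound N q \<alpha> \<beta> ^ n * M"
  using \<eta>
proof (induction n arbitrary: \<eta>)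
  case (Suc n)
  show ?case
    using asep_gen_abs_le[OF N Suc.IH Suc.prems] by (simp add: mult.assoc)
qed (use f in auto)

lemma summable_asep_semigroup:
  assumes N: "N \<ge> 1" and \<eta>: "\<eta> \<in> configs {1..N}"
  shows "summable (\<lambda>n. t ^ n / fact n * (asep_gen N q \<alpha> \<beta> ^^ n) f \<eta>)"
proof -
  define M where "M = (\<Sum>\<xi>\<in>configs {1..N}. \<bar>f \<xi>\<bar>)"
  have f: "\<bar>f \<xi>\<bar> \<le> M" if "\<xi> \<in> configs {1..N}" for \<xi>
    unfolding M_def using that
    by (intro member_le_sum[where f = "\<lambda>\<xi>. \<bar>f \<xi>\<bar>"]) (auto intro: finite_configs)
  let ?K = "asep_gen_bound N q \<alpha> \<beta>"
  have "summable (\<lambda>n. inverse (fact n) * (\<bar>t\<bar> * ?K) ^ n * M)"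
    by (intro summable_mult2 summable_exp)
  then show ?thesis
  proof (rule summable_comparison_test'[where N = 0])
    fix n :: nat
    have "norm (t ^ n / fact n * (asep_gen N q \<alpha> \<beta> ^^ n) f \<eta>)
        = \<bar>t\<bar> ^ n / fact n * \<bar>(asep_gen N q \<alpha> \<beta> ^^ n) f \<eta>\<bar>"
      by (simp add: abs_mult power_abs)
    also have "\<dots> \<le> \<bar>t\<bar> ^ n / fact n * (?K ^ n * M)"
      by (intro mult_left_mono asep_gen_pow_abs_le N f \<eta>) auto
    finally show "norm (t ^ n / fact n * (asep_gen N q \<alpha> \<beta> ^^ n) f \<eta>)
        \<le> inverse (fact n) * (\<bar>t\<bar> * ?K) ^ n * M"
      by (simp add: field_simps)
  qed
qed

lemma asep_stationary_iff_gen: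
  assumes N: "N \<ge> 1"
  shows "asep_stationary N q \<alpha> \<beta> \<mu> \<longleftrightarrow>
     set_pmf \<mu> \<subseteq> configs {1..N} \<and>
     (\<forall>f. measure_pmf.expectation \<mu> (asep_gen N q \<alpha> \<beta> f) = 0)"
proof (cases "set_pmf \<mu> \<subseteq> configs {1..N}")
  case True
  let ?L = "asep_gen N q \<alpha> \<beta>" and ?E = "measure_pmf.expectation \<mu>"
  have E: "?E g = (\<Sum>\<eta>\<in>configs {1..N}. g \<eta> * pmf \<mu> \<eta>)" for g
    by (rule integral_measure_pmf_real) (use True in \<open>auto intro: finite_configs\<close>)
  have sums: "(\<lambda>n. ?E ((?L ^^ n) f) / fact n * t ^ n) sums
                 ?E (asep_semigroup N q \<alpha> \<beta> t f)" for t f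
  proof -
    have "(\<lambda>n. \<Sum>\<eta>\<in>configs {1..N}. t ^ n / fact n * (?L ^^ n) f \<eta> * pmf \<mu> \<eta>) sums
          (\<Sum>\<eta>\<in>configs {1..N}. asep_semigroup N q \<alpha> \<beta> t f \<eta> * pmf \<mu> \<eta>)"
      unfolding asep_semigroup_def
      by (intro sums_sum sums_mult2 summable_sums summable_asep_semigroup N)
    then show ?thesis
      by (simp add: E sum_divide_distrib sum_distrib_right sum_distrib_left mult_ac)
  qed
  have "(\<forall>t\<ge>0. \<forall>f. ?E (asep_semigroup N q \<alpha> \<beta> t f) = ?E f) \<longleftrightarrow> (\<forall>f. ?E (?L f) = 0)"
  proof (intro iffI allI impI)
    fix f assume inv: "\<forall>t\<ge>0. \<forall>f. ?E (asep_semigroup N q \<alpha> \<beta> t f) = ?E f"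
    define c where "c n = ?E ((?L ^^ n) f) / fact n" for n
    have "((\<lambda>t. \<Sum>n. c n * t ^ n) has_field_derivative (\<Sum>n. diffs c n * 0 ^ n)) (at 0)"
      by (rule termdiffs_strong_converges_everywhere)
         (use sums in \<open>auto simp: c_def intro: sums_summable\<close>)
    then have d1: "((\<lambda>t. \<Sum>n. c n * t ^ n) has_real_derivative c 1) (at 0 within {0..})"
      by (simp add: diffs_def has_field_derivative_at_within)
    have "((\<lambda>t. ?E f) has_real_derivative c 1) (at 0 within {0..})"
    proof (rule has_field_derivative_transform_within[OF d1 zero_less_one])
      fix t :: real assume "t \<in> {0..}"
      then show "(\<Sum>n. c n * t ^ n) = ?E f"
        using sums_unique[OF sums[of f t]] inv by (simp add: c_def)
    qed auto
    moreover have "((\<lambda>t. ?E f) has_real_derivative 0) (at 0 within {0..})"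
      by simp
    ultimately have "c 1 = 0"
      by (rule has_field_derivative_unique) (simp add: at_within_Ici_at_right)
    then show "?E (?L f) = 0"
      by (simp add: c_def)
  next
    fix t :: real and f assume "\<forall>f. ?E (?L f) = 0"
    then have "?E ((?L ^^ n) f) = 0" if "n \<noteq> 0" for n
      using that by (cases n) auto
    then have "(\<lambda>n. ?E ((?L ^^ n) f) / fact n * t ^ n) sums
        (\<Sum>n\<in>{0}. ?E ((?L ^^ n) f) / fact n * t ^ n)"
      by (intro sums_finite) auto
    then show "?E (asep_semigroup N q \<alpha> \<beta> t f) = ?E f"
      using sums_unique2[OF sums] by simp
  qed
  with True show ?thesis
    by (simp add: asep_stationary_def)
qed (simp add: asep_stationary_def)

end

theory Submission
  imports Defs
begin

text \<open>
  The stationary weights have a matrix product form with non-negative bidiagonal matrices: on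
  functions of a height \<open>m\<close>, a particle acts by \<open>f m \<mapsto> (1 + v q^m) f m + c (m + 1) f (m + 1)\<close> and
  a hole by \<open>f m \<mapsto> (1 + u q^m) f m + f (m - 1)\<close>, where \<open>c m = (1 - q^m) (1 - u v q^(m-1))\<close>. The
  weight of a configuration is the \<open>(0,0)\<close> entry of the product of its matrices, so it is a sum
  over excursions of a height path. Stationarity is the usual telescoping of the quadratic
  algebra, and \<open>stationary_unique\<close> identifies \<open>\<mu>\<close> with the normalized weights. At large heights
  both matrices are free: a particle is \<open>1 + shift up\<close>, a hole is \<open>1 + shift down\<close>, and every word
  of length \<open>n\<close> has the same row sum \<open>2^n\<close>. The theorem says that the path is high along \<open>I\<close> and
  that the function which it sees to the right of \<open>I\<close> is flat on the scale on which the path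
  moves within \<open>I\<close>.

  Let \<open>T\<close> be the sum of the two matrices and \<open>R k = T^k \<delta>\<^sub>0\<close>. For \<open>u, v < 1\<close> there is a positive
  solution \<open>\<phi>\<close> of \<open>T \<phi> = 4 \<phi>\<close> with linear growth, a convolution of ratios of \<open>q\<close>-Pochhammer symbols.
  Conjugation by \<open>\<phi>\<close> turns \<open>T / 4\<close> into a reversible birth-death chain with conductances of order
  \<open>m^2\<close>, a discrete three-dimensional Bessel process. For such a chain the return probabilities
  are of order \<open>k^(-3/2)\<close>, because the Green function at \<open>0\<close> decays like \<open>1 / m\<close> and has expectation
  of order \<open>k^(-1/2)\<close> after \<open>k\<close> steps, and the return probabilities are monotone in time. They are
  moments of a spectral measure, so their second differences are of order \<open>k^(-7/2)\<close>, and this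
  bounds the gradient of the transition kernel. Hence \<open>R k\<close> is a function with slope of order
  \<open>4^k k^(-3/2)\<close> up to heights of order \<open>k^(1/2)\<close>.

  Let \<open>A\<close>, \<open>n\<close>, \<open>B\<close> be the numbers of sites to the left of \<open>I\<close>, in \<open>I\<close> and to the right of \<open>I\<close>, and let
  \<open>n \<le> A \<le> B\<close>. Along \<open>I\<close> the matrices are replaced by free ones acting on functions of an integer
  height. The replacement costs \<open>q^m\<close> at height \<open>m\<close>, which is paid near the bottom only, where the
  path is with probability of order \<open>A^(-3/2)\<close> at each step. The free words move \<open>R B\<close> by its
  slope times the displacement of a lazy random walk, of order \<open>n^(1/2)\<close>, whereas the height is
  of order \<open>A^(1/2)\<close>. Both errors are \<open>O((n / A)^(1/2))\<close> relative to the total weight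
  (\<open>block_weight_nearly_constant\<close>). The case \<open>A > B\<close> follows by reflection combined with
  particle-hole exchange, which swaps \<open>u\<close> and \<open>v\<close>. So the total variation distance is
  \<open>O((n / min A B)^(1/2))\<close>.
\<close>

section \<open>Birth-death chains with quadratic conductances\<close>

text \<open>
  Monotonicity turns a bound on sums into a bound on terms and gains one power: the last term
  of a block \<open>{k div 2..k}\<close> is at most the average over the block.
\<close>

lemma decay_from_block_sums:
  fixes x :: "nat \<Rightarrow> real"
  assumes dec: "decseq x" and nonneg: "\<And>k. 0 \<le> x k"
    and block: "\<And>j k. j \<le> k \<Longrightarrow> (\<Sum>i=j..k. x i) \<le> C * real (Suc j) powr - s"
    and s: "0 \<le> s"
  shows "x k \<le> C * 2 powr (s + 1) * real (Suc k) powr - (s + 1)"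
proof -
  define j where "j = k div 2"
  have j: "j \<le> k" "Suc k \<le> 2 * Suc j" "Suc j \<le> Suc k - j" unfolding j_def by auto
  have C: "0 \<le> C"
  proof -
    have "0 \<le> C * real (Suc 0) powr - s"
      using block[of 0 0] nonneg[of 0] by simp
    then show ?thesis by simp
  qed
  have "real (Suc j) * x k \<le> real (Suc k - j) * x k"
    using j nonneg[of k] by (intro mult_right_mono) (auto simp del: of_nat_Suc)
  also have "\<dots> = (\<Sum>i=j..k. x k)" by simp
  also have "\<dots> \<le> (\<Sum>i=j..k. x i)" using dec by (intro sum_mono) (auto simp: decseq_def)
  also have "\<dots> \<le> C * real (Suc j) powr - s" by (rule block[OF j(1)])
  finally have "x k \<le> C * real (Suc j) powr - s / real (Suc j)"
    by (simp add: field_simps del: of_nat_Suc)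
  also have "\<dots> = C * real (Suc j) powr - (s + 1)"
    by (simp add: powr_diff powr_minus powr_add divide_simps)
  also have "\<dots> \<le> C * (real (Suc k) / 2) powr - (s + 1)"
    using j C s by (intro mult_left_mono powr_mono2') auto
  also have "\<dots> = C * 2 powr (s + 1) * real (Suc k) powr - (s + 1)"
  proof -
    have "(x / 2) powr - r = 2 powr r * x powr - r" if "x > 0" for x r :: real
      using that by (simp add: powr_divide powr_minus divide_simps)
    from this[of "real (Suc k)" "s + 1"] show ?thesis by (simp del: of_nat_Suc)
  qed
  finally show ?thesis .
qed

lemma sum_inverse_sqrt_le: "(\<Sum>j<m. 1 / sqrt (real (Suc j))) \<le> 2 * sqrt (real m)"
proof (induction m)
  case (Suc m)
  have "1 \<le> 2 * (sqrt (real (Suc m)) - sqrt (real m)) * sqrt (real (Suc m))"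
  proof -
    have "0 \<le> (sqrt (real (Suc m)) - sqrt (real m))\<^sup>2" by simp
    also have "\<dots> = 2 * (sqrt (real (Suc m)) - sqrt (real m)) * sqrt (real (Suc m)) - 1"
      by (simp add: power2_eq_square algebra_simps)
    finally show ?thesis by simp
  qed
  then have "1 / sqrt (real (Suc m)) \<le> 2 * (sqrt (real (Suc m)) - sqrt (real m))"
    by (simp add: divide_simps)
  with Suc show ?case by simp
qed simp

lemma sum_inverse_square_bounds:
  shows "summable (\<lambda>j. 1 / (real (Suc (m + j)))\<^sup>2)"
    and "1 / real (Suc m) \<le> (\<Sum>j. 1 / (real (Suc (m + j)))\<^sup>2)"
    and "(\<Sum>j. 1 / (real (Suc (m + j)))\<^sup>2) \<le> 2 / real (Suc m)"
proof -
  define t where "t j = 1 / real (Suc (m + j))" for j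
  have "t \<longlonglongrightarrow> 0" unfolding t_def using LIMSEQ_ignore_initial_segment[OF LIMSEQ_inverse_real_of_nat, of m] by (simp add: inverse_eq_divide add.commute)
  then have tele: "(\<lambda>j. t j - t (Suc j)) sums (1 / real (Suc m))"
    using telescope_sums'[of t 0] by (simp add: t_def)
  have lo: "t j - t (Suc j) \<le> 1 / (real (Suc (m + j)))\<^sup>2" for j
    by (simp add: t_def divide_simps power2_eq_square)
  have hi: "1 / (real (Suc (m + j)))\<^sup>2 \<le> 2 * (t j - t (Suc j))" for j
    by (simp add: t_def divide_simps power2_eq_square)
  have t2: "(\<lambda>j. 2 * (t j - t (Suc j))) sums (2 * (1 / real (Suc m)))"
    by (intro sums_mult tele)
  show summ: "summable (\<lambda>j. 1 / (real (Suc (m + j)))\<^sup>2)"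
    by (rule summable_comparison_test'[OF sums_summable[OF t2], of 0]) (use hi in auto)
  show "1 / real (Suc m) \<le> (\<Sum>j. 1 / (real (Suc (m + j)))\<^sup>2)"
    using suminf_le[OF lo sums_summable[OF tele] summ] sums_unique[OF tele] by simp
  show "(\<Sum>j. 1 / (real (Suc (m + j)))\<^sup>2) \<le> 2 / real (Suc m)"
    using suminf_le[OF hi summ sums_summable[OF t2]] sums_unique[OF t2] by simp
qed

text \<open>
  A nearest neighbour chain on the natural numbers that is reversible with respect to \<open>w\<close>, with
  conductance \<open>W m\<close> on the edge between \<open>m\<close> and \<open>m + 1\<close>. The quadratic bounds make it comparable
  with the radial part of a three-dimensional random walk, and \<open>\<epsilon>\<close> bounds the holding
  probability from below. The test functions below solve Poisson equations of the chain
  exactly, so that only the size of \<open>W\<close> enters.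
\<close>

locale conductance_chain =
  fixes w W :: "nat \<Rightarrow> real" and lo hi \<epsilon> :: real
  assumes lo_pos: "0 < lo" and eps_pos: "0 < \<epsilon>"
    and w_lo: "lo * (real (Suc m))\<^sup>2 \<le> w m" and w_hi: "w m \<le> hi * (real (Suc m))\<^sup>2"
    and W_lo: "lo * (real (Suc m))\<^sup>2 \<le> W m" and W_hi: "W m \<le> hi * (real (Suc m))\<^sup>2"
    and hold: "W m + (if m = 0 then 0 else W (m - 1)) \<le> (1 - \<epsilon>) * w m"
    and w_0: "w 0 = 1"
begin

text \<open>
  The transition operator. At \<open>m = 0\<close> the difference \<open>f m - f (m - 1)\<close> is \<open>0\<close> by truncated
  subtraction, so that no conductance leaves the half line.
\<close>

definition P :: "(nat \<Rightarrow> real) \<Rightarrow> nat \<Rightarrow> real" where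
  "P f m = f m + (W m * (f (Suc m) - f m) - W (m - 1) * (f m - f (m - 1))) / w m"

text \<open>
  The transition kernel to \<open>0\<close>. As \<open>w 0 = 1\<close>, reversibility makes \<open>w m * kernel k m\<close> the probability
  of being at \<open>m\<close> after \<open>k\<close> steps from \<open>0\<close>.
\<close>

definition kernel :: "nat \<Rightarrow> nat \<Rightarrow> real" where
  "kernel k = (P ^^ k) (\<lambda>m. of_bool (m = 0))"

definition inner :: "nat \<Rightarrow> (nat \<Rightarrow> real) \<Rightarrow> (nat \<Rightarrow> real) \<Rightarrow> real" where
  "inner M f h = (\<Sum>m\<le>M. w m * f m * h m)"

definition expect :: "nat \<Rightarrow> (nat \<Rightarrow> real) \<Rightarrow> real" where
  "expect k h = (\<Sum>m\<le>k. w m * kernel k m * h m)"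

lemma w_pos: "0 < w m"
  using w_lo[of m] lo_pos by (meson less_le_trans mult_pos_pos of_nat_0_less_iff zero_less_Suc zero_less_power)

lemma W_pos: "0 < W m"
  using W_lo[of m] lo_pos by (meson less_le_trans mult_pos_pos of_nat_0_less_iff zero_less_Suc zero_less_power)

lemma hi_pos: "0 < hi"
  using w_hi[of 0] w_0 by simp

lemma P_flux:
  "w m * (P f m - f m) = W m * (f (Suc m) - f m) - W (m - 1) * (f m - f (m - 1))"
  using w_pos[of m] by (simp add: P_def)

lemma sum_by_parts:
  "(\<Sum>m\<le>M. w m * f m * (P h m - h m))
     = f M * (W M * (h (Suc M) - h M)) - (\<Sum>m<M. W m * (f (Suc m) - f m) * (h (Suc m) - h m))"
proof (induction M)
  case 0
  show ?case using P_flux[of 0 h] by (simp add: mult_ac)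
next
  case (Suc M)
  have "w (Suc M) * f (Suc M) * (P h (Suc M) - h (Suc M))
      = f (Suc M) * (W (Suc M) * (h (Suc (Suc M)) - h (Suc M)) - W M * (h (Suc M) - h M))"
    using P_flux[of "Suc M" h] by (metis diff_Suc_1 mult.assoc mult.commute)
  then show ?case
    using Suc by (simp add: algebra_simps)
qed

lemma flux_eq: "(\<Sum>j\<le>m. w j * (P f j - f j)) = W m * (f (Suc m) - f m)"
  using sum_by_parts[of "\<lambda>_. 1" f m] by simp

lemma inner_P_symmetric:
  assumes "\<And>m. M \<le> m \<Longrightarrow> f m = 0"
  shows "inner M (P f) h = inner M f (P h)"
proof -
  have "(\<Sum>m\<le>M. w m * f m * (P h m - h m)) = (\<Sum>m\<le>M. w m * h m * (P f m - f m))"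
    unfolding sum_by_parts using assms by (simp add: algebra_simps)
  then show ?thesis
    by (simp add: inner_def sum_subtractf right_diff_distrib mult_ac)
qed

lemma P_support:
  assumes "\<And>m. M \<le> m \<Longrightarrow> f m = 0" "Suc M \<le> m"
  shows "P f m = 0"
  using assms by (simp add: P_def)

lemma P_linear: "P (\<lambda>m. a * f m + b * h m) m = a * P f m + b * P h m"
  using w_pos[of m] by (simp add: P_def field_simps)

lemma P_diff: "P (\<lambda>m. f m - h m) m = P f m - P h m"
  using P_linear[of 1 f "-1" h m] by simp

lemma P_weights:
  "P f m = (1 - (W m + (if m = 0 then 0 else W (m - 1))) / w m) * f m + W m / w m * f (Suc m)
     + (if m = 0 then 0 else W (m - 1)) / w m * f (m - 1)"
  using w_pos[of m] by (cases m) (auto simp: P_def field_simps)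

lemma holding: "\<epsilon> \<le> 1 - (W m + (if m = 0 then 0 else W (m - 1))) / w m"
  using hold[of m] w_pos[of m] by (simp add: field_simps split: if_splits)

lemma P_lower:
  assumes "\<And>m. 0 \<le> f m"
  shows "\<epsilon> * f m \<le> P f m"
proof -
  have "\<epsilon> * f m \<le> (1 - (W m + (if m = 0 then 0 else W (m - 1))) / w m) * f m"
    by (intro mult_right_mono holding assms)
  moreover have "0 \<le> W m / w m * f (Suc m)" "0 \<le> (if m = 0 then 0 else W (m - 1)) / w m * f (m - 1)"
    using assms less_imp_le[OF w_pos] less_imp_le[OF W_pos]
    by (auto intro!: mult_nonneg_nonneg divide_nonneg_nonneg)
  ultimately show ?thesis unfolding P_weights by linarith
qed

lemma P_nonneg: "(\<And>m. 0 \<le> f m) \<Longrightarrow> 0 \<le> P f m"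
  by (rule order_trans[OF _ P_lower]) (use eps_pos in auto)

lemma P_square_le: "(P f m)\<^sup>2 \<le> P (\<lambda>m. (f m)\<^sup>2) m"
proof -
  define A where "A = P f m"
  have "0 \<le> P (\<lambda>j. (f j - A)\<^sup>2) m" by (rule P_nonneg) simp
  also have "P (\<lambda>j. (f j - A)\<^sup>2) m = P (\<lambda>m. (f m)\<^sup>2) m - 2 * A * P f m + A\<^sup>2"
    using w_pos[of m] by (simp add: P_def field_simps power2_eq_square)
  finally show ?thesis by (simp add: A_def power2_eq_square)
qed

lemma P_contraction:
  assumes "\<And>m. M \<le> m \<Longrightarrow> f m = 0"
  shows "inner M (P f) (P f) \<le> inner M f f"
proof -
  have "inner M (P f) (P f) \<le> (\<Sum>m\<le>M. w m * P (\<lambda>m. (f m)\<^sup>2) m)"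
    unfolding inner_def
    by (intro sum_mono) (use P_square_le w_pos in \<open>auto simp: power2_eq_square mult.assoc intro!: mult_left_mono less_imp_le\<close>)
  also have "\<dots> = inner M (P (\<lambda>m. (f m)\<^sup>2)) (\<lambda>_. 1)" by (simp add: inner_def)
  also have "\<dots> = inner M (\<lambda>m. (f m)\<^sup>2) (P (\<lambda>_. 1))"
    by (rule inner_P_symmetric) (use assms in auto)
  also have "\<dots> = inner M f f"
    by (simp add: inner_def P_def power2_eq_square mult.assoc)
  finally show ?thesis .
qed

text \<open>
  The holding probability keeps the spectrum of \<open>P\<close> away from \<open>-1\<close>. The Dirichlet form is bounded
  by \<open>(x - y)^2 \<le> 2 x^2 + 2 y^2\<close> on each edge, and the edges at \<open>m\<close> carry at most \<open>(1 - \<epsilon>) w m\<close>.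
\<close>

lemma inner_ge:
  assumes "\<And>m. M \<le> m \<Longrightarrow> f m = 0"
  shows "2 * \<epsilon> * inner M f f \<le> inner M f (\<lambda>m. f m + P f m)"
proof -
  define Wl where "Wl m = (if m = 0 then 0 else W (m - 1))" for m :: nat
  have fM: "f M = 0" using assms by simp
  have 1: "inner M f (\<lambda>m. f m + P f m) = 2 * inner M f f - (\<Sum>m<M. W m * (f (Suc m) - f m)\<^sup>2)"
    using sum_by_parts[of f f M] fM
    by (simp add: inner_def algebra_simps sum.distrib sum_subtractf sum_distrib_left power2_eq_square)
  have 2: "(\<Sum>m<M. W m * (f (Suc m) - f m)\<^sup>2) \<le> (\<Sum>m<M. 2 * W m * ((f (Suc m))\<^sup>2 + (f m)\<^sup>2))"
  proof (rule sum_mono)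
    fix m
    have "0 \<le> W m * (f (Suc m) + f m)\<^sup>2" using W_pos[of m] by simp
    then show "W m * (f (Suc m) - f m)\<^sup>2 \<le> 2 * W m * ((f (Suc m))\<^sup>2 + (f m)\<^sup>2)"
      by (simp add: power2_eq_square algebra_simps)
  qed
  have 3: "(\<Sum>m<M. 2 * W m * ((f (Suc m))\<^sup>2 + (f m)\<^sup>2)) = (\<Sum>m\<le>M. 2 * (W m + Wl m) * (f m)\<^sup>2)"
  proof -
    have "(\<Sum>m<M. W m * ((f (Suc m))\<^sup>2 + (f m)\<^sup>2)) + W M * (f M)\<^sup>2 = (\<Sum>m\<le>M. (W m + Wl m) * (f m)\<^sup>2)"
      by (induction M) (auto simp: Wl_def algebra_simps)
    then have "2 * (\<Sum>m<M. W m * ((f (Suc m))\<^sup>2 + (f m)\<^sup>2)) = 2 * (\<Sum>m\<le>M. (W m + Wl m) * (f m)\<^sup>2)"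
      using fM by simp
    then show ?thesis by (simp only: sum_distrib_left mult.assoc)
  qed
  have 4: "(\<Sum>m\<le>M. 2 * (W m + Wl m) * (f m)\<^sup>2) \<le> (\<Sum>m\<le>M. 2 * ((1 - \<epsilon>) * w m) * (f m)\<^sup>2)"
    by (intro sum_mono mult_right_mono mult_left_mono) (use hold in \<open>auto simp: Wl_def\<close>)
  have "(\<Sum>m\<le>M. 2 * ((1 - \<epsilon>) * w m) * (f m)\<^sup>2) = 2 * (1 - \<epsilon>) * inner M f f"
    by (simp add: inner_def sum_distrib_left power2_eq_square mult_ac)
  with 1 2 3 4 show ?thesis by (simp add: algebra_simps)
qed

lemma inner_nonneg: "0 \<le> inner M f f"
  unfolding inner_def using less_imp_le[OF w_pos] by (intro sum_nonneg) (simp add: mult.assoc)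

lemma inner_Cauchy_Schwarz: "(inner M f h)\<^sup>2 \<le> inner M f f * inner M h h"
proof -
  have "(\<Sum>m\<le>M. (sqrt (w m) * f m) * (sqrt (w m) * h m))\<^sup>2
      \<le> (\<Sum>m\<le>M. (sqrt (w m) * f m)\<^sup>2) * (\<Sum>m\<le>M. (sqrt (w m) * h m)\<^sup>2)"
    by (rule Cauchy_Schwarz_ineq_sum)
  moreover have "sqrt (w m) * f m * (sqrt (w m) * h m) = w m * f m * h m" for m f h
    using w_pos[of m] by (simp add: mult_ac) 
  ultimately show ?thesis by (simp add: inner_def power2_eq_square)
qed

lemma plus_P_expanding:
  assumes "\<And>m. M \<le> m \<Longrightarrow> f m = 0"
  shows "(2 * \<epsilon>)\<^sup>2 * inner M f f \<le> inner M (\<lambda>m. f m + P f m) (\<lambda>m. f m + P f m)"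
proof (cases "inner M f f = 0")
  case True
  then show ?thesis using inner_nonneg by simp
next
  case False
  then have pos: "0 < inner M f f" using inner_nonneg[of M f] by simp
  have "(2 * \<epsilon> * inner M f f)\<^sup>2 \<le> (inner M f (\<lambda>m. f m + P f m))\<^sup>2"
    using inner_ge[OF assms] eps_pos pos by (intro power_mono) auto
  also have "\<dots> \<le> inner M f f * inner M (\<lambda>m. f m + P f m) (\<lambda>m. f m + P f m)"
    by (rule inner_Cauchy_Schwarz)
  finally show ?thesis using pos by (simp add: power2_eq_square mult_ac)
qed

lemma kernel_0: "kernel 0 m = of_bool (m = 0)" by (simp add: kernel_def)
lemma kernel_Suc: "kernel (Suc k) = P (kernel k)" by (simp add: kernel_def)

lemma kernel_support: "k < m \<Longrightarrow> kernel k m = 0"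
proof (induction k arbitrary: m)
  case (Suc k)
  show ?case unfolding kernel_Suc
    by (rule P_support[of "Suc k"]) (use Suc in auto)
qed (simp add: kernel_0)

lemma kernel_nonneg: "0 \<le> kernel k m"
  by (induction k arbitrary: m) (auto simp: kernel_0 kernel_Suc intro: P_nonneg)

lemma expect_eq_inner: "k \<le> M \<Longrightarrow> expect k h = inner M (kernel k) h"
  unfolding expect_def inner_def
  by (intro sum.mono_neutral_left) (auto simp: kernel_support)

lemma expect_0: "expect 0 h = h 0"
  by (simp add: expect_def kernel_0 w_0)

lemma expect_Suc: "expect (Suc k) h = expect k (P h)"
proof -
  have "expect (Suc k) h = inner (Suc k) (P (kernel k)) h"
    using expect_eq_inner[of "Suc k" "Suc k" h] by (simp only: kernel_Suc order_refl)
  also have "\<dots> = inner (Suc k) (kernel k) (P h)"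
    by (rule inner_P_symmetric) (simp add: kernel_support)
  finally show ?thesis using expect_eq_inner[of k "Suc k" "P h"] by simp
qed

lemma expect_mono: "(\<And>m. h m \<le> h' m) \<Longrightarrow> expect k h \<le> expect k h'"
  unfolding expect_def using w_pos kernel_nonneg
  by (intro sum_mono mult_left_mono mult_nonneg_nonneg) (auto intro: less_imp_le)

lemma expect_linear: "expect k (\<lambda>m. a * h m + b * h' m) = a * expect k h + b * expect k h'"
  by (simp add: expect_def sum.distrib sum_distrib_left algebra_simps)

lemma expect_scale: "expect k (\<lambda>m. a * h m) = a * expect k h"
  using expect_linear[of k a h 0 h] by simp

lemma expect_one: "expect k (\<lambda>_. 1) = 1"
proof (induction k)
  case (Suc k)
  have "P (\<lambda>_. 1) = (\<lambda>_. 1)" by (simp add: P_def fun_eq_iff)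
  then show ?case using Suc by (simp add: expect_Suc)
qed (simp add: expect_0)

lemma expect_delta: "expect k (\<lambda>m. of_bool (m = 0)) = kernel k 0"
proof -
  have "expect k (\<lambda>m. of_bool (m = 0)) = (\<Sum>m\<le>k. if m = 0 then kernel k 0 else 0)"
    unfolding expect_def by (intro sum.cong) (auto simp: w_0)
  then show ?thesis by simp
qed

text \<open>
  Dynkin's formula. Applied to suitable \<open>F\<close> it yields all moment bounds.
\<close>

lemma expect_poisson:
  assumes "\<And>m. P F m = F m + r m"
  shows "expect k F = F 0 + (\<Sum>i<k. expect i r)"
proof (induction k)
  case (Suc k)
  have "P F = (\<lambda>m. 1 * F m + 1 * r m)"
    using assms by (simp add: fun_eq_iff)
  then have "expect (Suc k) F = expect k (\<lambda>m. 1 * F m + 1 * r m)"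
    by (simp only: expect_Suc)
  also have "\<dots> = expect k F + expect k r"
    using expect_linear[of k 1 F 1 r] by simp
  finally show ?case using Suc by simp
qed (simp add: expect_0)

text \<open>
  The solution of \<open>(P - 1) F = r\<close> with \<open>F 0 = 0\<close>: the flux through the edge at \<open>i\<close> must be the total
  source below it.
\<close>

definition poisson :: "(nat \<Rightarrow> real) \<Rightarrow> nat \<Rightarrow> real" where
  "poisson r m = (\<Sum>i<m. (\<Sum>j\<le>i. w j * r j) / W i)"

lemma P_poisson: "P (poisson r) m = poisson r m + r m"
proof -
  have *: "W m * (poisson r (Suc m) - poisson r m) = (\<Sum>j\<le>m. w j * r j)" for m
    using W_pos[of m] by (simp add: poisson_def)
  have "w m * (P (poisson r) m - poisson r m) = w m * r m"
  proof (cases m)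
    case 0
    then show ?thesis unfolding P_flux * by simp
  next
    case (Suc m')
    then show ?thesis unfolding P_flux * using *[of m'] by simp
  qed
  then show ?thesis using w_pos[of m] by simp
qed


definition moment_const :: real where "moment_const = 6 * hi / lo"

lemma moment_const_pos: "0 < moment_const" using lo_pos hi_pos by (simp add: moment_const_def)

lemma sum_w_le: "(\<Sum>j\<le>m. w j) \<le> hi * real (Suc m) ^ 3"
proof -
  have "(\<Sum>j\<le>m. w j) \<le> (\<Sum>j\<le>m. hi * (real (Suc m))\<^sup>2)"
    by (intro sum_mono order_trans[OF w_hi] mult_left_mono power_mono) (use hi_pos in auto)
  then show ?thesis by (simp add: power3_eq_cube power2_eq_square mult_ac)
qed

text \<open>
  With source \<open>1\<close>, the solution \<open>F\<close> has expectation exactly \<open>k\<close> at time \<open>k\<close>, and it is bounded below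
  by a multiple of \<open>m^2\<close>.
\<close>

lemma expect_square_le: "expect k (\<lambda>m. (real m)\<^sup>2) \<le> moment_const * real k"
proof -
  have cubes: "real (Suc i) ^ 3 / 3 \<le> (\<Sum>j\<le>i. (real (Suc j))\<^sup>2)" for i
    by (induction i) (auto simp: power3_eq_cube power2_eq_square field_simps)
  have "lo / (6 * hi) * (real m)\<^sup>2 \<le> poisson (\<lambda>_. 1) m" for m
  proof -
    have "lo / (3 * hi) * real (Suc i) \<le> (\<Sum>j\<le>i. w j * 1) / W i" for i
    proof -
      have "lo * (real (Suc i) ^ 3 / 3) \<le> lo * (\<Sum>j\<le>i. (real (Suc j))\<^sup>2)"
        using cubes lo_pos by simp
      also have "\<dots> \<le> (\<Sum>j\<le>i. w j)"
        unfolding sum_distrib_left by (intro sum_mono w_lo)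
      finally have 1: "lo * (real (Suc i) ^ 3 / 3) \<le> (\<Sum>j\<le>i. w j)" .
      have "lo / (3 * hi) * real (Suc i) * W i \<le> lo / (3 * hi) * real (Suc i) * (hi * (real (Suc i))\<^sup>2)"
        using W_hi lo_pos hi_pos by (intro mult_left_mono) auto
      also have "\<dots> = lo * (real (Suc i) ^ 3 / 3)"
        using hi_pos by (simp add: power3_eq_cube power2_eq_square del: of_nat_Suc)
      finally have "lo / (3 * hi) * real (Suc i) * W i \<le> (\<Sum>j\<le>i. w j)" using 1 by (rule order_trans)
      then show ?thesis using W_pos[of i] by (simp only: pos_le_divide_eq mult_1_right)
    qed
    then have "(\<Sum>i<m. lo / (3 * hi) * real (Suc i)) \<le> poisson (\<lambda>_. 1) m"
      unfolding poisson_def by (intro sum_mono)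
    moreover have "(real m)\<^sup>2 / 2 \<le> (\<Sum>i<m. real (Suc i))"
      by (induction m) (auto simp: power2_eq_square field_simps)
    then have "lo / (3 * hi) * ((real m)\<^sup>2 / 2) \<le> lo / (3 * hi) * (\<Sum>i<m. real (Suc i))"
      using lo_pos hi_pos by (intro mult_left_mono) auto
    ultimately show ?thesis by (simp add: sum_distrib_left)
  qed
  then have "expect k (\<lambda>m. lo / (6 * hi) * (real m)\<^sup>2) \<le> expect k (poisson (\<lambda>_. 1))"
    by (rule expect_mono)
  also have "\<dots> = real k"
    using expect_poisson[of "poisson (\<lambda>_. 1)" "\<lambda>_. 1", OF P_poisson]
    by (simp add: expect_one poisson_def)
  finally have "lo / (6 * hi) * expect k (\<lambda>m. (real m)\<^sup>2) \<le> real k"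
    by (simp only: expect_scale)
  then show ?thesis using lo_pos hi_pos by (simp add: moment_const_def field_simps)
qed

lemma expect_linear_le: "expect k real \<le> (1 + moment_const) * sqrt (real (Suc k))"
proof -
  define s where "s = sqrt (real (Suc k))"
  have s: "0 < s" "s * s = real (Suc k)" by (simp_all add: s_def)
  have "real m \<le> s * 1 + 1 / s * (real m)\<^sup>2" for m
  proof -
    have "0 \<le> (s - real m)\<^sup>2" by simp
    also have "\<dots> \<le> s * s + (real m)\<^sup>2 - s * real m"
      using s(1) by (simp add: power2_eq_square algebra_simps)
    finally show ?thesis using s(1) by (simp add: divide_simps power2_eq_square algebra_simps)
  qed
  then have "expect k real \<le> expect k (\<lambda>m. s * 1 + 1 / s * (real m)\<^sup>2)"
    by (rule expect_mono)
  also have "\<dots> = s * expect k (\<lambda>_. 1) + 1 / s * expect k (\<lambda>m. (real m)\<^sup>2)"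
    by (rule expect_linear)
  also have "\<dots> \<le> s * 1 + 1 / s * (moment_const * (s * s))"
  proof (intro add_mono mult_left_mono)
    show "expect k (\<lambda>m. (real m)\<^sup>2) \<le> moment_const * (s * s)"
      unfolding s by (rule order_trans[OF expect_square_le]) (use moment_const_pos in auto)
  qed (use s expect_one in auto)
  also have "\<dots> = (1 + moment_const) * s" using s(1) by (simp add: algebra_simps)
  finally show ?thesis unfolding s_def .
qed

text \<open>
  With source \<open>1 / (m + 1)\<close>, the solution grows at most linearly, and \<open>expect_linear_le\<close> bounds
  its expectation.
\<close>

lemma sum_expect_inverse_le:
  "(\<Sum>i<k. expect i (\<lambda>m. 1 / real (Suc m))) \<le> hi / lo * (1 + moment_const) * sqrt (real (Suc k))"
proof -
  define G where "G = poisson (\<lambda>m. 1 / real (Suc m))"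
  have "G m \<le> hi / lo * real m" for m
  proof -
    have "(\<Sum>j\<le>i. w j * (1 / real (Suc j))) / W i \<le> hi / lo" for i
    proof -
      have "(\<Sum>j\<le>i. w j * (1 / real (Suc j))) \<le> (\<Sum>j\<le>i. hi * real (Suc i))"
      proof (rule sum_mono)
        fix j assume "j \<in> {..i}"
        have "w j * (1 / real (Suc j)) \<le> hi * (real (Suc j))\<^sup>2 * (1 / real (Suc j))"
          by (intro mult_right_mono w_hi) auto
        also have "\<dots> = hi * real (Suc j)" by (simp add: power2_eq_square)
        also have "\<dots> \<le> hi * real (Suc i)" using hi_pos \<open>j \<in> {..i}\<close> by simp
        finally show "w j * (1 / real (Suc j)) \<le> hi * real (Suc i)" .
      qed
      also have "\<dots> = hi / lo * (lo * (real (Suc i))\<^sup>2)"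
        using lo_pos by (simp add: power2_eq_square mult_ac)
      also have "\<dots> \<le> hi / lo * W i"
        using lo_pos hi_pos W_lo by (intro mult_left_mono) auto
      finally show ?thesis using W_pos[of i] by (simp add: divide_le_eq)
    qed
    then have "G m \<le> (\<Sum>i<m. hi / lo)"
      unfolding G_def poisson_def by (intro sum_mono)
    then show ?thesis by (simp add: mult.commute)
  qed
  then have "expect k G \<le> expect k (\<lambda>m. hi / lo * real m)" by (rule expect_mono)
  also have "\<dots> = hi / lo * expect k real" by (rule expect_scale)
  also have "\<dots> \<le> hi / lo * ((1 + moment_const) * sqrt (real (Suc k)))"
    using lo_pos hi_pos by (intro mult_left_mono expect_linear_le) auto
  finally show ?thesis
    using expect_poisson[of G, OF P_poisson[of "\<lambda>m. 1 / real (Suc m)", folded G_def], of k]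
    by (simp add: G_def poisson_def mult.assoc)
qed

text \<open>
  The Green function with pole at \<open>0\<close>, harmonic elsewhere. It exists because the resistances
  \<open>1 / W\<close> are summable, and it is of order \<open>1 / m\<close>.
\<close>

definition green :: "nat \<Rightarrow> real" where "green m = (\<Sum>j. 1 / W (m + j))"

lemma summable_W: "summable (\<lambda>j. 1 / W (m + j))"
proof (rule summable_comparison_test'[of "\<lambda>j. 1 / lo * (1 / (real (Suc (m + j)))\<^sup>2)" 0])
  show "summable (\<lambda>j. 1 / lo * (1 / (real (Suc (m + j)))\<^sup>2))"
    by (intro summable_mult sum_inverse_square_bounds)
  show "norm (1 / W (m + j)) \<le> 1 / lo * (1 / (real (Suc (m + j)))\<^sup>2)" for j
    using W_lo[of "m + j"] W_pos[of "m + j"] lo_pos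
    by (simp add: frac_le del: of_nat_Suc)
qed

lemma green_bounds: "1 / hi * (1 / real (Suc m)) \<le> green m" "green m \<le> 2 / lo * (1 / real (Suc m))"
proof -
  have "1 / hi * (1 / real (Suc m)) \<le> 1 / hi * (\<Sum>j. 1 / (real (Suc (m + j)))\<^sup>2)"
    using sum_inverse_square_bounds(2) hi_pos by (intro mult_left_mono) auto
  also have "\<dots> = (\<Sum>j. 1 / hi * (1 / (real (Suc (m + j)))\<^sup>2))"
    by (intro suminf_mult[symmetric] sum_inverse_square_bounds)
  also have "\<dots> \<le> green m" unfolding green_def
  proof (rule suminf_le)
    show "1 / hi * (1 / (real (Suc (m + j)))\<^sup>2) \<le> 1 / W (m + j)" for j
      using W_hi[of "m + j"] W_pos[of "m + j"] hi_pos by (simp add: frac_le del: of_nat_Suc)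
  qed (intro summable_mult sum_inverse_square_bounds summable_W)+
  finally show "1 / hi * (1 / real (Suc m)) \<le> green m" .
  have "green m \<le> (\<Sum>j. 1 / lo * (1 / (real (Suc (m + j)))\<^sup>2))" unfolding green_def
  proof (rule suminf_le)
    show "1 / W (m + j) \<le> 1 / lo * (1 / (real (Suc (m + j)))\<^sup>2)" for j
      using W_lo[of "m + j"] lo_pos by (simp add: frac_le del: of_nat_Suc)
  qed (intro summable_mult sum_inverse_square_bounds summable_W)+
  also have "\<dots> = 1 / lo * (\<Sum>j. 1 / (real (Suc (m + j)))\<^sup>2)"
    by (intro suminf_mult sum_inverse_square_bounds)
  also have "\<dots> \<le> 1 / lo * (2 / real (Suc m))"
    using sum_inverse_square_bounds(3) lo_pos by (intro mult_left_mono) auto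
  finally show "green m \<le> 2 / lo * (1 / real (Suc m))" by simp
qed

lemma P_green: "P green m = green m + - of_bool (m = 0)"
proof -
  have *: "W m * (green (Suc m) - green m) = - 1" for m
    using suminf_split_head[OF summable_W[of m]] W_pos[of m] by (simp add: green_def)
  have "w m * (P green m - green m) = - of_bool (m = 0)"
  proof (cases m)
    case 0
    then show ?thesis unfolding P_flux * by simp
  next
    case (Suc m')
    then show ?thesis unfolding P_flux * using *[of m'] by simp
  qed
  then show ?thesis using w_pos[of m] w_0 by (cases "m = 0") auto
qed

lemma expect_green: "expect k green = green 0 - (\<Sum>i<k. kernel i 0)"
proof -
  have "expect i (\<lambda>m. - of_bool (m = 0)) = - kernel i 0" for i
    using expect_scale[of i "-1" "\<lambda>m. of_bool (m = 0)"] by (simp add: expect_delta)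
  then show ?thesis
    using expect_poisson[of green, OF P_green, of k] by (simp add: sum_negf)
qed

lemma green_nonneg: "0 \<le> green m"
  by (rule order_trans[OF _ green_bounds(1)]) (use hi_pos in auto)

lemma expect_nonneg: "(\<And>m. 0 \<le> h m) \<Longrightarrow> 0 \<le> expect k h"
  using expect_mono[of "\<lambda>_. 0" h k] by (simp add: expect_def)

text \<open>
  The expectation decreases in time by \<open>expect_green\<close>, and its sum up to time \<open>k\<close> is of order
  \<open>k^(1/2)\<close> by \<open>sum_expect_inverse_le\<close>.
\<close>

lemma expect_green_le: "\<exists>C>0. \<forall>k. expect k green \<le> C * real (Suc k) powr - (1/2)"
proof -
  define C where "C = 2 / lo * (hi / lo * (1 + moment_const) * 2)"
  have "expect k green \<le> C * real (Suc k) powr - (1/2)" for k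
  proof -
    have "real (Suc k) * expect k green = (\<Sum>i<Suc k. expect k green)" by simp
    also have "\<dots> \<le> (\<Sum>i<Suc k. expect i green)"
    proof (rule sum_mono)
      fix i assume "i \<in> {..<Suc k}"
      then have "(\<Sum>j<i. kernel j 0) \<le> (\<Sum>j<k. kernel j 0)"
        by (intro sum_mono2) (auto simp: kernel_nonneg)
      then show "expect k green \<le> expect i green" by (simp add: expect_green)
    qed
    also have "\<dots> \<le> (\<Sum>i<Suc k. 2 / lo * expect i (\<lambda>m. 1 / real (Suc m)))"
      unfolding expect_scale[symmetric] by (intro sum_mono expect_mono green_bounds)
    also have "\<dots> = 2 / lo * (\<Sum>i<Suc k. expect i (\<lambda>m. 1 / real (Suc m)))"
      by (simp only: sum_distrib_left)
    also have "\<dots> \<le> 2 / lo * (hi / lo * (1 + moment_const) * sqrt (real (Suc (Suc k))))"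
      using lo_pos by (intro mult_left_mono sum_expect_inverse_le) auto
    also have "\<dots> \<le> 2 / lo * (hi / lo * (1 + moment_const) * (2 * sqrt (real (Suc k))))"
    proof -
      have "sqrt (real (Suc (Suc k))) \<le> sqrt (4 * real (Suc k))" by simp
      also have "\<dots> = 2 * sqrt (real (Suc k))" by (simp add: real_sqrt_mult del: of_nat_Suc)
      finally show ?thesis using lo_pos hi_pos moment_const_pos by (intro mult_left_mono) auto
    qed
    also have "\<dots> = C * sqrt (real (Suc k))" by (simp add: C_def)
    also have "\<dots> = real (Suc k) * (C * real (Suc k) powr - (1/2))"
      by (simp add: powr_minus powr_half_sqrt real_div_sqrt field_simps del: of_nat_Suc)
    finally show ?thesis by (simp del: of_nat_Suc)
  qed
  moreover have "0 < C" using lo_pos hi_pos moment_const_pos by (simp add: C_def)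
  ultimately show ?thesis by blast
qed

lemma expect_inverse_le: "\<exists>C>0. \<forall>k. expect k (\<lambda>m. 1 / real (Suc m)) \<le> C * real (Suc k) powr - (1/2)"
proof -
  obtain C where C: "C > 0" "\<And>k. expect k green \<le> C * real (Suc k) powr - (1/2)"
    using expect_green_le by blast
  have "expect k (\<lambda>m. 1 / real (Suc m)) \<le> hi * C * real (Suc k) powr - (1/2)" for k
  proof -
    have "1 / hi * expect k (\<lambda>m. 1 / real (Suc m)) \<le> expect k green"
      unfolding expect_scale[symmetric] by (intro expect_mono green_bounds)
    then have "expect k (\<lambda>m. 1 / real (Suc m)) \<le> hi * expect k green"
      using hi_pos by (simp add: field_simps)
    also have "\<dots> \<le> hi * (C * real (Suc k) powr - (1/2))"
      using C(2)[of k] hi_pos by (intro mult_left_mono) auto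
    finally show ?thesis by (simp only: mult.assoc)
  qed
  then show ?thesis using C hi_pos by (intro exI[of _ "hi * C"]) auto
qed


lemma expect_add: "expect (i + j) h = expect i ((P ^^ j) h)"
proof (induction j arbitrary: h)
  case (Suc j)
  have "expect (i + Suc j) h = expect (i + j) (P h)" by (simp add: expect_Suc)
  then show ?case using Suc by (simp add: funpow_swap1)
qed simp

lemma inner_kernel_kernel:
  assumes "i \<le> M"
  shows "inner M (kernel i) (kernel j) = kernel (i + j) 0"
proof -
  have "kernel (i + j) 0 = expect (i + j) (\<lambda>m. of_bool (m = 0))" by (simp add: expect_delta)
  also have "\<dots> = expect i (kernel j)" unfolding kernel_def by (rule expect_add)
  finally show ?thesis using expect_eq_inner[OF assms] by simp
qed

text \<open>
  Return probabilities at even times. In spectral terms \<open>ret k\<close> is the \<open>k\<close>-th moment of a measure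
  on \<open>[0, 1]\<close>, the spectral measure of \<open>P^2\<close>, so all its differences have alternating signs. The
  signs that are used below express that \<open>P\<close> contracts \<open>kernel k\<close> and \<open>diff2 k\<close>.
\<close>

definition ret :: "nat \<Rightarrow> real" where "ret k = kernel (2 * k) 0"
definition diff2 :: "nat \<Rightarrow> nat \<Rightarrow> real" where "diff2 k = (\<lambda>m. kernel k m - kernel (Suc (Suc k)) m)"
definition diff1 :: "nat \<Rightarrow> nat \<Rightarrow> real" where "diff1 k = (\<lambda>m. kernel k m - kernel (Suc k) m)"

lemma diff2_support: "k + 2 < m \<Longrightarrow> diff2 k m = 0" by (simp add: diff2_def kernel_support)
lemma diff1_support: "k + 1 < m \<Longrightarrow> diff1 k m = 0" by (simp add: diff1_def kernel_support)

lemma ret_nonneg: "0 \<le> ret k" by (simp add: ret_def kernel_nonneg)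

lemma ret_eq: "k \<le> M \<Longrightarrow> inner M (kernel k) (kernel k) = ret k"
  using inner_kernel_kernel[of k M k] by (simp add: ret_def mult_2)

lemma ret_decseq: "ret (Suc k) \<le> ret k"
proof -
  have "inner (Suc k) (P (kernel k)) (P (kernel k)) \<le> inner (Suc k) (kernel k) (kernel k)"
    by (rule P_contraction) (simp add: kernel_support)
  then show ?thesis by (simp add: ret_eq flip: kernel_Suc)
qed

lemma inner_diff_left: "inner M (\<lambda>m. f m - h m) l = inner M f l - inner M h l"
  by (simp add: inner_def left_diff_distrib right_diff_distrib sum_subtractf)

lemma inner_diff_right: "inner M l (\<lambda>m. f m - h m) = inner M l f - inner M l h"
  by (simp add: inner_def left_diff_distrib right_diff_distrib sum_subtractf)

lemma inner_diff2:
  assumes "k + 2 \<le> M"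
  shows "inner M (diff2 k) (diff2 k) = ret k - 2 * ret (Suc k) + ret (Suc (Suc k))"
proof -
  have "inner M (diff2 k) (diff2 k) = inner M (kernel k) (kernel k) - inner M (kernel k) (kernel (Suc (Suc k)))
      - (inner M (kernel (Suc (Suc k))) (kernel k) - inner M (kernel (Suc (Suc k))) (kernel (Suc (Suc k))))"
    by (simp only: diff2_def inner_diff_left inner_diff_right)
  moreover have "inner M (kernel k) (kernel k) = ret k" "inner M (kernel (Suc (Suc k))) (kernel (Suc (Suc k))) = ret (Suc (Suc k))"
    using assms by (auto intro!: ret_eq)
  moreover have "inner M (kernel k) (kernel (Suc (Suc k))) = ret (Suc k)" "inner M (kernel (Suc (Suc k))) (kernel k) = ret (Suc k)"
    using assms inner_kernel_kernel[of k M "Suc (Suc k)"] inner_kernel_kernel[of "Suc (Suc k)" M k] by (simp_all add: ret_def mult_2)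
  ultimately show ?thesis by linarith
qed

lemma ret_convex: "0 \<le> ret k - 2 * ret (Suc k) + ret (Suc (Suc k))"
  using inner_nonneg[of "k + 2" "diff2 k"] by (simp only: inner_diff2[OF order_refl])

lemma inner_diff2_decreasing: "inner (k + 4) (diff2 (Suc k)) (diff2 (Suc k)) \<le> inner (k + 4) (diff2 k) (diff2 k)"
proof -
  have "P (diff2 k) = diff2 (Suc k)"
    by (simp add: fun_eq_iff diff2_def P_diff kernel_Suc)
  then show ?thesis
    using P_contraction[of "k + 4" "diff2 k"] by (simp add: diff2_support)
qed

lemma inner_diff1_le: "k + 2 < M \<Longrightarrow> (2 * \<epsilon>)\<^sup>2 * inner M (diff1 k) (diff1 k) \<le> inner M (diff2 k) (diff2 k)"
proof -
  assume M: "k + 2 < M"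
  have "(\<lambda>m. diff1 k m + P (diff1 k) m) = diff2 k"
    by (simp add: fun_eq_iff diff1_def diff2_def P_diff kernel_Suc)
  then show ?thesis
    using plus_P_expanding[of M "diff1 k"] M by (simp add: diff1_support)
qed

text \<open>
  Sums of return probabilities over a block telescope to a difference of expectations of the
  Green function.
\<close>

lemma ret_decay: "\<exists>C>0. \<forall>k. ret k \<le> C * real (Suc k) powr - (3/2)"
proof -
  obtain C where C: "C > 0" "\<And>k. expect k green \<le> C * real (Suc k) powr - (1/2)"
    using expect_green_le by blast
  have "ret k \<le> C * 2 powr (1/2 + 1) * real (Suc k) powr - (1/2 + 1)" for k
  proof (rule decay_from_block_sums)
    show "decseq ret" by (rule decseq_SucI) (rule ret_decseq)
    fix j k :: nat assume "j \<le> k"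
    have "(\<Sum>i=j..k. ret i) = (\<Sum>i\<in>(\<lambda>i. 2 * i) ` {j..k}. kernel i 0)"
      by (subst sum.reindex) (auto simp: inj_on_def ret_def)
    also have "\<dots> \<le> (\<Sum>i\<in>{2*j..<2*k+1}. kernel i 0)"
      by (intro sum_mono2) (auto simp: kernel_nonneg)
    also have "\<dots> = (\<Sum>i<2*k+1. kernel i 0) - (\<Sum>i<2*j. kernel i 0)"
      using sum_diff_nat_ivl[of 0 "2*j" "2*k+1" "\<lambda>i. kernel i 0"] \<open>j \<le> k\<close>
      by (simp add: atLeast0LessThan)
    also have "\<dots> = expect (2*j) green - expect (2*k+1) green"
      by (simp add: expect_green)
    also have "\<dots> \<le> expect (2*j) green" using expect_nonneg[OF green_nonneg] by simp
    also have "\<dots> \<le> C * real (Suc (2*j)) powr - (1/2)" by (rule C)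
    also have "\<dots> \<le> C * real (Suc j) powr - (1/2)"
      using C by (intro mult_left_mono powr_mono2') auto
    finally show "(\<Sum>i=j..k. ret i) \<le> C * real (Suc j) powr - (1/2)" .
  qed (auto simp: ret_nonneg)
  then show ?thesis using C by (intro exI[of _ "C * 2 powr (1/2 + 1)"]) auto
qed

lemma second_difference_decay:
  "\<exists>C>0. \<forall>k. ret k - 2 * ret (Suc k) + ret (Suc (Suc k)) \<le> C * real (Suc k) powr - (7/2)"
proof -
  obtain C where C: "C > 0" "\<And>k. ret k \<le> C * real (Suc k) powr - (3/2)"
    using ret_decay by blast
  define b where "b k = ret k - ret (Suc k)" for k
  define c where "c k = b k - b (Suc k)" for k
  have c_eq: "c k = ret k - 2 * ret (Suc k) + ret (Suc (Suc k))" for k by (simp add: b_def c_def)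
  have b: "b k \<le> C * 2 powr (3/2 + 1) * real (Suc k) powr - (3/2 + 1)" for k
  proof (rule decay_from_block_sums)
    have "b (Suc k) \<le> b k" for k using ret_convex[of k] unfolding b_def by linarith
    then show "decseq b" by (rule decseq_SucI)
    show "0 \<le> b k" for k using ret_decseq[of k] by (simp add: b_def)
    fix j k :: nat assume "j \<le> k"
    have "(\<Sum>i=j..k. b i) = ret j - ret (Suc k)"
      unfolding b_def using \<open>j \<le> k\<close> by (induction k rule: dec_induct) (auto)
    also have "\<dots> \<le> C * real (Suc j) powr - (3/2)"
      using ret_nonneg[of "Suc k"] C(2)[of j] by linarith
    finally show "(\<Sum>i=j..k. b i) \<le> C * real (Suc j) powr - (3/2)" .
  qed auto
  have "c k \<le> C * 2 powr (3/2 + 1) * 2 powr (3/2 + 1 + 1) * real (Suc k) powr - (3/2 + 1 + 1)" for k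
  proof (rule decay_from_block_sums)
    have "c (Suc k) \<le> c k" for k
      using inner_diff2_decreasing[of k] by (simp add: inner_diff2 c_eq)
    then show "decseq c" by (rule decseq_SucI)
    show "0 \<le> c k" for k using ret_convex[of k] by (simp add: c_eq)
    fix j k :: nat assume "j \<le> k"
    have "(\<Sum>i=j..k. c i) = b j - b (Suc k)"
      unfolding c_def using \<open>j \<le> k\<close> by (induction k rule: dec_induct) (auto)
    also have "\<dots> \<le> C * 2 powr (3/2 + 1) * real (Suc j) powr - (3/2 + 1)"
      using ret_decseq[of "Suc k"] b[of j] unfolding b_def by linarith
    finally show "(\<Sum>i=j..k. c i) \<le> C * 2 powr (3/2 + 1) * real (Suc j) powr - (3/2 + 1)" .
  qed auto
  then show ?thesis using C
    by (intro exI[of _ "C * 2 powr (3/2 + 1) * 2 powr (3/2 + 1 + 1)"]) (auto simp: c_eq)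
qed

text \<open>
  The gradient at \<open>m\<close> times \<open>W m\<close> is the total of \<open>w * (P - 1) kernel\<close> below \<open>m\<close>. By Cauchy-Schwarz
  this is at most the square root of the volume, of order \<open>m^3\<close>, times the norm of \<open>diff1 k\<close>. The
  latter is controlled by a second difference of return probabilities, since
  \<open>1 - P^2 = (1 + P) (1 - P)\<close> and \<open>1 + P\<close> is bounded below.
\<close>

lemma gradient_raw:
  "\<exists>C>0. \<forall>k m. \<bar>kernel k (Suc m) - kernel k m\<bar> \<le> C * (real (Suc k) powr - (7/4) / sqrt (real (Suc m)))"
proof -
  obtain C where C: "C > 0" "\<And>k. ret k - 2 * ret (Suc k) + ret (Suc (Suc k)) \<le> C * real (Suc k) powr - (7/2)"
    using second_difference_decay by blast
  define D where "D = C * hi / (lo * 2 * \<epsilon>)\<^sup>2"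
  have D: "D > 0" using C hi_pos lo_pos eps_pos by (simp add: D_def)
  have "\<bar>kernel k (Suc m) - kernel k m\<bar> \<le> sqrt D * (real (Suc k) powr - (7/4) / sqrt (real (Suc m)))" for k m
  proof -
    define d where "d = kernel k (Suc m) - kernel k m"
    define M where "M = max m (k + 3)"
    define n where "n = real (Suc m)"
    have n: "n > 0" by (simp add: n_def)
    have "W m * d = - inner m (\<lambda>_. 1) (diff1 k)"
      using flux_eq[where f = "kernel k" and m = m]
      by (simp add: d_def inner_def diff1_def kernel_Suc sum_negf[symmetric] algebra_simps)
    then have "(W m * d)\<^sup>2 \<le> inner m (\<lambda>_. 1) (\<lambda>_. 1) * inner m (diff1 k) (diff1 k)"
      using inner_Cauchy_Schwarz[of m "\<lambda>_. 1" "diff1 k"] by simp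
    also have "\<dots> \<le> hi * n ^ 3 * inner M (diff1 k) (diff1 k)"
    proof (intro mult_mono)
      show "inner m (\<lambda>_. 1) (\<lambda>_. 1) \<le> hi * n ^ 3" using sum_w_le by (simp add: inner_def n_def)
      show "inner m (diff1 k) (diff1 k) \<le> inner M (diff1 k) (diff1 k)"
        unfolding inner_def M_def using less_imp_le[OF w_pos]
        by (intro sum_mono2) (auto simp: mult.assoc)
    qed (use hi_pos n inner_nonneg in auto)
    finally have 1: "(W m * d)\<^sup>2 \<le> hi * n ^ 3 * inner M (diff1 k) (diff1 k)" .
    have "(2 * \<epsilon>)\<^sup>2 * inner M (diff1 k) (diff1 k) \<le> C * real (Suc k) powr - (7/2)"
    proof -
      have M: "k + 2 < M" by (simp add: M_def)
      show ?thesis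
        using inner_diff1_le[OF M] inner_diff2[OF less_imp_le[OF M]] C(2)[of k] by linarith
    qed
    then have 2: "inner M (diff1 k) (diff1 k) \<le> C * real (Suc k) powr - (7/2) / (2 * \<epsilon>)\<^sup>2"
      using eps_pos by (simp add: field_simps)
    have "(lo * n\<^sup>2)\<^sup>2 * d\<^sup>2 \<le> (W m * d)\<^sup>2"
      unfolding power_mult_distrib[of "W m"] using W_lo[of m] lo_pos n
      by (intro mult_right_mono power_mono) (auto simp: n_def)
    also have "\<dots> \<le> hi * n ^ 3 * (C * real (Suc k) powr - (7/2) / (2 * \<epsilon>)\<^sup>2)"
      by (rule order_trans[OF 1], intro mult_left_mono 2) (use hi_pos n in auto)
    also have "\<dots> = (lo * n\<^sup>2)\<^sup>2 * (D * (real (Suc k) powr - (7/2) / n))"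
      using n lo_pos eps_pos by (simp add: D_def field_simps power2_eq_square power3_eq_cube)
    finally have "d\<^sup>2 \<le> D * (real (Suc k) powr - (7/2) / n)"
      by (rule mult_left_le_imp_le) (use n lo_pos in auto)
    then have "\<bar>d\<bar> \<le> sqrt (D * (real (Suc k) powr - (7/2) / n))"
      by (rule real_le_rsqrt[of "\<bar>d\<bar>", unfolded power2_abs])
    also have "\<dots> = sqrt D * (sqrt (real (Suc k) powr - (7/2)) / sqrt n)"
      by (simp only: real_sqrt_mult real_sqrt_divide)
    also have "sqrt (real (Suc k) powr - (7/2)) = real (Suc k) powr - (7/4)"
      using powr_powr[of "real (Suc k)" "- (7/2)" "1/2"] by (simp add: powr_half_sqrt)
    finally show ?thesis unfolding d_def n_def .
  qed
  then show ?thesis using D by (intro exI[of _ "sqrt D"]) auto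
qed

text \<open>
  With \<open>x = (m + 1)^(1/2) (k + 1)^(-1/4)\<close> this is \<open>x \<le> 1 + x^2\<close>. It replaces fractional powers by
  a bound that is linear in \<open>m\<close>.
\<close>

lemma interpolate:
  fixes n m :: nat
  shows "sqrt (real (Suc m)) * real (Suc k) powr - (7/4)
    \<le> real (Suc k) powr - (3/2) * (1 + real (Suc m) / sqrt (real (Suc k)))"
proof -
  define x where "x = sqrt (real (Suc m)) * real (Suc k) powr - (1/4)"
  have "0 \<le> (x - 1)\<^sup>2 + x" by (intro add_nonneg_nonneg) (auto simp: x_def)
  then have "x \<le> 1 + x\<^sup>2" by (simp add: power2_eq_square algebra_simps)
  also have "x\<^sup>2 = real (Suc m) / sqrt (real (Suc k))"
  proof -
    have "(real (Suc k) powr - (1/4))\<^sup>2 = real (Suc k) powr - (1/2)"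
      by (simp add: power2_eq_square flip: powr_add)
    moreover have "real (Suc k) powr - (1/2) = 1 / sqrt (real (Suc k))"
      by (simp only: powr_minus_divide powr_half_sqrt of_nat_0_le_iff)
    ultimately show ?thesis by (simp only: x_def power_mult_distrib real_sqrt_pow2 of_nat_0_le_iff) simp
  qed
  finally have "real (Suc k) powr - (3/2) * x \<le> real (Suc k) powr - (3/2) * (1 + real (Suc m) / sqrt (real (Suc k)))"
    by (intro mult_left_mono) auto
  moreover have "real (Suc k) powr - (3/2) * x = sqrt (real (Suc m)) * real (Suc k) powr - (7/4)"
  proof -
    have "real (Suc k) powr - (7/4) = real (Suc k) powr - (3/2) * real (Suc k) powr - (1/4)"
      by (simp only: powr_add[symmetric]) simp
    then show ?thesis unfolding x_def by (simp only: mult_ac)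
  qed
  ultimately show ?thesis by (simp only:)
qed

theorem gradient_le:
  "\<exists>C>0. \<forall>k m. real (Suc m) * \<bar>kernel k (Suc m) - kernel k m\<bar>
     \<le> C * real (Suc k) powr - (3/2) * (1 + real (Suc m) / sqrt (real (Suc k)))"
proof -
  obtain C where C: "C > 0" "\<And>k m. \<bar>kernel k (Suc m) - kernel k m\<bar> \<le> C * (real (Suc k) powr - (7/4) / sqrt (real (Suc m)))"
    using gradient_raw by blast
  have "real (Suc m) * \<bar>kernel k (Suc m) - kernel k m\<bar>
     \<le> C * real (Suc k) powr - (3/2) * (1 + real (Suc m) / sqrt (real (Suc k)))" for k m
  proof -
    have "real (Suc m) * \<bar>kernel k (Suc m) - kernel k m\<bar> \<le> real (Suc m) * (C * (real (Suc k) powr - (7/4) / sqrt (real (Suc m))))"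
      by (intro mult_left_mono C) auto
    also have "\<dots> = C * (sqrt (real (Suc m)) * real (Suc k) powr - (7/4))"
      by (simp add: divide_simps mult_ac flip: real_sqrt_mult power2_eq_square del: of_nat_Suc)
    also have "\<dots> \<le> C * (real (Suc k) powr - (3/2) * (1 + real (Suc m) / sqrt (real (Suc k))))"
      using C by (intro mult_left_mono interpolate) auto
    finally show ?thesis by (simp only: mult.assoc)
  qed
  then show ?thesis using C by blast
qed

theorem kernel_0_le: "\<exists>C>0. \<forall>k. kernel k 0 \<le> C * real (Suc k) powr - (3/2)"
proof -
  obtain C where C: "C > 0" "\<And>k. ret k \<le> C * real (Suc k) powr - (3/2)"
    using ret_decay by blast
  have "kernel k 0 \<le> C * 2 powr (3/2) * real (Suc k) powr - (3/2)" for k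
  proof -
    define j where "j = k div 2"
    have "kernel k 0 \<le> ret j"
    proof (cases "even k")
      case True
      then show ?thesis by (simp add: ret_def j_def)
    next
      case False
      then have k: "k = j + Suc j" unfolding j_def by presburger
      have "(kernel k 0)\<^sup>2 \<le> ret j * ret (Suc j)"
        using inner_Cauchy_Schwarz[of "Suc j" "kernel j" "kernel (Suc j)"] k
        by (simp add: inner_kernel_kernel[of j "Suc j" "Suc j"] ret_eq)
      also have "\<dots> \<le> (ret j)\<^sup>2"
        unfolding power2_eq_square by (intro mult_left_mono ret_decseq ret_nonneg)
      finally show ?thesis by (rule power2_le_imp_le) (rule ret_nonneg)
    qed
    also have "\<dots> \<le> C * real (Suc j) powr - (3/2)" by (rule C)
    also have "\<dots> \<le> C * (real (Suc k) / 2) powr - (3/2)"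
      using C by (intro mult_left_mono powr_mono2') (auto simp: j_def)
    also have "\<dots> = C * 2 powr (3/2) * real (Suc k) powr - (3/2)"
    proof -
      have "(x / 2) powr - r = 2 powr r * x powr - r" if "x > 0" for x r :: real
        using that by (simp add: powr_divide powr_minus divide_simps)
      from this[of "real (Suc k)" "3/2"] show ?thesis by (simp del: of_nat_Suc)
    qed
    finally show ?thesis .
  qed
  then show ?thesis using C by (intro exI[of _ "C * 2 powr (3/2)"]) auto
qed

theorem kernel_le:
  "\<exists>C>0. \<forall>k m. kernel k m \<le> C * real (Suc k) powr - (3/2) * (1 + real (Suc m) / sqrt (real (Suc k)))"
proof -
  obtain C1 where C1: "C1 > 0" "\<And>k. kernel k 0 \<le> C1 * real (Suc k) powr - (3/2)"
    using kernel_0_le by blast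
  obtain C2 where C2: "C2 > 0" "\<And>k m. \<bar>kernel k (Suc m) - kernel k m\<bar> \<le> C2 * (real (Suc k) powr - (7/4) / sqrt (real (Suc m)))"
    using gradient_raw by blast
  have "kernel k m \<le> (C1 + 2 * C2) * real (Suc k) powr - (3/2) * (1 + real (Suc m) / sqrt (real (Suc k)))" for k m
  proof -
    define K where "K = real (Suc k) powr - (3/2)"
    define r where "r = 1 + real (Suc m) / sqrt (real (Suc k))"
    have K: "K > 0" and r: "r \<ge> 1" by (simp_all add: K_def r_def)
    have "kernel k m - kernel k 0 = (\<Sum>j<m. kernel k (Suc j) - kernel k j)" by (simp add: sum_lessThan_telescope)
    also have "\<dots> \<le> (\<Sum>j<m. C2 * (real (Suc k) powr - (7/4) / sqrt (real (Suc j))))"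
      by (intro sum_mono order_trans[OF _ C2(2)]) auto
    also have "\<dots> = C2 * (real (Suc k) powr - (7/4) * (\<Sum>j<m. 1 / sqrt (real (Suc j))))"
      by (simp add: sum_distrib_left)
    also have "\<dots> \<le> C2 * (real (Suc k) powr - (7/4) * (2 * sqrt (real (Suc m))))"
      using C2 by (intro mult_left_mono order_trans[OF sum_inverse_sqrt_le]) auto
    also have "\<dots> = 2 * C2 * (sqrt (real (Suc m)) * real (Suc k) powr - (7/4))" by simp
    also have "\<dots> \<le> 2 * C2 * (K * r)"
      unfolding K_def r_def using C2 by (intro mult_left_mono interpolate) auto
    finally have "kernel k m \<le> kernel k 0 + 2 * C2 * (K * r)" by simp
    also have "kernel k 0 \<le> C1 * (K * r)"
    proof -
      have "C1 * K * 1 \<le> C1 * K * r" using C1 K r by (intro mult_left_mono) auto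
      with C1(2)[of k] show ?thesis by (simp add: K_def mult.assoc)
    qed
    finally show ?thesis unfolding K_def[symmetric] r_def[symmetric] by (simp add: algebra_simps)
  qed
  then show ?thesis using C1 C2 by (intro exI[of _ "C1 + 2 * C2"]) auto
qed

text \<open>
  By \<open>expect_square_le\<close> the chain is below a multiple of \<open>k^(1/2)\<close> with probability at least \<open>1/2\<close>.
  Cauchy-Schwarz on that range, of volume \<open>k^(3/2)\<close>, gives a lower bound for the squared norm of
  the kernel, which is a return probability.
\<close>

theorem kernel_0_ge: "\<exists>c>0. \<forall>k. c * real (Suc k) powr - (3/2) \<le> kernel k 0"
proof -
  define s where "s = 2 + sqrt (2 * moment_const)"
  define c where "c = 1 / (4 * hi * s ^ 3)"
  have s: "s > 0" using moment_const_pos by (simp add: s_def add_pos_pos)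
  have c: "c > 0" using s hi_pos by (simp add: c_def)
  have low: "c * real (Suc k) powr - (3/2) \<le> ret k" for k
  proof -
    define x where "x = sqrt (real (Suc k))"
    \<comment> \<open>the radius is chosen so that Chebyshev leaves mass at most \<open>1/2\<close> outside\<close>
    define K where "K = nat \<lceil>sqrt (2 * moment_const) * x\<rceil>"
    have x: "x \<ge> 1" "x * x = real (Suc k)" by (simp_all add: x_def)
    have K1: "sqrt (2 * moment_const) * x \<le> real (Suc K)" unfolding K_def by linarith
    have "real K \<le> sqrt (2 * moment_const) * x + 1"
      unfolding K_def using x moment_const_pos by (simp add: ceiling_correct less_imp_le nat_ceiling_le_eq)
    also have "\<dots> + 1 \<le> s * x" using x by (simp add: s_def algebra_simps)
    finally have K2: "real (Suc K) \<le> s * x" by simp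
    have *: "1 \<le> 1 * of_bool (m \<le> K) + 1 / (real (Suc K))\<^sup>2 * (real m)\<^sup>2" for m :: nat
    proof (cases "m \<le> K")
      case False
      then have "(real (Suc K))\<^sup>2 \<le> (real m)\<^sup>2" by (intro power_mono) auto
      with False show ?thesis by (simp add: field_simps del: of_nat_Suc)
    qed auto
    have "1 \<le> expect k (\<lambda>m. 1 * of_bool (m \<le> K) + 1 / (real (Suc K))\<^sup>2 * (real m)\<^sup>2)"
      using expect_mono[OF *, of k] by (simp only: expect_one)
    also have "\<dots> = expect k (\<lambda>m. of_bool (m \<le> K)) + 1 / (real (Suc K))\<^sup>2 * expect k (\<lambda>m. (real m)\<^sup>2)"
      using expect_linear[of k 1 "\<lambda>m. of_bool (m \<le> K)" "1 / (real (Suc K))\<^sup>2" "\<lambda>m. (real m)\<^sup>2"] by simp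
    also have "1 / (real (Suc K))\<^sup>2 * expect k (\<lambda>m. (real m)\<^sup>2) \<le> 1 / 2"
    proof -
      have "(sqrt (2 * moment_const) * x)\<^sup>2 \<le> (real (Suc K))\<^sup>2"
        using K1 x moment_const_pos by (intro power_mono) auto
      then have "2 * (moment_const * real (Suc k)) \<le> (real (Suc K))\<^sup>2"
        using moment_const_pos by (simp add: power_mult_distrib x_def)
      moreover have "expect k (\<lambda>m. (real m)\<^sup>2) \<le> moment_const * real (Suc k)"
        by (rule order_trans[OF expect_square_le]) (use moment_const_pos in auto)
      ultimately have "2 * expect k (\<lambda>m. (real m)\<^sup>2) \<le> (real (Suc K))\<^sup>2" by linarith
      then show ?thesis by (simp add: field_simps del: of_nat_Suc)
    qed
    finally have "1 / 2 \<le> expect k (\<lambda>m. of_bool (m \<le> K))" by simp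
    also have "\<dots> = inner K (kernel k) (\<lambda>_. 1)"
    proof -
      have "expect k (\<lambda>m. of_bool (m \<le> K)) = (\<Sum>m\<le>max k K. w m * kernel k m * of_bool (m \<le> K))"
        by (simp add: expect_eq_inner[of k "max k K"] inner_def)
      also have "\<dots> = (\<Sum>m\<le>K. w m * kernel k m * of_bool (m \<le> K))"
        by (intro sum.mono_neutral_right) auto
      also have "\<dots> = inner K (kernel k) (\<lambda>_. 1)" unfolding inner_def by (intro sum.cong) auto
      finally show ?thesis .
    qed
    finally have "(1 / 2)\<^sup>2 \<le> (inner K (kernel k) (\<lambda>_. 1))\<^sup>2" by (intro power_mono) auto
    also have "\<dots> \<le> inner K (kernel k) (kernel k) * inner K (\<lambda>_. 1) (\<lambda>_. 1)"
      by (rule inner_Cauchy_Schwarz)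
    also have "\<dots> \<le> ret k * (hi * (s * x) ^ 3)"
    proof (intro mult_mono)
      have "inner K (kernel k) (kernel k) \<le> inner (max k K) (kernel k) (kernel k)"
        unfolding inner_def using less_imp_le[OF w_pos]
        by (intro sum_mono2) (auto simp: mult.assoc)
      then show "inner K (kernel k) (kernel k) \<le> ret k" by (simp add: ret_eq)
      have "inner K (\<lambda>_. 1) (\<lambda>_. 1) \<le> hi * real (Suc K) ^ 3" using sum_w_le by (simp add: inner_def)
      also have "\<dots> \<le> hi * (s * x) ^ 3" using K2 hi_pos by (intro mult_left_mono power_mono) auto
      finally show "inner K (\<lambda>_. 1) (\<lambda>_. 1) \<le> hi * (s * x) ^ 3" .
    qed (auto simp: ret_nonneg inner_nonneg)
    finally have "1 / 4 \<le> ret k * (hi * s ^ 3) * x ^ 3" by (simp add: power2_eq_square power_mult_distrib mult_ac)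
    then have "c * (1 / x ^ 3) \<le> ret k"
      using s hi_pos x unfolding c_def by (simp add: field_simps)
    moreover have "1 / x ^ 3 = real (Suc k) powr - (3/2)"
    proof -
      have "x = real (Suc k) powr (1/2)" by (simp add: x_def powr_half_sqrt)
      then have "x ^ 3 = real (Suc k) powr (3/2)"
        unfolding power3_eq_cube by (simp only: powr_add[symmetric]) simp
      then show ?thesis by (simp only: powr_minus_divide)
    qed
    ultimately show ?thesis by simp
  qed
  \<comment> \<open>odd times cost one step of holding at \<open>0\<close>\<close>
  have eps1: "\<epsilon> \<le> 1" using hold[of 0] w_0 W_pos[of 0] by simp
  have "c * \<epsilon> * real (Suc k) powr - (3/2) \<le> kernel k 0" for k
  proof -
    define j where "j = k div 2"
    have "\<epsilon> * ret j \<le> kernel k 0"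
    proof (cases "even k")
      case True
      then have "kernel k 0 = ret j" by (simp add: ret_def j_def)
      then show ?thesis using eps1 mult_right_mono[OF eps1 ret_nonneg[of j]] by simp
    next
      case False
      then have k: "k = Suc (2 * j)" by (simp add: j_def)
      show ?thesis unfolding k kernel_Suc ret_def by (rule P_lower) (rule kernel_nonneg)
    qed
    moreover have "c * real (Suc k) powr - (3/2) \<le> c * real (Suc j) powr - (3/2)"
      using c by (intro mult_left_mono powr_mono2') (auto simp: j_def)
    then have "\<epsilon> * (c * real (Suc k) powr - (3/2)) \<le> \<epsilon> * ret j"
      using low[of j] eps_pos by (intro mult_left_mono) auto
    ultimately show ?thesis by (simp add: mult_ac)
  qed
  then show ?thesis using c eps_pos by (intro exI[of _ "c * \<epsilon>"]) auto
qed

end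

section \<open>Transfer matrices and their harmonic function\<close>

text \<open>
  With \<open>r = q^(1/(p+1))\<close>, one factor \<open>r^m\<close> absorbs each factor \<open>m + 1\<close>, since
  \<open>(m + 1) r^m \<le> 1 + r + \<dots> + r^m\<close>, and one such factor is left for summation.
\<close>

lemma sum_poly_geometric_bounded:
  fixes q :: real
  assumes "0 \<le> q" "q < 1"
  shows "\<exists>C>0. \<forall>n. (\<Sum>m<n. real (Suc m) ^ p * q ^ m) \<le> C"
proof -
  define r where "r = root (Suc p) q"
  have r: "0 \<le> r" "r < 1" "r ^ Suc p = q"
    using assms by (simp_all add: r_def real_root_pow_pos2 del: power_Suc)
  have geo: "(\<Sum>i<n. r ^ i) \<le> 1 / (1 - r)" for n
    using r by (simp add: sum_gp_strict divide_right_mono)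
  have decay: "real (Suc m) * r ^ m \<le> 1 / (1 - r)" for m
  proof -
    have "real (Suc m) * r ^ m = (\<Sum>i<Suc m. r ^ m)" by simp
    also have "\<dots> \<le> (\<Sum>i<Suc m. r ^ i)"
      using r by (intro sum_mono power_decreasing) auto
    finally show ?thesis using geo[of "Suc m"] by linarith
  qed
  have "(\<Sum>m<n. real (Suc m) ^ p * q ^ m) \<le> (1 / (1 - r)) ^ p * (1 / (1 - r))" for n
  proof -
    have "(\<Sum>m<n. real (Suc m) ^ p * q ^ m) \<le> (\<Sum>m<n. (1 / (1 - r)) ^ p * r ^ m)"
    proof (rule sum_mono)
      fix m
      have "q ^ m = (r ^ m) ^ p * r ^ m"
        unfolding r(3)[symmetric] power_mult[symmetric] by (simp add: power_add mult.commute)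
      then have "real (Suc m) ^ p * q ^ m = (real (Suc m) * r ^ m) ^ p * r ^ m"
        by (simp add: power_mult_distrib del: of_nat_Suc)
      also have "\<dots> \<le> (1 / (1 - r)) ^ p * r ^ m"
        using r by (intro mult_right_mono power_mono decay) auto
      finally show "real (Suc m) ^ p * q ^ m \<le> (1 / (1 - r)) ^ p * r ^ m" .
    qed
    also have "\<dots> \<le> (1 / (1 - r)) ^ p * (1 / (1 - r))"
      unfolding sum_distrib_left[symmetric] using r by (intro mult_left_mono geo) auto
    finally show ?thesis .
  qed
  then show ?thesis using r by (intro exI[of _ "(1 / (1 - r)) ^ p * (1 / (1 - r))"]) auto
qed

text \<open>
  The \<open>q\<close>-Pochhammer symbol \<open>(x; q)_n\<close>.
\<close>

definition qpoch :: "real \<Rightarrow> real \<Rightarrow> nat \<Rightarrow> real" where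
  "qpoch q x n = (\<Prod>i<n. 1 - x * q ^ i)"

lemma qpoch_Suc: "qpoch q x (Suc n) = qpoch q x n * (1 - x * q ^ n)"
  by (simp add: qpoch_def)

lemma qpoch_0 [simp]: "qpoch q x 0 = 1"
  by (simp add: qpoch_def)

lemma qpoch_bounds:
  assumes q: "0 \<le> q" "q < 1" and x: "\<bar>x\<bar> < 1"
  shows "\<exists>c>0. \<exists>C>0. \<forall>n. c \<le> qpoch q x n \<and> qpoch q x n \<le> C"
proof -
  define r where "r = \<bar>x\<bar>"
  have geo: "(\<Sum>i<n. q ^ i) \<le> 1 / (1 - q)" for n
    using q by (simp add: sum_gp_strict divide_right_mono)
  have xq: "\<bar>x * q ^ i\<bar> \<le> r" "\<bar>x * q ^ i\<bar> \<le> q ^ i" for i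
    using q x mult_left_mono[OF power_le_one[OF q(1) less_imp_le[OF q(2)], of i], of r]
      mult_right_mono[of r 1 "q ^ i"]
    by (simp_all add: r_def abs_mult)
  have "exp (- (1 / (1 - r) * (1 / (1 - q)))) \<le> qpoch q x n" for n
  proof -
    have "exp (- (1 / (1 - r) * (1 / (1 - q)))) \<le> exp (\<Sum>i<n. - (1 / (1 - r) * q ^ i))"
      unfolding sum_negf sum_distrib_left[symmetric] exp_le_cancel_iff neg_le_iff_le
      using x by (intro mult_left_mono geo) (auto simp: r_def)
    also have "\<dots> = (\<Prod>i<n. exp (- (1 / (1 - r) * q ^ i)))" by (rule exp_sum) simp
    also have "\<dots> \<le> qpoch q x n" unfolding qpoch_def
    proof (intro prod_mono conjI)
      fix i
      define t where "t = \<bar>x * q ^ i\<bar>"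
      have t: "0 \<le> t" "t \<le> r" "r < 1" "t \<le> q ^ i" using xq[of i] x by (auto simp: t_def r_def)
      have "1 / (1 - t) = 1 + t / (1 - t)" using t by (simp add: field_simps)
      also have "\<dots> \<le> exp (t / (1 - t))" by (rule exp_ge_add_one_self)
      also have "\<dots> \<le> exp (1 / (1 - r) * q ^ i)"
        using t by (simp add: frac_le)
      finally have "exp (- (1 / (1 - r) * q ^ i)) \<le> 1 - t"
        using t by (simp add: exp_minus field_simps)
      also have "\<dots> \<le> 1 - x * q ^ i" by (simp add: t_def)
      finally show "exp (- (1 / (1 - r) * q ^ i)) \<le> 1 - x * q ^ i" .
    qed simp
    finally show ?thesis .
  qed
  moreover have "qpoch q x n \<le> exp (1 / (1 - q))" for n
  proof -
    have "qpoch q x n \<le> (\<Prod>i<n. exp (q ^ i))" unfolding qpoch_def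
    proof (intro prod_mono conjI)
      fix i
      show "0 \<le> 1 - x * q ^ i" using xq[of i] x by (simp add: r_def abs_le_iff)
      show "1 - x * q ^ i \<le> exp (q ^ i)"
        using xq(2)[of i] exp_ge_add_one_self[of "q ^ i"] unfolding abs_le_iff by linarith
    qed
    also have "\<dots> = exp (\<Sum>i<n. q ^ i)" by (simp add: exp_sum)
    also have "\<dots> \<le> exp (1 / (1 - q))" using geo by simp
    finally show ?thesis .
  qed
  ultimately show ?thesis
    by (meson exp_gt_zero)
qed

text \<open>
  The range \<open>\<bar>u\<bar>, \<bar>v\<bar> < 1\<close> is the maximal current phase; \<open>u, v > -1\<close> holds for positive boundary
  rates.
\<close>

locale asep_matrices =
  fixes q u v :: real
  assumes q: "0 \<le> q" "q < 1" and u: "\<bar>u\<bar> < 1" and v: "\<bar>v\<bar> < 1"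
begin

text \<open>
  With \<open>d = dstep - 1\<close> and \<open>e = estep - 1\<close>, the choice of \<open>c\<close> gives the \<open>q\<close>-oscillator relation
  \<open>d e - q e d = 1 - q\<close>. In this representation both boundary vectors are \<open>\<delta>\<^sub>0\<close> and no entry is
  negative.
\<close>

definition c :: "nat \<Rightarrow> real" where "c m = (1 - q ^ m) * (1 - u * v * q ^ (m - 1))"

definition dstep :: "(nat \<Rightarrow> real) \<Rightarrow> nat \<Rightarrow> real" where
  "dstep f m = (1 + v * q ^ m) * f m + c (Suc m) * f (Suc m)"

definition estep :: "(nat \<Rightarrow> real) \<Rightarrow> nat \<Rightarrow> real" where
  "estep f m = (1 + u * q ^ m) * f m + (if m = 0 then 0 else f (m - 1))"

definition T :: "(nat \<Rightarrow> real) \<Rightarrow> nat \<Rightarrow> real" where "T f m = dstep f m + estep f m"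

definition R :: "nat \<Rightarrow> nat \<Rightarrow> real" where "R k = (T ^^ k) (\<lambda>m. of_bool (m = 0))"

definition \<pi> :: "nat \<Rightarrow> real" where "\<pi> m = (\<Prod>i<m. c (Suc i))"

lemma uv: "\<bar>u * v\<bar> < 1"
  using u v by (simp add: abs_mult) (metis abs_ge_zero mult_left_less_imp_less mult.right_neutral mult_less_cancel_left2 order_le_less_trans mult_strict_mono zero_less_one)

lemma \<pi>_eq: "\<pi> m = qpoch q q m * qpoch q (u * v) m"
  by (simp add: \<pi>_def qpoch_def c_def prod.distrib)

lemma \<pi>_Suc: "\<pi> (Suc m) = \<pi> m * c (Suc m)"
  by (simp add: \<pi>_def)

lemma \<pi>_bounds: "\<exists>lo>0. \<exists>hi>0. \<forall>m. lo \<le> \<pi> m \<and> \<pi> m \<le> hi"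
proof -
  obtain c1 C1 where 1: "c1 > 0" "C1 > 0" "\<And>n. c1 \<le> qpoch q q n" "\<And>n. qpoch q q n \<le> C1"
    using qpoch_bounds[OF q, of q] q by auto
  obtain c2 C2 where 2: "c2 > 0" "C2 > 0" "\<And>n. c2 \<le> qpoch q (u * v) n" "\<And>n. qpoch q (u * v) n \<le> C2"
    using qpoch_bounds[OF q uv] by auto
  have "c1 * c2 \<le> \<pi> m" for m
    unfolding \<pi>_eq using 1 2 by (intro mult_mono) (auto intro: order_trans[of 0 c1])
  moreover have "\<pi> m \<le> C1 * C2" for m
    unfolding \<pi>_eq using 1 2 by (intro mult_mono) (auto intro: order_trans[of 0 c2])
  moreover have "0 < c1 * c2" "0 < C1 * C2" using 1 2 by auto
  ultimately show ?thesis by blast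
qed

lemma \<pi>_pos: "0 < \<pi> m"
  using \<pi>_bounds by (meson less_le_trans)

lemma c_pos: "0 < c (Suc m)"
  using \<pi>_pos[of m] \<pi>_pos[of "Suc m"] by (simp add: \<pi>_Suc zero_less_mult_iff)

text \<open>
  By the \<open>q\<close>-binomial theorem \<open>coef x\<close> has generating function \<open>(x t; q)\<^sub>\<infinity> / (t; q)\<^sub>\<infinity>\<close>. Hence
  \<open>coef_conv\<close> has generating function \<open>(u t; q)\<^sub>\<infinity> (v t; q)\<^sub>\<infinity> / (t; q)\<^sub>\<infinity>^2\<close>; it is an
  Al-Salam-Chihara polynomial at the upper edge of the spectrum, up to normalization. As
  \<open>\<bar>u\<bar>, \<bar>v\<bar> < 1\<close>, both \<open>coef u\<close> and \<open>coef v\<close> are bounded above and away from \<open>0\<close>, so that \<open>\<phi>\<close> grows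
  linearly.
\<close>

definition coef :: "real \<Rightarrow> nat \<Rightarrow> real" where "coef x n = qpoch q x n / qpoch q q n"

definition coef_conv :: "nat \<Rightarrow> real" where "coef_conv n = (\<Sum>i=0..n. coef u i * coef v (n - i))"

definition \<phi> :: "nat \<Rightarrow> real" where "\<phi> m = coef_conv m / qpoch q (u * v) m"

lemma q_power_Suc_less: "q ^ Suc n < 1"
  using power_decreasing[of 1 "Suc n" q] q by simp

lemma coef_Suc: "(1 - q ^ Suc n) * coef x (Suc n) = (1 - x * q ^ n) * coef x n"
  using q_power_Suc_less[of n] by (simp add: coef_def qpoch_Suc)

text \<open>
  Scaling \<open>t\<close> to \<open>q t\<close> in the generating function multiplies it by
  \<open>(1 - t)^2 / ((1 - u t) (1 - v t))\<close>.
\<close>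

lemma coef_conv_recurrence:
  "(1 - q ^ Suc n) * coef_conv (Suc n) = (2 - (u + v) * q ^ n) * coef_conv n
     - (if n = 0 then 0 else (1 - u * v * q ^ (n - 1)) * coef_conv (n - 1))"
proof -
  define scale where "scale f = Abs_fps (\<lambda>n. q ^ n * fps_nth f n)" for f :: "real fps"
  define F where "F x = Abs_fps (coef x)" for x
  have scale_mult: "scale (f * g) = scale f * scale g" for f g
    by (rule fps_ext)
       (auto simp: scale_def fps_mult_nth sum_distrib_left power_add[symmetric] mult_ac intro!: sum.cong)
  have F: "(1 - fps_X) * F x = (1 - fps_const x * fps_X) * scale (F x)" for x
  proof (rule fps_ext)
    fix n
    show "fps_nth ((1 - fps_X) * F x) n = fps_nth ((1 - fps_const x * fps_X) * scale (F x)) n"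
      using coef_Suc[of "n - 1" x]
      by (cases n) (simp_all add: left_diff_distrib mult.assoc F_def scale_def algebra_simps)
  qed
  have SF: "F u * F v = Abs_fps coef_conv" by (rule fps_ext) (simp add: F_def fps_mult_nth coef_conv_def)
  have "(1 - fps_X) * (1 - fps_X) * Abs_fps coef_conv
      = (1 - fps_const u * fps_X) * (1 - fps_const v * fps_X) * scale (Abs_fps coef_conv)"
    using F[of u] F[of v] unfolding SF[symmetric] scale_mult
    by (metis (no_types, opaque_lifting) mult.assoc mult.commute)
  then have "Abs_fps coef_conv - fps_const 2 * (fps_X * Abs_fps coef_conv) + fps_X * (fps_X * Abs_fps coef_conv)
     = scale (Abs_fps coef_conv) - fps_const (u + v) * (fps_X * scale (Abs_fps coef_conv))
       + fps_const (u * v) * (fps_X * (fps_X * scale (Abs_fps coef_conv)))"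
    by (simp add: algebra_simps numeral_fps_const flip: fps_const_mult fps_const_add)
  then have "fps_nth (Abs_fps coef_conv - fps_const 2 * (fps_X * Abs_fps coef_conv) + fps_X * (fps_X * Abs_fps coef_conv)) (Suc n)
     = fps_nth (scale (Abs_fps coef_conv) - fps_const (u + v) * (fps_X * scale (Abs_fps coef_conv))
       + fps_const (u * v) * (fps_X * (fps_X * scale (Abs_fps coef_conv)))) (Suc n)"
    by simp
  then show ?thesis
    by (cases n) (simp_all add: scale_def algebra_simps)
qed

lemma qpoch_uv_pos: "0 < qpoch q (u * v) m"
  using qpoch_bounds[OF q uv] by (meson less_le_trans)

lemma T_\<phi>: "T \<phi> m = 4 * \<phi> m"
proof -
  have 1: "c (Suc m) * \<phi> (Suc m) = (1 - q ^ Suc m) * coef_conv (Suc m) / qpoch q (u * v) m"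
    using qpoch_uv_pos[of m] qpoch_uv_pos[of "Suc m"]
    by (simp add: c_def \<phi>_def qpoch_Suc zero_less_mult_iff)
  have 2: "(if m = 0 then 0 else (1 - u * v * q ^ (m - 1)) * coef_conv (m - 1)) / qpoch q (u * v) m
      = (if m = 0 then 0 else \<phi> (m - 1))"
    using qpoch_uv_pos[of m] qpoch_uv_pos[of "m - 1"]
    by (cases m) (auto simp: \<phi>_def qpoch_Suc zero_less_mult_iff)
  have "c (Suc m) * \<phi> (Suc m) = (2 - (u + v) * q ^ m) * \<phi> m - (if m = 0 then 0 else \<phi> (m - 1))"
    unfolding 1 coef_conv_recurrence diff_divide_distrib 2 by (simp add: \<phi>_def)
  then show ?thesis by (simp add: T_def dstep_def estep_def algebra_simps)
qed

lemma \<phi>_bounds: "\<exists>lo>0. \<exists>hi>0. \<forall>m. lo * real (Suc m) \<le> \<phi> m \<and> \<phi> m \<le> hi * real (Suc m)"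
proof -
  have coef_bounds: "\<exists>c>0. \<exists>C>0. \<forall>n. c \<le> coef x n \<and> coef x n \<le> C" if x: "\<bar>x\<bar> < 1" for x
  proof -
    obtain c1 C1 where 1: "c1 > 0" "C1 > 0" "\<And>n. c1 \<le> qpoch q q n" "\<And>n. qpoch q q n \<le> C1"
      using qpoch_bounds[OF q, of q] q by auto
    obtain c2 C2 where 2: "c2 > 0" "C2 > 0" "\<And>n. c2 \<le> qpoch q x n" "\<And>n. qpoch q x n \<le> C2"
      using qpoch_bounds[OF q x] by auto
    have "c2 / C1 \<le> coef x n" "coef x n \<le> C2 / c1" for n
      using 1(1,2) 1(3,4)[of n] 2(1,2) 2(3,4)[of n] unfolding coef_def by (auto intro!: frac_le)
    moreover have "0 < c2 / C1" "0 < C2 / c1" using 1 2 by auto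
    ultimately show ?thesis by blast
  qed
  obtain c1 C1 where 1: "c1 > 0" "C1 > 0" "\<And>n. c1 \<le> coef u n" "\<And>n. coef u n \<le> C1"
    using coef_bounds[OF u] by auto
  obtain c2 C2 where 2: "c2 > 0" "C2 > 0" "\<And>n. c2 \<le> coef v n" "\<And>n. coef v n \<le> C2"
    using coef_bounds[OF v] by auto
  obtain c3 C3 where 3: "c3 > 0" "C3 > 0" "\<And>n. c3 \<le> qpoch q (u * v) n" "\<And>n. qpoch q (u * v) n \<le> C3"
    using qpoch_bounds[OF q uv] by auto
  have Alo: "0 \<le> coef u n" "0 \<le> coef v n" for n
    using 1(1) 1(3)[of n] 2(1) 2(3)[of n] by linarith+
  have lo: "c1 * c2 * real (Suc m) \<le> coef_conv m" for m
  proof -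
    have "(\<Sum>i=0..m. c1 * c2) \<le> coef_conv m" unfolding coef_conv_def
      using 1 2 Alo by (intro sum_mono mult_mono) auto
    then show ?thesis by (simp add: mult.commute)
  qed
  have hi: "coef_conv m \<le> C1 * C2 * real (Suc m)" for m
  proof -
    have "coef_conv m \<le> (\<Sum>i=0..m. C1 * C2)" unfolding coef_conv_def
      using 1 2 Alo by (intro sum_mono mult_mono) auto
    then show ?thesis by (simp add: mult.commute)
  qed
  have "c1 * c2 / C3 * real (Suc m) \<le> \<phi> m" for m
  proof -
    have "c1 * c2 * real (Suc m) / C3 \<le> \<phi> m" unfolding \<phi>_def
      using lo[of m] 1 2 3 qpoch_uv_pos[of m] by (intro frac_le) (auto intro: order_trans[OF _ lo[of m]])
    then show ?thesis by simp
  qed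
  moreover have "\<phi> m \<le> C1 * C2 / c3 * real (Suc m)" for m
  proof -
    have "\<phi> m \<le> C1 * C2 * real (Suc m) / c3" unfolding \<phi>_def
      using hi[of m] 1 2 3 qpoch_uv_pos[of m] by (intro frac_le) auto
    then show ?thesis by simp
  qed
  moreover have "0 < c1 * c2 / C3" "0 < C1 * C2 / c3" using 1 2 3 by auto
  ultimately show ?thesis by blast
qed

lemma \<phi>_pos: "0 < \<phi> m"
proof -
  obtain lo where "lo > 0" "\<And>m. lo * real (Suc m) \<le> \<phi> m" using \<phi>_bounds by blast
  then show ?thesis by (meson less_le_trans mult_pos_pos of_nat_0_less_iff zero_less_Suc)
qed

lemma \<phi>_0: "\<phi> 0 = 1"
  by (simp add: \<phi>_def coef_conv_def coef_def)

lemma c_near_1: "\<bar>c (Suc m) - 1\<bar> \<le> 3 * q ^ m"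
proof -
  have b: "0 \<le> q ^ m" "q ^ m \<le> 1" "q ^ Suc m \<le> q ^ m" "0 \<le> q ^ Suc m" "q ^ Suc m \<le> 1"
    using q by (auto intro!: power_le_one mult_nonneg_nonneg power_decreasing mult_le_one simp: mult_left_le_one_le)
  have uvq: "\<bar>u * v * q ^ m\<bar> \<le> q ^ m"
    using uv b(1) mult_right_mono[OF less_imp_le[OF uv] b(1)] by (simp add: abs_mult)
  have "\<bar>q ^ Suc m * (u * v * q ^ m)\<bar> \<le> 1 * q ^ m"
    unfolding abs_mult[of "q ^ Suc m"] using b uvq by (intro mult_mono) auto
  moreover have "c (Suc m) - 1 = - (q ^ Suc m) - u * v * q ^ m + q ^ Suc m * (u * v * q ^ m)"
    by (simp add: c_def algebra_simps)
  ultimately show ?thesis using uvq b by linarith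
qed

text \<open>
  The eigenvalue equation expresses the increments of \<open>\<phi>\<close>, weighted by \<open>\<pi>\<close>, as a sum of terms of
  order \<open>m q^m\<close>.
\<close>

lemma \<phi>_Lipschitz: "\<exists>C>0. \<forall>m. \<bar>\<phi> (Suc m) - \<phi> m\<bar> \<le> C"
proof -
  obtain hi where hi: "hi > 0" "\<And>m. \<phi> m \<le> hi * real (Suc m)" using \<phi>_bounds by blast
  obtain pl ph where p: "pl > 0" "ph > 0" "\<And>m. pl \<le> \<pi> m" "\<And>m. \<pi> m \<le> ph" using \<pi>_bounds by blast
  obtain C where C: "C > 0" "\<And>n. (\<Sum>m<n. real (Suc m) ^ 1 * q ^ m) \<le> C"
    using sum_poly_geometric_bounded[OF q] by blast
  define D where "D = ph * 5 * hi"
  have D: "D > 0" using p hi by (simp add: D_def)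
  define d where "d m = \<pi> (Suc m) * (\<phi> (Suc m) - \<phi> m)" for m
  define e where "e m = \<pi> m * \<phi> m * (1 - c (Suc m) - (u + v) * q ^ m)" for m
  have e: "\<bar>e m\<bar> \<le> D * (real (Suc m) * q ^ m)" for m
  proof -
    have "\<bar>(u + v) * q ^ m\<bar> \<le> 2 * q ^ m"
      unfolding abs_mult using u v q by (intro mult_mono) auto
    then have "\<bar>1 - c (Suc m) - (u + v) * q ^ m\<bar> \<le> 5 * q ^ m"
      using c_near_1[of m] by linarith
    then have "\<bar>e m\<bar> \<le> \<pi> m * \<phi> m * (5 * q ^ m)"
      unfolding e_def abs_mult using \<pi>_pos[of m] \<phi>_pos[of m] by (intro mult_mono) auto
    also have "\<dots> \<le> ph * (hi * real (Suc m)) * (5 * q ^ m)"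
      using p hi q \<phi>_pos[of m] by (intro mult_right_mono mult_mono) auto
    finally show ?thesis by (simp add: D_def mult_ac)
  qed
  have rec: "d (Suc m) = d m + e (Suc m)" for m
  proof -
    have "c (Suc (Suc m)) * (\<phi> (Suc (Suc m)) - \<phi> (Suc m))
        = (\<phi> (Suc m) - \<phi> m) + \<phi> (Suc m) * (1 - c (Suc (Suc m)) - (u + v) * q ^ Suc m)"
      using T_\<phi>[of "Suc m"] by (simp add: T_def dstep_def estep_def algebra_simps)
    then have "\<pi> (Suc m) * (c (Suc (Suc m)) * (\<phi> (Suc (Suc m)) - \<phi> (Suc m)))
        = \<pi> (Suc m) * ((\<phi> (Suc m) - \<phi> m) + \<phi> (Suc m) * (1 - c (Suc (Suc m)) - (u + v) * q ^ Suc m))"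
      by (rule arg_cong)
    then show ?thesis by (simp add: d_def e_def \<pi>_Suc[of "Suc m"] ring_distribs mult.assoc)
  qed
  have "\<bar>d m\<bar> \<le> \<bar>d 0\<bar> + (\<Sum>i<Suc m. \<bar>e i\<bar>)" for m
  proof (induction m)
    case (Suc m)
    then show ?case using rec[of m] abs_triangle_ineq[of "d m" "e (Suc m)"] by simp
  qed simp
  also have "\<bar>d 0\<bar> + (\<Sum>i<Suc m. \<bar>e i\<bar>) \<le> \<bar>d 0\<bar> + D * C" for m
  proof -
    have "(\<Sum>i<Suc m. \<bar>e i\<bar>) \<le> (\<Sum>i<Suc m. D * (real (Suc i) ^ 1 * q ^ i))"
      using e by (intro sum_mono) simp
    also have "\<dots> \<le> D * C" unfolding sum_distrib_left[symmetric]
      using D by (intro mult_left_mono C(2)) simp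
    finally show ?thesis by simp
  qed
  finally have d: "\<bar>d m\<bar> \<le> \<bar>d 0\<bar> + D * C" for m .
  have "\<bar>\<phi> (Suc m) - \<phi> m\<bar> \<le> (\<bar>d 0\<bar> + D * C) / pl" for m
  proof -
    have "pl * \<bar>\<phi> (Suc m) - \<phi> m\<bar> \<le> \<pi> (Suc m) * \<bar>\<phi> (Suc m) - \<phi> m\<bar>"
      using p by (intro mult_right_mono) auto
    also have "\<dots> = \<bar>d m\<bar>" using \<pi>_pos[of "Suc m"] by (simp add: d_def abs_mult)
    finally show ?thesis using d[of m] p by (simp add: field_simps)
  qed
  moreover have "0 < (\<bar>d 0\<bar> + D * C) / pl" using p D C by (simp add: add_nonneg_pos)
  ultimately show ?thesis by blast
qed

text \<open>
  The Doob transform of \<open>T / 4\<close> by \<open>\<phi>\<close>; \<open>T\<close> is self-adjoint with respect to \<open>\<pi>\<close>.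
\<close>

definition w :: "nat \<Rightarrow> real" where "w m = \<pi> m * (\<phi> m)\<^sup>2"
definition W :: "nat \<Rightarrow> real" where "W m = \<pi> (Suc m) * \<phi> m * \<phi> (Suc m) / 4"
definition \<epsilon> :: real where "\<epsilon> = min (1 / 2) ((2 + u + v) / 4)"

lemma conductance_chain_exists: "\<exists>lo hi. conductance_chain w W lo hi \<epsilon>"
proof -
  obtain l h where f: "l > 0" "h > 0" "\<And>m. l * real (Suc m) \<le> \<phi> m" "\<And>m. \<phi> m \<le> h * real (Suc m)"
    using \<phi>_bounds by blast
  obtain pl ph where p: "pl > 0" "ph > 0" "\<And>m. pl \<le> \<pi> m" "\<And>m. \<pi> m \<le> ph" using \<pi>_bounds by blast
  define lo where "lo = pl * l\<^sup>2 / 4"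
  define hi where "hi = ph * h\<^sup>2"
  have lo: "0 < lo" using f p by (simp add: lo_def)
  have f': "l * real (Suc m) \<le> \<phi> (Suc m)" "\<phi> (Suc m) \<le> h * (2 * real (Suc m))" for m
  proof -
    have "l * real (Suc m) \<le> l * real (Suc (Suc m))" using f(1) by simp
    then show "l * real (Suc m) \<le> \<phi> (Suc m)" using f(3)[of "Suc m"] by linarith
    have "h * real (Suc (Suc m)) \<le> h * (2 * real (Suc m))" using f(2) by simp
    then show "\<phi> (Suc m) \<le> h * (2 * real (Suc m))" using f(4)[of "Suc m"] by linarith
  qed
  have prod_lo: "pl * (l * real (Suc m)) * (l * real (Suc m)) \<le> a * x * y"
    if "pl \<le> a" "l * real (Suc m) \<le> x" "l * real (Suc m) \<le> y" for a x y m
    using that f(1) p(1)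
    by (intro mult_mono) (auto intro!: mult_nonneg_nonneg intro: order_trans[of 0 pl] order_trans[of 0 "l * real (Suc m)"])
  have prod_hi: "a * x * y \<le> ph * (h * real (Suc m)) * (2 * (h * real (Suc m)))"
    if "0 \<le> a" "0 \<le> x" "0 \<le> y" "a \<le> ph" "x \<le> h * real (Suc m)" "y \<le> 2 * (h * real (Suc m))" for a x y m
    using that f(2) p(2) by (intro mult_mono) (auto intro!: mult_nonneg_nonneg)
  have "conductance_chain w W lo (2 * hi) \<epsilon>"
  proof
    show "0 < lo" by (rule lo)
    show "0 < \<epsilon>" using u v by (simp add: \<epsilon>_def)
    show "w 0 = 1" by (simp add: w_def \<phi>_0 \<pi>_def)
    fix m
    have "4 * lo * (real (Suc m))\<^sup>2 \<le> w m"
      using prod_lo[OF p(3) f(3) f(3), of m m] by (simp add: w_def lo_def power2_eq_square mult_ac)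
    moreover have "0 \<le> lo * (real (Suc m))\<^sup>2" using lo by simp
    ultimately show "lo * (real (Suc m))\<^sup>2 \<le> w m" by linarith
    have "\<phi> m \<le> 2 * (h * real (Suc m))"
      using f(4)[of m] \<phi>_pos[of m] by linarith
    then show "w m \<le> 2 * hi * (real (Suc m))\<^sup>2"
      using prod_hi[OF _ _ _ p(4) f(4), of m m "\<phi> m"] \<pi>_pos[of m] \<phi>_pos[of m]
      by (simp add: w_def hi_def power2_eq_square mult_ac)
    have "4 * (lo * (real (Suc m))\<^sup>2) \<le> 4 * W m"
      using prod_lo[OF p(3)[of "Suc m"] f(3)[of m] f'(1)[of m]]
      by (simp add: W_def lo_def power2_eq_square mult_ac del: of_nat_Suc)
    then show "lo * (real (Suc m))\<^sup>2 \<le> W m" by linarith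
    have "\<pi> (Suc m) * \<phi> m * \<phi> (Suc m) \<le> ph * (h * real (Suc m)) * (2 * (h * real (Suc m)))"
      using f'(2)[of m] \<pi>_pos[of "Suc m"] \<phi>_pos[of m] \<phi>_pos[of "Suc m"]
      by (intro prod_hi p f) (auto simp: mult_ac)
    then have "4 * W m \<le> 2 * hi * (real (Suc m))\<^sup>2"
      by (simp add: W_def hi_def power2_eq_square mult_ac)
    moreover have "0 \<le> hi * (real (Suc m))\<^sup>2" using p f by (simp add: hi_def)
    ultimately show "W m \<le> 2 * hi * (real (Suc m))\<^sup>2" by linarith
    have "W m + (if m = 0 then 0 else W (m - 1))
        = \<pi> m * \<phi> m * (c (Suc m) * \<phi> (Suc m) + (if m = 0 then 0 else \<phi> (m - 1))) / 4"
      by (cases m) (simp_all add: W_def \<pi>_Suc algebra_simps add_divide_distrib)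
    also have "c (Suc m) * \<phi> (Suc m) + (if m = 0 then 0 else \<phi> (m - 1)) = (2 - (u + v) * q ^ m) * \<phi> m"
      using T_\<phi>[of m] by (simp add: T_def dstep_def estep_def algebra_simps)
    also have "\<pi> m * \<phi> m * ((2 - (u + v) * q ^ m) * \<phi> m) / 4 = (1 - (2 + (u + v) * q ^ m) / 4) * w m"
      by (simp add: w_def power2_eq_square field_simps)
    also have "\<dots> \<le> (1 - \<epsilon>) * w m"
    proof (intro mult_right_mono diff_left_mono)
      have qm: "0 \<le> q ^ m" "q ^ m \<le> 1" using q by (auto intro: power_le_one)
      show "\<epsilon> \<le> (2 + (u + v) * q ^ m) / 4"
      proof (cases "0 \<le> u + v")
        case True
        then show ?thesis using qm by (simp add: \<epsilon>_def min_le_iff_disj)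
      next
        case False
        then have "(u + v) * 1 \<le> (u + v) * q ^ m" using qm by (intro mult_left_mono_neg) auto
        moreover have "\<epsilon> \<le> (2 + u + v) / 4" unfolding \<epsilon>_def by (rule min.cobounded2)
        ultimately show ?thesis by simp
      qed
      show "0 \<le> w m" using \<pi>_pos[of m] by (simp add: w_def)
    qed
    finally show "W m + (if m = 0 then 0 else W (m - 1)) \<le> (1 - \<epsilon>) * w m" .
  qed
  then show ?thesis by blast
qed


lemma R_Suc: "R (Suc k) = T (R k)" by (simp add: R_def)

lemma R_eq_chain:
  assumes "conductance_chain w W lo hi \<epsilon>"
  shows "R k m = 4 ^ k * \<phi> m * conductance_chain.kernel w W k m"
proof -
  interpret CC: conductance_chain w W lo hi \<epsilon> by fact
  have T_P: "T (\<lambda>m. a * \<phi> m * f m) m = 4 * a * \<phi> m * CC.P f m" for a f m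
  proof -
    define p where "p = (if m = 0 then 0 else \<phi> (m - 1))"
    have pos: "\<pi> m > 0" "\<phi> m > 0" by (rule \<pi>_pos \<phi>_pos)+
    have up: "4 * \<phi> m * (W m / w m) = c (Suc m) * \<phi> (Suc m)"
      using pos by (simp add: W_def w_def \<pi>_Suc power2_eq_square)
    have down: "4 * \<phi> m * (W (m - 1) / w m) * (f m - f (m - 1)) = p * (f m - f (m - 1))"
      using pos by (cases m) (simp_all add: W_def w_def p_def power2_eq_square)
    have diag: "(2 + (u + v) * q ^ m) * \<phi> m = 4 * \<phi> m - c (Suc m) * \<phi> (Suc m) - p"
      using T_\<phi>[of m] by (simp add: T_def dstep_def estep_def p_def algebra_simps)
    have "T (\<lambda>m. a * \<phi> m * f m) m
        = a * ((2 + (u + v) * q ^ m) * \<phi> m * f m + c (Suc m) * \<phi> (Suc m) * f (Suc m) + p * f (m - 1))"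
      by (simp add: T_def dstep_def estep_def p_def algebra_simps)
    also have "\<dots> = a * (4 * \<phi> m * f m + c (Suc m) * \<phi> (Suc m) * (f (Suc m) - f m) - p * (f m - f (m - 1)))"
      unfolding diag by (simp add: algebra_simps)
    also have "\<dots> = a * (4 * \<phi> m * CC.P f m)"
      unfolding up[symmetric] down[symmetric] CC.P_def by (simp add: algebra_simps diff_divide_distrib add_divide_distrib)
    finally show ?thesis by (simp add: mult_ac)
  qed
  show ?thesis
  proof (induction k arbitrary: m)
    case 0
    show ?case by (cases m) (simp_all add: R_def CC.kernel_0 \<phi>_0)
  next
    case (Suc k)
    have "R (Suc k) m = T (\<lambda>m. 4 ^ k * \<phi> m * CC.kernel k m) m"
      unfolding R_Suc using Suc by (auto intro!: arg_cong2[where f = T] simp: fun_eq_iff)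
    then show ?case by (simp add: T_P CC.kernel_Suc)
  qed
qed

definition \<kappa> :: "nat \<Rightarrow> real" where "\<kappa> k = real (Suc k) powr - (3/2)"

lemma \<kappa>_pos: "0 < \<kappa> k" by (simp add: \<kappa>_def)

lemma R_0_ge: "\<exists>c>0. \<forall>k. c * (4 ^ k * \<kappa> k) \<le> R k 0"
proof -
  obtain lo hi where cc: "conductance_chain w W lo hi \<epsilon>" using conductance_chain_exists by blast
  interpret CC: conductance_chain w W lo hi \<epsilon> by fact
  obtain c where c: "c > 0" "\<And>k. c * \<kappa> k \<le> CC.kernel k 0"
    using CC.kernel_0_ge unfolding \<kappa>_def by blast
  have "c * (4 ^ k * \<kappa> k) \<le> R k 0" for k
    using mult_left_mono[OF c(2)[of k], of "4 ^ k"]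
    by (simp add: R_eq_chain[OF cc] \<phi>_0 mult_ac)
  with c(1) show ?thesis by blast
qed

lemma R_nonneg: "0 \<le> R k m"
proof -
  obtain lo hi where cc: "conductance_chain w W lo hi \<epsilon>" using conductance_chain_exists by blast
  interpret CC: conductance_chain w W lo hi \<epsilon> by fact
  show ?thesis unfolding R_eq_chain[OF cc] using CC.kernel_nonneg \<phi>_pos[of m] by simp
qed

lemma R_support: "k < m \<Longrightarrow> R k m = 0"
proof -
  assume "k < m"
  obtain lo hi where cc: "conductance_chain w W lo hi \<epsilon>" using conductance_chain_exists by blast
  interpret CC: conductance_chain w W lo hi \<epsilon> by fact
  show ?thesis unfolding R_eq_chain[OF cc] using CC.kernel_support \<open>k < m\<close> by simp
qed

text \<open>
  Both bounds come from \<open>R k = 4^k * \<phi> * kernel k\<close> and the product rule.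
\<close>

lemma R_bounds:
  "\<exists>C>0. \<forall>k m. R k m \<le> C * (4 ^ k * \<kappa> k) * (real (Suc m) * (1 + real (Suc m) / sqrt (real (Suc k))))
     \<and> \<bar>R k (Suc m) - R k m\<bar> \<le> C * (4 ^ k * \<kappa> k) * (1 + real (Suc m) / sqrt (real (Suc k)))"
proof -
  obtain lo hi where cc: "conductance_chain w W lo hi \<epsilon>" using conductance_chain_exists by blast
  interpret CC: conductance_chain w W lo hi \<epsilon> by fact
  define r where "r k m = 1 + real (Suc m) / sqrt (real (Suc k))" for k m
  have r: "0 < r k m" for k m unfolding r_def by (intro add_pos_nonneg) auto
  obtain C1 where C1: "C1 > 0" "\<And>k m. CC.kernel k m \<le> C1 * \<kappa> k * r k m"
    using CC.kernel_le unfolding \<kappa>_def r_def by blast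
  obtain C2 where C2: "C2 > 0" "\<And>k m. real (Suc m) * \<bar>CC.kernel k (Suc m) - CC.kernel k m\<bar> \<le> C2 * \<kappa> k * r k m"
    using CC.gradient_le unfolding \<kappa>_def r_def by blast
  obtain h where h: "h > 0" "\<And>m. \<phi> m \<le> h * real (Suc m)" using \<phi>_bounds by blast
  obtain L where L: "L > 0" "\<And>m. \<bar>\<phi> (Suc m) - \<phi> m\<bar> \<le> L" using \<phi>_Lipschitz by blast
  define C where "C = h * C1 + 2 * h * C2 + L * C1"
  have C: "C > 0" "h * C1 \<le> C" "2 * h * C2 + L * C1 \<le> C"
    using C1 C2 h L by (simp_all add: C_def add_pos_pos)
  have "R k m \<le> C * (4 ^ k * \<kappa> k) * (real (Suc m) * r k m)" for k m
  proof -
    have "R k m \<le> 4 ^ k * (h * real (Suc m)) * (C1 * \<kappa> k * r k m)"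
      unfolding R_eq_chain[OF cc] using h C1 \<phi>_pos[of m] CC.kernel_nonneg
      by (intro mult_mono mult_left_mono) auto
    also have "\<dots> = (h * C1) * ((4 ^ k * \<kappa> k) * (real (Suc m) * r k m))" by (simp add: mult_ac)
    also have "\<dots> \<le> C * ((4 ^ k * \<kappa> k) * (real (Suc m) * r k m))"
      using C \<kappa>_pos[of k] r[of k m] by (intro mult_right_mono) auto
    finally show ?thesis by (simp only: mult.assoc)
  qed
  moreover have "\<bar>R k (Suc m) - R k m\<bar> \<le> C * (4 ^ k * \<kappa> k) * r k m" for k m
  proof -
    let ?d = "CC.kernel k (Suc m) - CC.kernel k m"
    have "R k (Suc m) - R k m = 4 ^ k * (\<phi> (Suc m) * ?d + (\<phi> (Suc m) - \<phi> m) * CC.kernel k m)"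
      unfolding R_eq_chain[OF cc] by (simp add: algebra_simps)
    then have "\<bar>R k (Suc m) - R k m\<bar> = 4 ^ k * \<bar>\<phi> (Suc m) * ?d + (\<phi> (Suc m) - \<phi> m) * CC.kernel k m\<bar>"
      by (simp add: abs_mult)
    also have "\<dots> \<le> 4 ^ k * (\<phi> (Suc m) * \<bar>?d\<bar> + \<bar>\<phi> (Suc m) - \<phi> m\<bar> * CC.kernel k m)"
      using abs_triangle_ineq[of "\<phi> (Suc m) * ?d" "(\<phi> (Suc m) - \<phi> m) * CC.kernel k m"]
        \<phi>_pos[of "Suc m"] CC.kernel_nonneg[of k m]
      by (intro mult_left_mono) (simp_all add: abs_mult)
    also have "\<dots> \<le> 4 ^ k * (2 * h * (C2 * \<kappa> k * r k m) + L * (C1 * \<kappa> k * r k m))"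
    proof (intro mult_left_mono add_mono)
      have "h * real (Suc (Suc m)) \<le> h * (2 * real (Suc m))" using h by simp
      then have "\<phi> (Suc m) \<le> 2 * h * real (Suc m)" using h(2)[of "Suc m"] by linarith
      then have "\<phi> (Suc m) * \<bar>?d\<bar> \<le> 2 * h * real (Suc m) * \<bar>?d\<bar>" by (intro mult_right_mono) auto
      also have "\<dots> = 2 * h * (real (Suc m) * \<bar>?d\<bar>)" by simp
      also have "\<dots> \<le> 2 * h * (C2 * \<kappa> k * r k m)" using h C2 by (intro mult_left_mono) auto
      finally show "\<phi> (Suc m) * \<bar>?d\<bar> \<le> 2 * h * (C2 * \<kappa> k * r k m)" .
      show "\<bar>\<phi> (Suc m) - \<phi> m\<bar> * CC.kernel k m \<le> L * (C1 * \<kappa> k * r k m)"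
        using L C1 CC.kernel_nonneg by (intro mult_mono) auto
    qed auto
    also have "\<dots> = (2 * h * C2 + L * C1) * ((4 ^ k * \<kappa> k) * r k m)" by (simp add: algebra_simps)
    also have "\<dots> \<le> C * ((4 ^ k * \<kappa> k) * r k m)"
      using C \<kappa>_pos[of k] r[of k m] by (intro mult_right_mono) auto
    finally show ?thesis by (simp only: mult.assoc)
  qed
  ultimately show ?thesis unfolding r_def using C(1) by blast
qed

text \<open>
  As \<open>\<pi> * R k = 4^k * w * kernel k / \<phi>\<close>, the two sums are, up to constants, the expectations of
  \<open>1 / (m + 1)\<close> and of \<open>1\<close> for the chain at time \<open>k\<close>.
\<close>

lemma \<pi>_R_sums:
  "\<exists>C>0. \<forall>k. (\<Sum>m\<le>k. \<pi> m * R k m) \<le> C * (4 ^ k / sqrt (real (Suc k)))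
     \<and> (\<Sum>m\<le>k. \<pi> m * R k m * real (Suc m)) \<le> C * 4 ^ k"
proof -
  obtain lo hi where cc: "conductance_chain w W lo hi \<epsilon>" using conductance_chain_exists by blast
  interpret CC: conductance_chain w W lo hi \<epsilon> by fact
  obtain C1 where C1: "C1 > 0" "\<And>k. CC.expect k (\<lambda>m. 1 / real (Suc m)) \<le> C1 * real (Suc k) powr - (1/2)"
    using CC.expect_inverse_le by blast
  obtain l where l: "l > 0" "\<And>m. l * real (Suc m) \<le> \<phi> m" using \<phi>_bounds by blast
  have le: "l * (\<pi> m * R k m * real (Suc m)) \<le> 4 ^ k * (w m * CC.kernel k m)" for k m
  proof -
    have "l * (\<pi> m * R k m * real (Suc m)) = \<pi> m * R k m * (l * real (Suc m))" by simp
    also have "\<dots> \<le> \<pi> m * R k m * \<phi> m"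
      using l \<pi>_pos[of m] R_nonneg by (intro mult_left_mono) auto
    also have "\<dots> = 4 ^ k * (w m * CC.kernel k m)"
      by (simp add: R_eq_chain[OF cc] w_def power2_eq_square)
    finally show ?thesis .
  qed
  define C where "C = (C1 + 1) / l"
  have "(\<Sum>m\<le>k. \<pi> m * R k m) \<le> C * (4 ^ k / sqrt (real (Suc k)))" for k
  proof -
    have "l * (\<Sum>m\<le>k. \<pi> m * R k m) \<le> (\<Sum>m\<le>k. 4 ^ k * (w m * CC.kernel k m * (1 / real (Suc m))))"
      unfolding sum_distrib_left
    proof (rule sum_mono)
      fix m
      have "l * (\<pi> m * R k m) = l * (\<pi> m * R k m * real (Suc m)) * (1 / real (Suc m))" by simp
      also have "\<dots> \<le> 4 ^ k * (w m * CC.kernel k m) * (1 / real (Suc m))"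
        by (intro mult_right_mono le) auto
      finally show "l * (\<pi> m * R k m) \<le> 4 ^ k * (w m * CC.kernel k m * (1 / real (Suc m)))"
        by (simp only: mult.assoc)
    qed
    also have "\<dots> = 4 ^ k * CC.expect k (\<lambda>m. 1 / real (Suc m))"
      by (simp only: CC.expect_def sum_distrib_left)
    also have "\<dots> \<le> 4 ^ k * (C1 * real (Suc k) powr - (1/2))"
      using C1 by (intro mult_left_mono) auto
    also have "\<dots> = C1 * (4 ^ k / sqrt (real (Suc k)))"
      by (simp only: powr_minus_divide powr_half_sqrt of_nat_0_le_iff) simp
    also have "\<dots> \<le> (C1 + 1) * (4 ^ k / sqrt (real (Suc k)))" by (intro mult_right_mono) auto
    finally show ?thesis using l by (simp add: C_def field_simps)
  qed
  moreover have "(\<Sum>m\<le>k. \<pi> m * R k m * real (Suc m)) \<le> C * 4 ^ k" for k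
  proof -
    have "l * (\<Sum>m\<le>k. \<pi> m * R k m * real (Suc m)) \<le> (\<Sum>m\<le>k. 4 ^ k * (w m * CC.kernel k m * 1))"
      unfolding sum_distrib_left by (intro sum_mono) (use le in simp)
    also have "\<dots> = 4 ^ k * CC.expect k (\<lambda>m. 1)"
      by (simp only: CC.expect_def sum_distrib_left)
    also have "\<dots> \<le> (C1 + 1) * 4 ^ k" using C1 by (simp add: CC.expect_one)
    finally show ?thesis using l by (simp add: C_def field_simps)
  qed
  moreover have "0 < C" using C1 l by (simp add: C_def)
  ultimately show ?thesis by blast
qed

end

section \<open>Matrix products of words and the free walk\<close>

definition words :: "nat \<Rightarrow> bool list set" where "words n = {xs. length xs = n}"

lemma finite_words: "finite (words n)"
  using finite_lists_length_eq[of "UNIV :: bool set" n] by (simp add: words_def)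

lemma card_words: "card (words n) = 2 ^ n"
  using card_lists_length_eq[of "UNIV :: bool set" n] by (simp add: words_def)

lemma sum_words_0: "(\<Sum>xs\<in>words 0. F xs) = F []"
  by (simp add: words_def)

lemma sum_words_Suc: "(\<Sum>xs\<in>words (Suc n). F xs) = (\<Sum>xs\<in>words n. F (True # xs) + F (False # xs))"
proof -
  have eq: "words (Suc n) = (#) True ` words n \<union> (#) False ` words n"
    by (auto simp: words_def length_Suc_conv)
  show ?thesis unfolding eq
    by (subst sum.union_disjoint) (auto simp: finite_words sum.reindex sum.distrib)
qed

lemma sum_words_add: "(\<Sum>xs\<in>words (m + n). F xs) = (\<Sum>xs\<in>words m. \<Sum>ys\<in>words n. F (xs @ ys))"
proof (induction m arbitrary: F)
  case (Suc m)
  show ?case by (simp add: sum_words_Suc Suc sum.distrib)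
qed (simp add: sum_words_0)

lemma sum_words_rev_Not: "(\<Sum>xs\<in>words n. F (rev (map Not xs))) = (\<Sum>xs\<in>words n. F xs)"
  by (rule sum.reindex_bij_witness[of _ "\<lambda>xs. rev (map Not xs)" "\<lambda>xs. rev (map Not xs)"])
     (auto simp: words_def rev_map comp_def)

text \<open>
  The steps at infinite height. They act on functions of an integer, so that the sum of the
  products over all words of length \<open>n\<close> is exactly \<open>4^n\<close> times the \<open>n\<close>-step operator of a lazy
  simple random walk.
\<close>

definition free_step :: "bool \<Rightarrow> (int \<Rightarrow> real) \<Rightarrow> int \<Rightarrow> real" where
  "free_step b F x = F x + F (if b then x + 1 else x - 1)"

definition free_word :: "bool list \<Rightarrow> (int \<Rightarrow> real) \<Rightarrow> int \<Rightarrow> real" where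
  "free_word xs F = foldr free_step xs F"

definition free_T :: "(int \<Rightarrow> real) \<Rightarrow> int \<Rightarrow> real" where
  "free_T F x = F (x + 1) + 2 * F x + F (x - 1)"

lemma free_word_simps: "free_word [] F = F" "free_word (b # xs) F = free_step b (free_word xs F)"
  by (simp_all add: free_word_def)

lemma free_T_pow_mono:
  assumes "\<And>x. F x \<le> G x"
  shows "(free_T ^^ n) F x \<le> (free_T ^^ n) G x"
proof (induction n arbitrary: x)
  case (Suc n)
  show ?case using Suc[of "x + 1"] Suc[of x] Suc[of "x - 1"] by (simp add: free_T_def)
qed (use assms in simp)

text \<open>
  Quadratic functions are the only test functions that the free walk needs: its variance is
  \<open>n / 2\<close> after \<open>n\<close> steps, and absolute values are dominated by quadratic functions.
\<close>

lemma free_T_pow_quadratic: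
  "(free_T ^^ n) (\<lambda>x. \<alpha> + \<beta> * (real_of_int (x - y))\<^sup>2) x
     = 4 ^ n * (\<alpha> + \<beta> * ((real_of_int (x - y))\<^sup>2 + real n / 2))"
proof (induction n arbitrary: x)
  case (Suc n)
  show ?case
    unfolding funpow.simps o_def free_T_def[of "(free_T ^^ n) _"] Suc by (simp add: field_simps power2_eq_square)
qed simp

lemma sum_abs_free_word_le: "(\<Sum>xs\<in>words n. \<bar>free_word xs F x\<bar>) \<le> (free_T ^^ n) (\<lambda>y. \<bar>F y\<bar>) x"
proof (induction n arbitrary: x)
  case (Suc n)
  have "(\<Sum>xs\<in>words (Suc n). \<bar>free_word xs F x\<bar>)
      = (\<Sum>xs\<in>words n. \<bar>free_word xs F x + free_word xs F (x + 1)\<bar> + \<bar>free_word xs F x + free_word xs F (x - 1)\<bar>)"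
    by (simp add: sum_words_Suc free_word_simps free_step_def)
  also have "\<dots> \<le> (\<Sum>xs\<in>words n. \<bar>free_word xs F (x + 1)\<bar> + 2 * \<bar>free_word xs F x\<bar> + \<bar>free_word xs F (x - 1)\<bar>)"
    by (intro sum_mono) linarith
  also have "\<dots> = (\<Sum>xs\<in>words n. \<bar>free_word xs F (x + 1)\<bar>) + 2 * (\<Sum>xs\<in>words n. \<bar>free_word xs F x\<bar>)
      + (\<Sum>xs\<in>words n. \<bar>free_word xs F (x - 1)\<bar>)"
    by (simp add: sum.distrib sum_distrib_left)
  also have "\<dots> \<le> free_T ((free_T ^^ n) (\<lambda>y. \<bar>F y\<bar>)) x"
    unfolding free_T_def[of "(free_T ^^ n) _"] by (intro add_mono mult_left_mono Suc) auto
  finally show ?case by simp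
qed (simp add: sum_words_0 free_word_simps)

lemma free_word_diff_const: "free_word xs (\<lambda>y. F y - a) x = free_word xs F x - 2 ^ length xs * a"
proof (induction xs arbitrary: x)
  case (Cons b xs)
  show ?case by (simp add: free_word_simps free_step_def Cons)
qed (simp add: free_word_simps)

lemma sum_free_word_deviation_le:
  "(\<Sum>xs\<in>words n. \<bar>free_word xs F x - 2 ^ n * F x\<bar>) \<le> (free_T ^^ n) (\<lambda>y. \<bar>F y - F x\<bar>) x"
proof -
  have "(\<Sum>xs\<in>words n. \<bar>free_word xs F x - 2 ^ n * F x\<bar>) = (\<Sum>xs\<in>words n. \<bar>free_word xs (\<lambda>y. F y - F x) x\<bar>)"
    by (intro sum.cong) (simp_all add: free_word_diff_const words_def)
  then show ?thesis using sum_abs_free_word_le[where F = "\<lambda>y. F y - F x"] by simp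
qed

definition zero_extend :: "(nat \<Rightarrow> real) \<Rightarrow> int \<Rightarrow> real" where
  "zero_extend f x = (if x < 0 then 0 else f (nat x))"

context asep_matrices
begin

definition letter :: "bool \<Rightarrow> (nat \<Rightarrow> real) \<Rightarrow> nat \<Rightarrow> real" where
  "letter b = (if b then dstep else estep)"

definition word :: "bool list \<Rightarrow> (nat \<Rightarrow> real) \<Rightarrow> nat \<Rightarrow> real" where
  "word xs f = foldr letter xs f"

definition weight :: "bool list \<Rightarrow> real" where
  "weight xs = word xs (\<lambda>m. of_bool (m = 0)) 0"

lemma word_simps: "word [] f = f" "word (b # xs) f = letter b (word xs f)"
  by (simp_all add: word_def)

lemma word_append: "word (xs @ ys) f = word xs (word ys f)"
  by (simp add: word_def)

lemma letter_linear: "letter b (\<lambda>m. s * f m + t * h m) m = s * letter b f m + t * letter b h m"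
  by (simp add: letter_def dstep_def estep_def algebra_simps)

lemma word_linear: "word xs (\<lambda>m. s * f m + t * h m) m = s * word xs f m + t * word xs h m"
proof (induction xs arbitrary: m)
  case (Cons b xs)
  have "word xs (\<lambda>m. s * f m + t * h m) = (\<lambda>m. s * word xs f m + t * word xs h m)"
    using Cons by (simp add: fun_eq_iff)
  then show ?case by (simp add: word_simps letter_linear)
qed (simp add: word_simps)

lemma diagonal_pos: "0 < 1 + u * q ^ m" "0 < 1 + v * q ^ m"
proof -
  have "\<bar>x * q ^ m\<bar> < 1" if "\<bar>x\<bar> < 1" for x
  proof -
    have "\<bar>x * q ^ m\<bar> \<le> \<bar>x\<bar> * 1"
      unfolding abs_mult using q by (intro mult_left_mono) (auto intro: power_le_one)
    with that show ?thesis by linarith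
  qed
  from this[OF u] this[OF v] show "0 < 1 + u * q ^ m" "0 < 1 + v * q ^ m"
    by (simp_all add: abs_less_iff)
qed

lemma letter_nonneg:
  assumes "\<And>m. 0 \<le> f m"
  shows "0 \<le> letter b f m"
  using assms less_imp_le[OF diagonal_pos(1)] less_imp_le[OF diagonal_pos(2)] less_imp_le[OF c_pos]
  by (auto simp: letter_def dstep_def estep_def intro!: add_nonneg_nonneg mult_nonneg_nonneg)

lemma letter_pos:
  assumes "\<And>m. 0 \<le> f m" "0 < f m"
  shows "0 < letter b f m"
proof -
  have "0 < (1 + v * q ^ m) * f m" "0 < (1 + u * q ^ m) * f m"
    using diagonal_pos assms(2) by (auto intro: mult_pos_pos)
  moreover have "0 \<le> c (Suc m) * f (Suc m)" using c_pos[of m] assms(1) by simp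
  ultimately show ?thesis
    using assms(1) by (simp add: letter_def dstep_def estep_def add_pos_nonneg)
qed

lemma word_nonneg:
  assumes "\<And>m. 0 \<le> f m"
  shows "0 \<le> word xs f m"
  by (induction xs arbitrary: m) (auto simp: word_simps assms intro: letter_nonneg)

lemma weight_pos: "0 < weight xs"
proof -
  have "0 < word xs (\<lambda>m. of_bool (m = 0)) 0"
    by (induction xs) (auto simp: word_simps intro!: letter_pos word_nonneg)
  then show ?thesis by (simp add: weight_def)
qed

lemma letter_sum: "letter True f m + letter False f m = T f m"
  by (simp add: letter_def T_def)

lemma T_add: "T (\<lambda>m. f m + h m) m = T f m + T h m"
  by (simp add: T_def dstep_def estep_def algebra_simps)

lemma T_sum: "finite X \<Longrightarrow> T (\<lambda>m. \<Sum>x\<in>X. F x m) m = (\<Sum>x\<in>X. T (F x) m)"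
proof (induction X rule: finite_induct)
  case empty
  show ?case by (simp add: T_def dstep_def estep_def)
qed (simp add: T_add)

lemma sum_word: "(\<Sum>xs\<in>words n. word xs f m) = (T ^^ n) f m"
proof (induction n arbitrary: m)
  case (Suc n)
  have "(\<Sum>xs\<in>words (Suc n). word xs f m) = (\<Sum>xs\<in>words n. T (word xs f) m)"
    by (simp add: sum_words_Suc word_simps letter_sum)
  also have "\<dots> = T (\<lambda>m. \<Sum>xs\<in>words n. word xs f m) m"
    by (simp add: T_sum finite_words)
  also have "(\<lambda>m. \<Sum>xs\<in>words n. word xs f m) = (T ^^ n) f" using Suc by (simp add: fun_eq_iff)
  finally show ?case by simp
qed (simp add: sum_words_0 word_simps)

lemma sum_weight: "(\<Sum>xs\<in>words n. weight xs) = R n 0"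
  by (simp add: weight_def sum_word R_def)

text \<open>
  The quadratic algebra of the open ASEP, for the matrices multiplied by \<open>1 - q\<close>.
\<close>

lemma letter_relation:
  "letter True (letter False f) m - q * letter False (letter True f) m
     = (1 - q) * (letter True f m + letter False f m)"
  by (cases m) (simp_all add: letter_def dstep_def estep_def c_def algebra_simps)

lemma weight_bulk:
  "weight (xs @ True # False # ys) - q * weight (xs @ False # True # ys)
     = (1 - q) * (weight (xs @ True # ys) + weight (xs @ False # ys))"
proof -
  let ?f = "word ys (\<lambda>m. of_bool (m = 0))"
  have eq: "letter True (letter False ?f)
      = (\<lambda>m. q * letter False (letter True ?f) m + (1 - q) * (1 * letter True ?f m + 1 * letter False ?f m))"
    using letter_relation[of ?f] by (simp add: fun_eq_iff algebra_simps)
  have "weight (xs @ True # False # ys) = word xs (letter True (letter False ?f)) 0"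
    by (simp add: weight_def word_append word_simps)
  also have "\<dots> = q * word xs (letter False (letter True ?f)) 0
      + (1 - q) * (1 * word xs (letter True ?f) 0 + 1 * word xs (letter False ?f) 0)"
    unfolding eq word_linear ..
  finally show ?thesis by (simp add: weight_def word_append word_simps)
qed

lemma weight_left: "weight (False # xs) = (1 + u) * weight xs"
  by (simp add: weight_def word_simps letter_def estep_def)

lemma weight_right: "weight (xs @ [True]) = (1 + v) * weight xs"
proof -
  have "letter True (\<lambda>m. of_bool (m = 0)) = (\<lambda>m. (1 + v) * of_bool (m = 0) + 0 * of_bool (m = 0))"
    by (auto simp: letter_def dstep_def fun_eq_iff)
  then have "weight (xs @ [True]) = word xs (\<lambda>m. (1 + v) * of_bool (m = 0) + 0 * of_bool (m = 0)) 0"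
    by (simp add: weight_def word_append word_simps)
  also have "\<dots> = (1 + v) * weight xs" unfolding word_linear by (simp add: weight_def)
  finally show ?thesis .
qed

definition pair :: "nat \<Rightarrow> (nat \<Rightarrow> real) \<Rightarrow> (nat \<Rightarrow> real) \<Rightarrow> real" where
  "pair M f h = (\<Sum>m\<le>M. \<pi> m * f m * h m)"

lemma pair_T: "pair M f (T h) = pair M (T f) h + \<pi> M * c (Suc M) * (f M * h (Suc M) - f (Suc M) * h M)"
proof -
  have "pair M f (T h) - pair M (T f) h = \<pi> M * c (Suc M) * (f M * h (Suc M) - f (Suc M) * h M)" for M
  proof (induction M)
    case 0
    show ?case by (simp add: pair_def T_def dstep_def estep_def algebra_simps)
  next
    case (Suc M)
    then show ?case by (simp add: pair_def T_def dstep_def estep_def \<pi>_Suc[of M] algebra_simps)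
  qed
  then show ?thesis by (simp add: algebra_simps)
qed

lemma pair_R_T_pow: "i + k < M \<Longrightarrow> pair M (R k) ((T ^^ i) h) = pair M (R (k + i)) h"
proof (induction i arbitrary: k)
  case (Suc i)
  have "pair M (R k) ((T ^^ Suc i) h) = pair M (T (R k)) ((T ^^ i) h)"
    using pair_T[of M "R k" "(T ^^ i) h"] Suc.prems by (simp add: R_support)
  also have "\<dots> = pair M (R (Suc k + i)) h"
    unfolding R_Suc[symmetric] using Suc.prems by (intro Suc.IH) simp
  finally show ?case by simp
qed simp

lemma T_pow_0_eq_pair: "(T ^^ k) h 0 = pair (Suc k) (R k) h"
proof -
  have "pair (Suc k) (R 0) ((T ^^ k) h) = (\<Sum>m\<le>Suc k. if m = 0 then (T ^^ k) h 0 else 0)"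
    unfolding pair_def by (intro sum.cong) (auto simp: R_def \<pi>_def)
  then have "(T ^^ k) h 0 = pair (Suc k) (R 0) ((T ^^ k) h)" by simp
  then show ?thesis using pair_R_T_pow[of k 0 "Suc k" h] by simp
qed

lemma pair_R_eq_sum: "k \<le> M \<Longrightarrow> pair M (R k) h = (\<Sum>m\<le>k. \<pi> m * R k m * h m)"
  unfolding pair_def by (rule sum.mono_neutral_right) (auto simp: R_support)

definition block_weight :: "nat \<Rightarrow> nat \<Rightarrow> bool list \<Rightarrow> real" where
  "block_weight A B zs = (\<Sum>xs\<in>words A. \<Sum>ys\<in>words B. weight (xs @ zs @ ys))"

lemma word_sum: "finite X \<Longrightarrow> word xs (\<lambda>m. \<Sum>x\<in>X. F x m) m = (\<Sum>x\<in>X. word xs (F x) m)"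
proof (induction X rule: finite_induct)
  case empty
  show ?case using word_linear[of xs 0 "\<lambda>_. 0" 0 "\<lambda>_. 0"] by simp
next
  case (insert x X)
  then show ?case using word_linear[of xs 1 "F x" 1 "\<lambda>m. \<Sum>x\<in>X. F x m"] by simp
qed

lemma block_weight_eq: "block_weight A B zs = (T ^^ A) (word zs (R B)) 0"
proof -
  have "block_weight A B zs = (\<Sum>xs\<in>words A. word xs (word zs (R B)) 0)"
    by (simp add: block_weight_def weight_def word_append word_sum[OF finite_words, symmetric] sum_word R_def)
  then show ?thesis by (simp add: sum_word)
qed

lemma sum_block_weight: "(\<Sum>zs\<in>words n. block_weight A B zs) = R (A + n + B) 0"
proof -
  have "R (A + n + B) 0 = (\<Sum>xs\<in>words (A + (n + B)). weight xs)"
    by (simp add: sum_weight add.assoc)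
  also have "\<dots> = (\<Sum>xs\<in>words A. \<Sum>zs\<in>words n. \<Sum>ys\<in>words B. weight (xs @ zs @ ys))"
    by (simp only: sum_words_add)
  also have "\<dots> = (\<Sum>zs\<in>words n. block_weight A B zs)"
    unfolding block_weight_def by (rule sum.swap)
  finally show ?thesis ..
qed

text \<open>
  At \<open>h = 0\<close> the free hole step sees the value at \<open>-1\<close>, which the killed step does not; this is
  covered because \<open>q^0 = 1\<close>, also for \<open>q = 0\<close>.
\<close>

lemma comparison_step:
  "\<bar>letter b (\<lambda>m. G (int m)) h - free_step b G (int h)\<bar>
     \<le> 3 * q ^ h * (\<bar>G (int h - 1)\<bar> + \<bar>G (int h)\<bar> + \<bar>G (int h + 1)\<bar>)"
proof -
  have qh: "0 \<le> q ^ h" using q by simp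
  have vq: "\<bar>x * q ^ h * y\<bar> \<le> q ^ h * \<bar>y\<bar>" if "\<bar>x\<bar> < 1" for x y
  proof -
    have "\<bar>x\<bar> * (q ^ h * \<bar>y\<bar>) \<le> 1 * (q ^ h * \<bar>y\<bar>)"
      using that qh by (intro mult_right_mono) auto
    then show ?thesis using qh by (simp add: abs_mult mult.assoc)
  qed
  have nn: "0 \<le> q ^ h * \<bar>y\<bar>" for y using qh by simp
  show ?thesis
  proof (cases b)
    case True
    have "letter b (\<lambda>m. G (int m)) h - free_step b G (int h)
        = v * q ^ h * G (int h) + (c (Suc h) - 1) * G (int h + 1)"
      using True by (simp add: letter_def dstep_def free_step_def algebra_simps)
    also have "\<bar>\<dots>\<bar> \<le> q ^ h * \<bar>G (int h)\<bar> + 3 * q ^ h * \<bar>G (int h + 1)\<bar>"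
    proof (intro order_trans[OF abs_triangle_ineq] add_mono vq[OF v])
      show "\<bar>(c (Suc h) - 1) * G (int h + 1)\<bar> \<le> 3 * q ^ h * \<bar>G (int h + 1)\<bar>"
        unfolding abs_mult by (intro mult_right_mono c_near_1) auto
    qed
    finally show ?thesis using nn[of "G (int h - 1)"] nn[of "G (int h)"] by (simp add: algebra_simps)
  next
    case False
    have "letter b (\<lambda>m. G (int m)) h - free_step b G (int h)
        = u * q ^ h * G (int h) - (if h = 0 then G (int h - 1) else 0)"
      using False by (cases h) (simp_all add: letter_def estep_def free_step_def algebra_simps)
    also have "\<bar>\<dots>\<bar> \<le> q ^ h * \<bar>G (int h)\<bar> + q ^ h * \<bar>G (int h - 1)\<bar>"
      using vq[OF u, of "G (int h)"] nn[of "G (int h - 1)"] by (cases h) auto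
    finally show ?thesis
      using nn[of "G (int h - 1)"] nn[of "G (int h)"] nn[of "G (int h + 1)"] by (simp add: algebra_simps)
  qed
qed

definition discrepancy :: "(nat \<Rightarrow> real) \<Rightarrow> nat \<Rightarrow> nat \<Rightarrow> real" where
  "discrepancy f n h = (\<Sum>xs\<in>words n. \<bar>word xs f h - free_word xs (zero_extend f) (int h)\<bar>)"

lemma abs_letter_le: "\<bar>letter b f h\<bar> \<le> letter b (\<lambda>m. \<bar>f m\<bar>) h"
proof -
  have "letter b (\<lambda>m. 1 * \<bar>f m\<bar> + s * f m) h = 1 * letter b (\<lambda>m. \<bar>f m\<bar>) h + s * letter b f h" for s
    by (rule letter_linear)
  moreover have "0 \<le> letter b (\<lambda>m. 1 * \<bar>f m\<bar> + s * f m) h" if "s = 1 \<or> s = -1" for s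
    using that by (intro letter_nonneg) auto
  ultimately have "0 \<le> 1 * letter b (\<lambda>m. \<bar>f m\<bar>) h + 1 * letter b f h"
      "0 \<le> 1 * letter b (\<lambda>m. \<bar>f m\<bar>) h + (-1) * letter b f h" by metis+
  then show ?thesis by linarith
qed

text \<open>
  Replacing the first letter costs \<open>comparison_step\<close>; the rest of the word is replaced under an
  exact first letter. The sum over all words turns the letters into \<open>T\<close> and the free letters
  into \<open>free_T\<close>.
\<close>

lemma discrepancy_Suc:
  "discrepancy f (Suc n) h \<le> T (discrepancy f n) h + 6 * q ^ h * (free_T ^^ Suc n) (\<lambda>y. \<bar>zero_extend f y\<bar>) (int h)"
proof -
  define G where "G xs = free_word xs (zero_extend f)" for xs
  define D where "D xs m = word xs f m - G xs (int m)" for xs m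
  define J where "J xs = 3 * q ^ h * (\<bar>G xs (int h - 1)\<bar> + \<bar>G xs (int h)\<bar> + \<bar>G xs (int h + 1)\<bar>)" for xs
  have step: "\<bar>word (b # xs) f h - free_word (b # xs) (zero_extend f) (int h)\<bar> \<le> letter b (\<lambda>m. \<bar>D xs m\<bar>) h + J xs" for b xs
  proof -
    have "word xs f = (\<lambda>m. 1 * D xs m + 1 * G xs (int m))" by (simp add: D_def fun_eq_iff)
    then have "letter b (word xs f) h = letter b (D xs) h + letter b (\<lambda>m. G xs (int m)) h"
      using letter_linear[of b 1 "D xs" 1 "\<lambda>m. G xs (int m)" h] by simp
    then have "word (b # xs) f h - free_word (b # xs) (zero_extend f) (int h)
        = letter b (D xs) h + (letter b (\<lambda>m. G xs (int m)) h - free_step b (G xs) (int h))"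
      by (simp add: word_simps free_word_simps G_def)
    then show ?thesis
      using abs_letter_le[of b "D xs" h] comparison_step[of b "G xs" h] unfolding J_def by linarith
  qed
  have "discrepancy f (Suc n) h
      \<le> (\<Sum>xs\<in>words n. (letter True (\<lambda>m. \<bar>D xs m\<bar>) h + J xs) + (letter False (\<lambda>m. \<bar>D xs m\<bar>) h + J xs))"
    unfolding discrepancy_def sum_words_Suc by (intro sum_mono add_mono step)
  also have "\<dots> = (\<Sum>xs\<in>words n. T (\<lambda>m. \<bar>D xs m\<bar>) h) + 2 * (\<Sum>xs\<in>words n. J xs)"
    by (simp add: letter_sum[symmetric] sum.distrib sum_distrib_left algebra_simps)
  also have "(\<Sum>xs\<in>words n. T (\<lambda>m. \<bar>D xs m\<bar>) h) = T (discrepancy f n) h"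
    unfolding T_sum[OF finite_words, symmetric]
    by (rule arg_cong2[where f = T]) (auto simp: fun_eq_iff discrepancy_def D_def G_def)
  also have "(\<Sum>xs\<in>words n. J xs) \<le> 3 * q ^ h * (free_T ^^ Suc n) (\<lambda>y. \<bar>zero_extend f y\<bar>) (int h)"
  proof -
    define H where "H = (free_T ^^ n) (\<lambda>y. \<bar>zero_extend f y\<bar>)"
    have H: "(\<Sum>xs\<in>words n. \<bar>G xs x\<bar>) \<le> H x" for x
      unfolding H_def G_def by (rule sum_abs_free_word_le)
    have H0: "0 \<le> H x" for x by (rule order_trans[OF _ H]) (auto intro: sum_nonneg)
    have "(\<Sum>xs\<in>words n. J xs) = 3 * q ^ h * ((\<Sum>xs\<in>words n. \<bar>G xs (int h - 1)\<bar>)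
        + (\<Sum>xs\<in>words n. \<bar>G xs (int h)\<bar>) + (\<Sum>xs\<in>words n. \<bar>G xs (int h + 1)\<bar>))"
      by (simp only: J_def sum_distrib_left[symmetric] sum.distrib)
    also have "\<dots> \<le> 3 * q ^ h * (free_T H (int h))"
    proof (rule mult_left_mono)
      show "(\<Sum>xs\<in>words n. \<bar>G xs (int h - 1)\<bar>)
        + (\<Sum>xs\<in>words n. \<bar>G xs (int h)\<bar>) + (\<Sum>xs\<in>words n. \<bar>G xs (int h + 1)\<bar>) \<le> free_T H (int h)"
        unfolding free_T_def using H[of "int h - 1"] H[of "int h"] H[of "int h + 1"] H0[of "int h"] by linarith
    qed (use q in auto)
    finally show ?thesis by (simp add: H_def)
  qed
  finally show ?thesis by simp
qed

lemma T_mono: "(\<And>m. f m \<le> h m) \<Longrightarrow> T f m \<le> T h m"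
proof -
  assume "\<And>m. f m \<le> h m"
  then have "0 \<le> letter b (\<lambda>m. 1 * h m + (-1) * f m) m" for b
    by (intro letter_nonneg) simp
  then have "letter b f m \<le> letter b h m" for b unfolding letter_linear by simp
  from add_mono[OF this[of True] this[of False]] show ?thesis by (simp add: letter_sum)
qed

lemma discrepancy_le:
  assumes b: "\<And>j x. j \<le> n \<Longrightarrow> (free_T ^^ j) (\<lambda>y. \<bar>zero_extend f y\<bar>) x \<le> 4 ^ j * b x"
  shows "discrepancy f n h \<le> (\<Sum>i<n. 6 * 4 ^ (n - i) * (T ^^ i) (\<lambda>m. q ^ m * b (int m)) h)"
  using b
proof (induction n arbitrary: h)
  case 0
  show ?case by (simp add: discrepancy_def sum_words_0 word_simps free_word_simps zero_extend_def)
next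
  case (Suc n)
  define e where "e = (\<lambda>m. q ^ m * b (int m))"
  have "T (discrepancy f n) h \<le> T (\<lambda>m. \<Sum>i<n. 6 * 4 ^ (n - i) * (T ^^ i) e m) h"
    unfolding e_def by (intro T_mono Suc.IH Suc.prems) auto
  also have "\<dots> = (\<Sum>i<n. 6 * 4 ^ (n - i) * (T ^^ Suc i) e h)"
    unfolding T_sum[OF finite_lessThan]
    by (intro sum.cong refl) (simp add: T_def dstep_def estep_def algebra_simps)
  also have "\<dots> = (\<Sum>i\<in>{1..<Suc n}. 6 * 4 ^ (Suc n - i) * (T ^^ i) e h)"
    by (rule sum.reindex_bij_witness[of _ "\<lambda>i. i - 1" Suc]) auto
  finally have 1: "T (discrepancy f n) h \<le> (\<Sum>i\<in>{1..<Suc n}. 6 * 4 ^ (Suc n - i) * (T ^^ i) e h)" .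
  have "6 * q ^ h * (free_T ^^ Suc n) (\<lambda>y. \<bar>zero_extend f y\<bar>) (int h) \<le> 6 * q ^ h * (4 ^ Suc n * b (int h))"
    using Suc.prems[of "Suc n"] q by (intro mult_left_mono) auto
  also have "\<dots> = 6 * 4 ^ (Suc n - 0) * (T ^^ 0) e h" by (simp add: e_def)
  finally have "discrepancy f (Suc n) h \<le> (\<Sum>i\<in>{1..<Suc n}. 6 * 4 ^ (Suc n - i) * (T ^^ i) e h)
      + 6 * 4 ^ (Suc n - 0) * (T ^^ 0) e h"
    using discrepancy_Suc[of f n h] 1 by linarith
  also have "\<dots> = (\<Sum>i\<in>insert 0 {1..<Suc n}. 6 * 4 ^ (Suc n - i) * (T ^^ i) e h)"
    by (subst sum.insert) auto
  also have "insert 0 {1..<Suc n} = {..<Suc n}" by auto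
  finally show ?case by (simp only: e_def)
qed

end

sublocale asep_matrices \<subseteq> swap: asep_matrices q v u
  by standard (use q u v in auto)

section \<open>Word weights in the middle of a long product\<close>

context asep_matrices
begin

lemma swap_same: "swap.c = c" "swap.\<pi> = \<pi>"
  by (simp_all add: fun_eq_iff c_def swap.c_def \<pi>_def swap.\<pi>_def mult_ac)

text \<open>
  Transposition with respect to \<open>\<pi>\<close> exchanges particles with holes and \<open>u\<close> with \<open>v\<close>.
\<close>

lemma pair_letter:
  assumes "\<And>m. M \<le> m \<Longrightarrow> f m = 0"
  shows "pair M f (letter b h) = pair M (swap.letter (\<not> b) f) h"
proof -
  have e1: "pair M f (dstep h) - pair M (swap.estep f) h = \<pi> M * c (Suc M) * f M * h (Suc M)" for M
    by (induction M) (simp_all add: pair_def dstep_def swap.estep_def \<pi>_Suc algebra_simps)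
  have e2: "pair M f (estep h) - pair M (swap.dstep f) h = - \<pi> M * c (Suc M) * f (Suc M) * h M" for M
    by (induction M) (simp_all add: pair_def estep_def swap.dstep_def swap_same \<pi>_Suc algebra_simps)
  show ?thesis
    using e1[of M] e2[of M] assms[of M] assms[of "Suc M"] by (simp add: letter_def swap.letter_def)
qed

lemma pair_word:
  assumes "\<And>m. K \<le> m \<Longrightarrow> f m = 0" "K + length xs \<le> M"
  shows "pair M f (word xs h) = pair M (swap.word (rev (map Not xs)) f) h"
  using assms
proof (induction xs arbitrary: f K)
  case (Cons b xs)
  have "pair M f (word (b # xs) h) = pair M (swap.letter (\<not> b) f) (word xs h)"
    unfolding word_simps by (rule pair_letter) (use Cons.prems in auto)
  also have "\<dots> = pair M (swap.word (rev (map Not xs)) (swap.letter (\<not> b) f)) h"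
    by (rule Cons.IH[of "Suc K"])
       (use Cons.prems in \<open>auto simp: swap.letter_def swap.dstep_def swap.estep_def\<close>)
  finally show ?case by (simp add: swap.word_append swap.word_simps)
qed (simp add: word_simps swap.word_simps)

lemma weight_symmetric: "weight xs = swap.weight (rev (map Not xs))"
proof -
  define \<delta> :: "nat \<Rightarrow> real" where "\<delta> m = of_bool (m = 0)" for m
  have 1: "pair M \<delta> f = f 0" "pair M f \<delta> = f 0" for M f
  proof -
    have "(\<Sum>m\<le>M. \<pi> m * \<delta> m * f m) = (\<Sum>m\<le>M. if m = 0 then f 0 else 0)"
      "(\<Sum>m\<le>M. \<pi> m * f m * \<delta> m) = (\<Sum>m\<le>M. if m = 0 then f 0 else 0)"
      by (rule sum.cong; auto simp: \<delta>_def \<pi>_def)+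
    then show "pair M \<delta> f = f 0" "pair M f \<delta> = f 0" by (simp_all add: pair_def)
  qed
  have "weight xs = word xs \<delta> 0" by (simp add: weight_def \<delta>_def[abs_def])
  also have "\<dots> = pair (1 + length xs) \<delta> (word xs \<delta>)" by (simp only: 1)
  also have "\<dots> = pair (1 + length xs) (swap.word (rev (map Not xs)) \<delta>) \<delta>"
    by (rule pair_word[of 1]) (auto simp: \<delta>_def)
  also have "\<dots> = swap.word (rev (map Not xs)) \<delta> 0" by (simp only: 1)
  also have "\<dots> = swap.weight (rev (map Not xs))" by (simp only: swap.weight_def \<delta>_def[abs_def])
  finally show ?thesis .
qed

lemma block_weight_symmetric: "block_weight A B zs = swap.block_weight B A (rev (map Not zs))"
proof -
  define f where "f xs = rev (map Not xs)" for xs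
  have "block_weight A B zs = (\<Sum>xs\<in>words A. \<Sum>ys\<in>words B. swap.weight (f ys @ f zs @ f xs))"
    by (simp add: block_weight_def weight_symmetric[of "_ @ _"] f_def)
  also have "\<dots> = (\<Sum>xs\<in>words A. \<Sum>ys\<in>words B. swap.weight (ys @ f zs @ xs))"
    unfolding f_def sum_words_rev_Not[where F = "\<lambda>ys. swap.weight (ys @ _ @ _)"]
    by (rule sum_words_rev_Not[where F = "\<lambda>xs. \<Sum>ys\<in>words B. swap.weight (ys @ _ @ xs)"])
  also have "\<dots> = swap.block_weight B A (f zs)"
    unfolding swap.block_weight_def by (rule sum.swap)
  finally show ?thesis by (simp add: f_def)
qed

lemma zero_extend_Lipschitz:
  assumes grad: "\<And>m. \<bar>f (Suc m) - f m\<bar> \<le> K * (1 + real (Suc m) / \<sigma>)"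
    and f0: "\<bar>f 0\<bar> \<le> K * (1 + 1 / \<sigma>)" and \<sigma>: "0 < \<sigma>" and K: "0 \<le> K"
  shows "\<bar>zero_extend f x - zero_extend f y\<bar> \<le> K * real_of_int \<bar>x - y\<bar> * (1 + real_of_int (\<bar>y\<bar> + \<bar>x - y\<bar> + 1) / \<sigma>)"
proof -
  have step: "\<bar>zero_extend f (y + 1) - zero_extend f y\<bar> \<le> K * (1 + (real_of_int \<bar>y\<bar> + 1) / \<sigma>)" for y
  proof -
    consider "y \<ge> 0" | "y = -1" | "y < -1" by linarith
    then show ?thesis
    proof cases
      case 1
      then show ?thesis using grad[of "nat y"] by (simp add: zero_extend_def nat_add_distrib add.commute)
    next
      case 2
      have "K * (1 + 1 / \<sigma>) \<le> K * (1 + 2 / \<sigma>)"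
        using K \<sigma> by (intro mult_left_mono add_left_mono divide_right_mono) auto
      with 2 f0 show ?thesis by (simp add: zero_extend_def)
    next
      case 3
      then show ?thesis using K \<sigma> by (simp add: zero_extend_def)
    qed
  qed
  have mono: "K * (1 + a / \<sigma>) \<le> K * (1 + b / \<sigma>)" if "a \<le> b" for a b
    using that K \<sigma> by (intro mult_left_mono add_left_mono divide_right_mono) auto
  have walk: "\<bar>zero_extend f (y + e * int d) - zero_extend f y\<bar> \<le> real d * (K * (1 + (\<bar>y\<bar> + real d + 1) / \<sigma>))"
    if e: "e = 1 \<or> e = -1" for d and e :: int
  proof (induction d)
    case (Suc d)
    have "\<bar>zero_extend f (y + e * int (Suc d)) - zero_extend f (y + e * int d)\<bar> \<le> K * (1 + (\<bar>y\<bar> + real (Suc d) + 1) / \<sigma>)"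
    proof (cases "e = 1")
      case True
      have "\<bar>zero_extend f (y + int d + 1) - zero_extend f (y + int d)\<bar> \<le> K * (1 + (real_of_int \<bar>y + int d\<bar> + 1) / \<sigma>)" by (rule step)
      also have "\<dots> \<le> K * (1 + (\<bar>y\<bar> + real (Suc d) + 1) / \<sigma>)" by (rule mono) simp
      finally show ?thesis using True by (simp add: algebra_simps)
    next
      case False
      then have e: "e = -1" using e by simp
      have "\<bar>zero_extend f (y - int d - 1 + 1) - zero_extend f (y - int d - 1)\<bar> \<le> K * (1 + (real_of_int \<bar>y - int d - 1\<bar> + 1) / \<sigma>)" by (rule step)
      also have "\<dots> \<le> K * (1 + (\<bar>y\<bar> + real (Suc d) + 1) / \<sigma>)" by (rule mono) simp
      finally show ?thesis using e by (simp add: algebra_simps abs_minus_commute)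
    qed
    moreover have "real d * (K * (1 + (\<bar>y\<bar> + real d + 1) / \<sigma>)) \<le> real d * (K * (1 + (\<bar>y\<bar> + real (Suc d) + 1) / \<sigma>))"
      by (intro mult_left_mono mono) auto
    ultimately have "\<bar>zero_extend f (y + e * int (Suc d)) - zero_extend f y\<bar>
        \<le> K * (1 + (\<bar>y\<bar> + real (Suc d) + 1) / \<sigma>) + real d * (K * (1 + (\<bar>y\<bar> + real (Suc d) + 1) / \<sigma>))"
      using Suc by linarith
    also have "\<dots> = real (Suc d) * (K * (1 + (\<bar>y\<bar> + real (Suc d) + 1) / \<sigma>))"
      by (simp only: of_nat_Suc distrib_right mult_1)
    finally show ?case .
  qed simp
  define d where "d = nat \<bar>x - y\<bar>"
  have d: "real d = \<bar>x - y\<bar>" by (simp add: d_def)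
  have "x = y + 1 * int d \<or> x = y + (-1) * int d" by (auto simp: d_def)
  then have "\<bar>zero_extend f x - zero_extend f y\<bar> \<le> real d * (K * (1 + (\<bar>y\<bar> + real d + 1) / \<sigma>))"
    using walk[of 1 d] walk[of "-1" d] by metis
  then show ?thesis unfolding d by (simp add: mult_ac)
qed

text \<open>
  The displacement of the free walk is of order \<open>s = n^(1/2)\<close>. Each \<open>r = \<bar>x - y\<bar>\<close> is replaced by
  the quadratic majorant \<open>s + r^2 / (2 s)\<close>, whose expectation is again of order \<open>s\<close>.
\<close>

lemma free_walk_deviation:
  assumes dev: "\<And>x. \<bar>F x - F y\<bar> \<le> K * real_of_int \<bar>x - y\<bar> * (1 + real_of_int (\<bar>y\<bar> + \<bar>x - y\<bar> + 1) / \<sigma>)"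
    and K: "0 \<le> K" and n: "1 \<le> n" and \<sigma>: "sqrt (real n) \<le> \<sigma>"
  shows "(free_T ^^ n) (\<lambda>x. \<bar>F x - F y\<bar>) y \<le> 4 ^ n * (K * sqrt (real n) * (2 * (1 + real_of_int (\<bar>y\<bar> + 1) / \<sigma>)))"
proof -
  define s where "s = sqrt (real n)"
  define t where "t = 1 + real_of_int (\<bar>y\<bar> + 1) / \<sigma>"
  have s: "1 \<le> s" "s * s = real n" "s \<le> \<sigma>" using n \<sigma> by (simp_all add: s_def)
  have t: "1 \<le> t" using s by (simp add: t_def)
  define \<alpha> where "\<alpha> = K * (s * t)"
  define \<beta> where "\<beta> = K * (t / s / 2 + 1 / \<sigma>)"
  have "\<bar>F x - F y\<bar> \<le> \<alpha> + \<beta> * (real_of_int (x - y))\<^sup>2" for x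
  proof -
    define r where "r = real_of_int \<bar>x - y\<bar>"
    have r: "0 \<le> r" "(real_of_int (x - y))\<^sup>2 = r * r" by (simp_all add: r_def power2_eq_square flip: of_int_mult)
    have "0 \<le> (s - r)\<^sup>2" by simp
    then have "2 * (s * r) \<le> s * s + r * r" by (simp add: power2_eq_square algebra_simps)
    moreover have "0 \<le> s * s" using s by simp
    ultimately have "2 * (s * r) \<le> 2 * (s * s) + r * r" by linarith
    then have rs: "r \<le> s + r * r / s / 2" using s(1) by (simp add: field_simps)
    have "\<bar>F x - F y\<bar> \<le> K * (r * t + r * r / \<sigma>)"
      using dev[of x] by (simp add: r_def t_def algebra_simps add_divide_distrib)
    also have "\<dots> \<le> K * ((s + r * r / s / 2) * t + r * r / \<sigma>)"
      using K rs t by (intro mult_left_mono add_right_mono mult_right_mono) auto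
    also have "\<dots> = \<alpha> + \<beta> * (r * r)" by (simp add: \<alpha>_def \<beta>_def algebra_simps)
    finally show ?thesis unfolding r(2) .
  qed
  then have "(free_T ^^ n) (\<lambda>x. \<bar>F x - F y\<bar>) y \<le> (free_T ^^ n) (\<lambda>x. \<alpha> + \<beta> * (real_of_int (x - y))\<^sup>2) y"
    by (rule free_T_pow_mono)
  also have "\<dots> = 4 ^ n * (\<alpha> + \<beta> * (real n / 2))" unfolding free_T_pow_quadratic by simp
  also have "\<dots> \<le> 4 ^ n * (K * s * (2 * t))"
  proof (rule mult_left_mono)
    have "\<beta> * (real n / 2) = K * (s * t / 4 + s * (s / \<sigma>) / 2)"
      unfolding \<beta>_def s(2)[symmetric] using s(1) by (simp add: field_simps)
    also have "\<dots> \<le> K * (s * t / 4 + s * 1 / 2)"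
    proof (intro mult_left_mono[OF _ K] add_left_mono divide_right_mono mult_left_mono)
      show "s / \<sigma> \<le> 1" using s by simp
    qed (use s in auto)
    also have "\<dots> \<le> K * (s * t / 4 + s * t / 2)"
      using K s t by (intro mult_left_mono add_left_mono divide_right_mono mult_left_mono) auto
    also have "\<dots> \<le> K * (s * t)" using K s t by (intro mult_left_mono) auto
    finally show "\<alpha> + \<beta> * (real n / 2) \<le> K * s * (2 * t)" by (simp add: \<alpha>_def)
  qed simp
  finally show ?thesis by (simp only: s_def t_def)
qed


text \<open>
  Sharp for bounded \<open>x\<close> only, where \<open>F\<close> is spread to distance \<open>n^(1/2)\<close>; it is used against the
  weight \<open>q^x\<close>.
\<close>

lemma free_walk_growth:
  assumes bound: "\<And>x. \<bar>F x\<bar> \<le> K * (real_of_int (\<bar>x\<bar> + 1) * (1 + real_of_int (\<bar>x\<bar> + 1) / \<sigma>))"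
    and K: "0 \<le> K" and n: "1 \<le> n" and \<sigma>: "sqrt (real n) \<le> \<sigma>" and j: "j \<le> n"
  shows "(free_T ^^ j) (\<lambda>x. \<bar>F x\<bar>) x \<le> 4 ^ j * (6 * (K * sqrt (real n)) * ((real_of_int x)\<^sup>2 + 1))"
proof -
  define s where "s = sqrt (real n)"
  have s: "1 \<le> s" "s * s = real n" "s \<le> \<sigma>" using n \<sigma> by (simp_all add: s_def)
  have "\<bar>F x\<bar> \<le> K * (s + 3 / s) + K * (3 / s) * (real_of_int (x - 0))\<^sup>2" for x
  proof -
    define r where "r = real_of_int \<bar>x\<bar>"
    have r: "0 \<le> r" "(real_of_int (x - 0))\<^sup>2 = r * r" by (simp_all add: r_def power2_eq_square flip: of_int_mult)
    have "0 \<le> (s - (r + 1))\<^sup>2" by simp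
    then have "2 * (s * (r + 1)) \<le> s * s + (r + 1) * (r + 1)" by (simp add: power2_eq_square algebra_simps)
    moreover have sq: "(r + 1) * (r + 1) \<le> 2 * (r * r) + 2"
      using zero_le_power2[of "r - 1"] by (simp add: power2_eq_square algebra_simps)
    moreover have "0 \<le> s * s" using s by simp
    ultimately have "s * (r + 1) \<le> s * s + (r * r + 1)" by linarith
    then have rs: "r + 1 \<le> s + (r * r + 1) / s" using s(1) by (simp add: field_simps)
    have "(r + 1) * (r + 1) / \<sigma> \<le> (2 * (r * r) + 2) / s"
      using sq s r by (intro frac_le) auto
    moreover have "(r + 1) * (1 + (r + 1) / \<sigma>) = (r + 1) + (r + 1) * (r + 1) / \<sigma>"
      by (simp add: distrib_left)
    ultimately have "(r + 1) * (1 + (r + 1) / \<sigma>) \<le> s + (r * r + 1) / s + (2 * (r * r) + 2) / s"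
      using rs by linarith
    also have "\<dots> = (s + 3 / s) + 3 / s * (r * r)" by (simp add: algebra_simps add_divide_distrib)
    finally have "K * ((r + 1) * (1 + (r + 1) / \<sigma>)) \<le> K * ((s + 3 / s) + 3 / s * (r * r))"
      using K by (rule mult_left_mono)
    with bound[of x] show ?thesis unfolding r(2) by (simp add: r_def algebra_simps)
  qed
  then have "(free_T ^^ j) (\<lambda>x. \<bar>F x\<bar>) x
      \<le> (free_T ^^ j) (\<lambda>x. K * (s + 3 / s) + K * (3 / s) * (real_of_int (x - 0))\<^sup>2) x"
    by (rule free_T_pow_mono)
  also have "\<dots> = 4 ^ j * (K * (s + 3 / s + 3 / s * ((real_of_int x)\<^sup>2 + real j / 2)))"
    unfolding free_T_pow_quadratic by (simp add: algebra_simps)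
  also have "\<dots> \<le> 4 ^ j * (K * (s * (6 * ((real_of_int x)\<^sup>2 + 1))))"
  proof (intro mult_left_mono K)
    define X where "X = (real_of_int x)\<^sup>2"
    have X: "0 \<le> X" by (simp add: X_def)
    have inv: "3 / s \<le> 3 * s" using s(1) mult_mono[of 1 s 1 s] by (simp add: divide_le_eq mult.assoc)
    have "3 / s * (X + real j / 2) \<le> 3 / s * (X + s * s / 2)"
      using s j by (intro mult_left_mono add_left_mono) auto
    also have "\<dots> = 3 / s * X + 3 * s / 2" using s(1) by (simp add: field_simps)
    also have "3 / s * X \<le> 3 * s * X" using inv X by (rule mult_right_mono)
    finally have "s + 3 / s + 3 / s * (X + real j / 2) \<le> s + 3 * s + (3 * s * X + 3 * s / 2)"
      using inv by linarith
    also have "\<dots> \<le> s * (6 * (X + 1))" using s(1) X by (simp add: algebra_simps)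
    finally show "s + 3 / s + 3 / s * ((real_of_int x)\<^sup>2 + real j / 2) \<le> s * (6 * ((real_of_int x)\<^sup>2 + 1))"
      unfolding X_def .
  qed auto
  finally show ?thesis by (simp add: s_def mult_ac)
qed

lemma \<kappa>_antimono: "i \<le> j \<Longrightarrow> \<kappa> j \<le> \<kappa> i"
  unfolding \<kappa>_def by (intro powr_mono2') auto

text \<open>
  The path is at a bounded height at time \<open>k\<close> with weight of order \<open>4^k k^(-3/2)\<close>.
\<close>

lemma pair_R_geometric:
  "\<exists>D>0. \<forall>k M. pair M (R k) (\<lambda>m. q ^ m * ((real m)\<^sup>2 + 1)) \<le> D * (4 ^ k * \<kappa> k)"
proof -
  obtain C where C: "C > 0"
    "\<And>k m. R k m \<le> C * (4 ^ k * \<kappa> k) * (real (Suc m) * (1 + real (Suc m) / sqrt (real (Suc k))))"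
    using R_bounds by blast
  obtain ph where ph: "ph > 0" "\<And>m. \<pi> m \<le> ph" using \<pi>_bounds by blast
  obtain G where G: "G > 0" "\<And>n. (\<Sum>m<n. real (Suc m) ^ 4 * q ^ m) \<le> G"
    using sum_poly_geometric_bounded[OF q] by blast
  define D where "D = ph * (C * 2) * G"
  have "pair M (R k) (\<lambda>m. q ^ m * ((real m)\<^sup>2 + 1)) \<le> D * (4 ^ k * \<kappa> k)" for k M
  proof -
    have "pair M (R k) (\<lambda>m. q ^ m * ((real m)\<^sup>2 + 1))
        \<le> (\<Sum>m\<le>M. ph * (C * 2) * (4 ^ k * \<kappa> k) * (real (Suc m) ^ 4 * q ^ m))"
      unfolding pair_def
    proof (rule sum_mono)
      fix m
      define r where "r = real (Suc m)"
      have r: "1 \<le> r" by (simp add: r_def)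
      have "r / sqrt (real (Suc k)) \<le> r" using r by (simp add: divide_le_eq)
      then have "1 + r / sqrt (real (Suc k)) \<le> 2 * r" using r by linarith
      then have "C * (4 ^ k * \<kappa> k) * (r * (1 + r / sqrt (real (Suc k)))) \<le> C * (4 ^ k * \<kappa> k) * (r * (2 * r))"
        using C \<kappa>_pos[of k] r by (intro mult_left_mono) auto
      then have "R k m \<le> C * (4 ^ k * \<kappa> k) * (r * (2 * r))"
        using C(2)[of k m] by (simp only: r_def order_trans)
      moreover have "(real m)\<^sup>2 + 1 \<le> r * r" by (simp add: r_def power2_eq_square algebra_simps)
      ultimately have "\<pi> m * R k m * (q ^ m * ((real m)\<^sup>2 + 1))
          \<le> ph * (C * (4 ^ k * \<kappa> k) * (r * (2 * r))) * (q ^ m * (r * r))"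
        using ph \<pi>_pos[of m] R_nonneg[of k m] q r C \<kappa>_pos[of k]
        by (intro mult_mono mult_left_mono mult_nonneg_nonneg) (auto intro: less_imp_le)
      also have "\<dots> = ph * (C * 2) * (4 ^ k * \<kappa> k) * (r ^ 4 * q ^ m)"
        by (simp add: power4_eq_xxxx mult_ac)
      finally show "\<pi> m * R k m * (q ^ m * ((real m)\<^sup>2 + 1)) \<le> ph * (C * 2) * (4 ^ k * \<kappa> k) * (real (Suc m) ^ 4 * q ^ m)"
        by (simp only: r_def)
    qed
    also have "\<dots> = ph * (C * 2) * (4 ^ k * \<kappa> k) * (\<Sum>m<Suc M. real (Suc m) ^ 4 * q ^ m)"
      by (simp only: sum_distrib_left lessThan_Suc_atMost)
    also have "\<dots> \<le> ph * (C * 2) * (4 ^ k * \<kappa> k) * G"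
      using ph C \<kappa>_pos[of k] by (intro mult_left_mono G(2)) auto
    finally show ?thesis by (simp add: D_def mult_ac)
  qed
  moreover have "D > 0" using ph C G by (simp add: D_def)
  ultimately show ?thesis by blast
qed

lemma \<kappa>_mult: "real (Suc k) * \<kappa> k = 1 / sqrt (real (Suc k))"
proof -
  have "real (Suc k) * \<kappa> k = real (Suc k) powr 1 * real (Suc k) powr - (3/2)" by (simp add: \<kappa>_def)
  also have "\<dots> = real (Suc k) powr - (1/2)" by (simp only: powr_add[symmetric]) simp
  finally show ?thesis by (simp only: powr_minus_divide powr_half_sqrt of_nat_0_le_iff)
qed

lemma \<kappa>_comparable:
  assumes "Suc m \<le> 3 * Suc k"
  shows "\<kappa> k \<le> 3 powr (3/2) * \<kappa> m"
proof -
  have "(3 * real (Suc k)) powr - (3/2) \<le> \<kappa> m"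
  proof -
    have "real (Suc m) \<le> real (3 * Suc k)" using assms by (simp only: of_nat_le_iff)
    then show ?thesis unfolding \<kappa>_def by (intro powr_mono2') simp_all
  qed
  moreover have "(3 * real (Suc k)) powr - (3/2) = 3 powr - (3/2) * \<kappa> k"
    unfolding \<kappa>_def by (rule powr_mult)
  ultimately have "3 powr (3/2) * (3 powr - (3/2) * \<kappa> k) \<le> 3 powr (3/2) * \<kappa> m"
    by (intro mult_left_mono) auto
  moreover have "(3::real) powr (3/2) * (3 powr - (3/2) * \<kappa> k) = \<kappa> k"
    by (simp only: mult.assoc[symmetric] powr_add[symmetric]) simp
  ultimately show ?thesis by linarith
qed

text \<open>
  The reference value \<open>2^n * R (A + B) 0\<close> is the weight that a word of free letters would have
  if the height did not change along it. The deviation is a sum of two parts, weighted by the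
  mass \<open>\<pi> * R A\<close> of the path at the left end of the word. Up to the factor \<open>4^n\<close>, the displacement
  part is of order \<open>n^(1/2)\<close> times the slope \<open>4^B B^(-3/2)\<close> times the total mass \<open>4^A A^(-1/2)\<close> from
  \<open>\<pi>_R_sums\<close>. The discrepancy part is a sum over the letters; self-adjointness of \<open>T\<close> moves the
  exact letters in front of a replaced one into \<open>R (A + i)\<close>, and \<open>pair_R_geometric\<close> bounds each
  term.
\<close>

theorem block_weight_nearly_constant:
  "\<exists>C>0. \<forall>A B n. 1 \<le> n \<and> n \<le> A \<and> A \<le> B \<longrightarrow>
     (\<Sum>zs\<in>words n. \<bar>block_weight A B zs - 2 ^ n * R (A + B) 0\<bar>)
       \<le> C * sqrt (real n / real (Suc A)) * R (A + n + B) 0"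
proof -
  obtain C1 where C1: "C1 > 0"
    "\<And>k m. R k m \<le> C1 * (4 ^ k * \<kappa> k) * (real (Suc m) * (1 + real (Suc m) / sqrt (real (Suc k))))"
    "\<And>k m. \<bar>R k (Suc m) - R k m\<bar> \<le> C1 * (4 ^ k * \<kappa> k) * (1 + real (Suc m) / sqrt (real (Suc k)))"
    using R_bounds by blast
  obtain C2 where C2: "C2 > 0" "\<And>k. (\<Sum>m\<le>k. \<pi> m * R k m) \<le> C2 * (4 ^ k / sqrt (real (Suc k)))"
     "\<And>k. (\<Sum>m\<le>k. \<pi> m * R k m * real (Suc m)) \<le> C2 * 4 ^ k"
    using \<pi>_R_sums by blast
  obtain D where D: "D > 0" "\<And>k M. pair M (R k) (\<lambda>m. q ^ m * ((real m)\<^sup>2 + 1)) \<le> D * (4 ^ k * \<kappa> k)"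
    using pair_R_geometric by blast
  obtain c0 where c0: "c0 > 0" "\<And>k. c0 * (4 ^ k * \<kappa> k) \<le> R k 0" using R_0_ge by blast
  define E where "E = (4 * C2 + 36 * D) * C1"
  define C where "C = E * 3 powr (3/2) / c0"
  have E: "0 < E" using C1 C2 D by (simp add: E_def)
  have "(\<Sum>zs\<in>words n. \<bar>block_weight A B zs - 2 ^ n * R (A + B) 0\<bar>)
       \<le> C * sqrt (real n / real (Suc A)) * R (A + n + B) 0"
    if n: "1 \<le> n" "n \<le> A" and AB: "A \<le> B" for A B n
  proof -
    define F where "F = zero_extend (R B)"
    define K where "K = C1 * (4 ^ B * \<kappa> B)"
    define \<sigma> where "\<sigma> = sqrt (real (Suc B))"
    define s where "s = sqrt (real n)"
    define a where "a = sqrt (real (Suc A))"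
    define L where "L m = \<pi> m * R A m" for m
    have K: "0 \<le> K" using C1 \<kappa>_pos[of B] by (simp add: K_def)
    have \<sigma>: "0 < \<sigma>" "s \<le> \<sigma>" "a \<le> \<sigma>" "0 < a" using n AB by (simp_all add: \<sigma>_def s_def a_def)
    have s: "0 \<le> s" by (simp add: s_def)
    have L: "0 \<le> L m" for m using \<pi>_pos[of m] R_nonneg by (simp add: L_def)
    have F_diff: "\<bar>F x - F y\<bar> \<le> K * real_of_int \<bar>x - y\<bar> * (1 + real_of_int (\<bar>y\<bar> + \<bar>x - y\<bar> + 1) / \<sigma>)" for x y
      unfolding F_def
    proof (rule zero_extend_Lipschitz)
      show "\<bar>R B (Suc m) - R B m\<bar> \<le> K * (1 + real (Suc m) / \<sigma>)" for m
        using C1(3)[of B m] by (simp only: K_def \<sigma>_def)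
      show "\<bar>R B 0\<bar> \<le> K * (1 + 1 / \<sigma>)"
        using C1(2)[of B 0] R_nonneg[of B 0] by (simp add: K_def \<sigma>_def)
    qed (use K \<sigma> in auto)
    have F_bound: "\<bar>F x\<bar> \<le> K * (real_of_int (\<bar>x\<bar> + 1) * (1 + real_of_int (\<bar>x\<bar> + 1) / \<sigma>))" for x
    proof (cases "x < 0")
      case True
      then show ?thesis using K \<sigma> by (simp add: F_def zero_extend_def)
    next
      case False
      then show ?thesis
        using C1(2)[of B "nat x"] R_nonneg[of B "nat x"]
        by (simp add: F_def zero_extend_def K_def \<sigma>_def add.commute)
    qed
    define dev where "dev m = (free_T ^^ n) (\<lambda>x. \<bar>F x - F (int m)\<bar>) (int m)" for m
    have split: "\<bar>block_weight A B zs - 2 ^ n * R (A + B) 0\<bar>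
        \<le> (\<Sum>m\<le>A. L m * (\<bar>word zs (R B) m - free_word zs F (int m)\<bar> + \<bar>free_word zs F (int m) - 2 ^ n * F (int m)\<bar>))" for zs
    proof -
      have 1: "block_weight A B zs = (\<Sum>m\<le>A. L m * word zs (R B) m)"
        unfolding block_weight_eq T_pow_0_eq_pair L_def by (rule pair_R_eq_sum) simp
      have "R (A + B) 0 = (T ^^ A) (R B) 0" by (simp add: R_def funpow_add)
      also have "\<dots> = (\<Sum>m\<le>A. L m * R B m)"
        unfolding T_pow_0_eq_pair L_def by (rule pair_R_eq_sum) simp
      finally have "block_weight A B zs - 2 ^ n * R (A + B) 0 = (\<Sum>m\<le>A. L m * (word zs (R B) m - 2 ^ n * F (int m)))"
        unfolding 1 by (simp add: F_def zero_extend_def right_diff_distrib sum_subtractf sum_distrib_left mult_ac)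
      also have "\<bar>\<dots>\<bar> \<le> (\<Sum>m\<le>A. \<bar>L m * (word zs (R B) m - 2 ^ n * F (int m))\<bar>)" by (rule sum_abs)
      also have "\<dots> \<le> (\<Sum>m\<le>A. L m * (\<bar>word zs (R B) m - free_word zs F (int m)\<bar> + \<bar>free_word zs F (int m) - 2 ^ n * F (int m)\<bar>))"
        unfolding abs_mult using L by (intro sum_mono) (auto intro!: mult_left_mono)
      finally show ?thesis .
    qed
    have "(\<Sum>zs\<in>words n. \<bar>block_weight A B zs - 2 ^ n * R (A + B) 0\<bar>)
        \<le> (\<Sum>zs\<in>words n. \<Sum>m\<le>A. L m * (\<bar>word zs (R B) m - free_word zs F (int m)\<bar> + \<bar>free_word zs F (int m) - 2 ^ n * F (int m)\<bar>))"
      by (intro sum_mono split)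
    also have "\<dots> = (\<Sum>m\<le>A. L m * (discrepancy (R B) n m + (\<Sum>zs\<in>words n. \<bar>free_word zs F (int m) - 2 ^ n * F (int m)\<bar>)))"
      by (subst sum.swap) (simp add: discrepancy_def F_def sum.distrib sum_distrib_left distrib_left)
    also have "\<dots> \<le> (\<Sum>m\<le>A. L m * (discrepancy (R B) n m + dev m))"
      unfolding dev_def using L by (intro sum_mono mult_left_mono add_left_mono sum_free_word_deviation_le) auto
    also have "\<dots> = (\<Sum>m\<le>A. L m * discrepancy (R B) n m) + (\<Sum>m\<le>A. L m * dev m)"
      by (simp add: distrib_left sum.distrib)
    also have "(\<Sum>m\<le>A. L m * dev m) \<le> 4 * C2 * (4 ^ (A + n) * K * s / a)"
    proof -
      have "(\<Sum>m\<le>A. L m * dev m) \<le> (\<Sum>m\<le>A. L m * (4 ^ n * (K * s * (2 * (1 + real (Suc m) / \<sigma>)))))"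
      proof (intro sum_mono mult_left_mono L)
        fix m
        show "dev m \<le> 4 ^ n * (K * s * (2 * (1 + real (Suc m) / \<sigma>)))"
          using free_walk_deviation[where F = F and y = "int m", OF F_diff K n(1), folded s_def, OF \<sigma>(2)]
          by (simp add: dev_def add.commute)
      qed
      also have "\<dots> = 4 ^ n * K * s * 2 * ((\<Sum>m\<le>A. \<pi> m * R A m) + (\<Sum>m\<le>A. \<pi> m * R A m * real (Suc m)) / \<sigma>)"
        by (simp add: L_def sum_distrib_left sum_divide_distrib sum.distrib[symmetric] algebra_simps)
      also have "\<dots> \<le> 4 ^ n * K * s * 2 * (C2 * (4 ^ A / a) + C2 * 4 ^ A / a)"
      proof (intro mult_left_mono add_mono)
        show "(\<Sum>m\<le>A. \<pi> m * R A m) \<le> C2 * (4 ^ A / a)" unfolding a_def by (rule C2)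
        show "(\<Sum>m\<le>A. \<pi> m * R A m * real (Suc m)) / \<sigma> \<le> C2 * 4 ^ A / a"
          using C2 \<sigma> by (intro frac_le) auto
      qed (use K s in auto)
      also have "\<dots> = 4 * C2 * (4 ^ (A + n) * K * s / a)" by (simp add: power_add mult_ac)
      finally show ?thesis .
    qed
    also have "(\<Sum>m\<le>A. L m * discrepancy (R B) n m) \<le> 36 * D * (4 ^ (A + n) * K * s / a)"
    proof -
      define b where "b x = 6 * (K * s) * ((real_of_int x)\<^sup>2 + 1)" for x
      define e where "e = (\<lambda>m. q ^ m * b (int m))"
      have disc: "discrepancy (R B) n m \<le> (\<Sum>i<n. 6 * 4 ^ (n - i) * (T ^^ i) e m)" for m
        unfolding e_def
      proof (rule discrepancy_le)
        fix j x assume "j \<le> n"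
        show "(free_T ^^ j) (\<lambda>y. \<bar>zero_extend (R B) y\<bar>) x \<le> 4 ^ j * b x"
          unfolding b_def s_def
          by (rule free_walk_growth[OF F_bound[unfolded F_def] K n(1) _ \<open>j \<le> n\<close>]) (use \<sigma> in \<open>simp add: s_def\<close>)
      qed
      have "(\<Sum>m\<le>A. L m * discrepancy (R B) n m) \<le> (\<Sum>m\<le>A. L m * (\<Sum>i<n. 6 * 4 ^ (n - i) * (T ^^ i) e m))"
        using L disc by (intro sum_mono mult_left_mono) auto
      also have "\<dots> = (\<Sum>m\<le>A. \<Sum>i<n. 6 * 4 ^ (n - i) * (L m * (T ^^ i) e m))"
        by (simp add: sum_distrib_left mult_ac)
      also have "\<dots> = (\<Sum>i<n. 6 * 4 ^ (n - i) * (\<Sum>m\<le>A. L m * (T ^^ i) e m))"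
        by (subst sum.swap) (simp add: sum_distrib_left)
      also have "\<dots> \<le> (\<Sum>i<n. 36 * D * (K * s) * 4 ^ (A + n) * \<kappa> A)"
      proof (rule sum_mono)
        fix i assume "i \<in> {..<n}"
        then have i: "i < n" by simp
        define M where "M = A + n"
        have "(\<Sum>m\<le>A. L m * (T ^^ i) e m) = pair M (R A) ((T ^^ i) e)"
          unfolding L_def by (rule pair_R_eq_sum[symmetric]) (simp add: M_def)
        also have "\<dots> = pair M (R (A + i)) e"
          by (rule pair_R_T_pow) (use i in \<open>simp add: M_def\<close>)
        also have "\<dots> = 6 * (K * s) * pair M (R (A + i)) (\<lambda>m. q ^ m * ((real m)\<^sup>2 + 1))"
          unfolding pair_def e_def b_def sum_distrib_left by (intro sum.cong) (simp_all only: mult_ac of_int_of_nat_eq)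
        also have "\<dots> \<le> 6 * (K * s) * (D * (4 ^ (A + i) * \<kappa> (A + i)))"
          using K s by (intro mult_left_mono D) auto
        also have "\<dots> \<le> 6 * (K * s) * (D * (4 ^ (A + i) * \<kappa> A))"
          using K s D(1) by (intro mult_left_mono \<kappa>_antimono) auto
        finally have "6 * 4 ^ (n - i) * (\<Sum>m\<le>A. L m * (T ^^ i) e m) \<le> 6 * 4 ^ (n - i) * (6 * (K * s) * (D * (4 ^ (A + i) * \<kappa> A)))"
          by (intro mult_left_mono) auto
        also have "\<dots> = 36 * D * (K * s) * (4 ^ (n - i) * 4 ^ (A + i)) * \<kappa> A" by (simp add: mult_ac)
        also have "(4::real) ^ (n - i) * 4 ^ (A + i) = 4 ^ (A + n)"
          using i by (simp add: power_add[symmetric] add.commute)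
        finally show "6 * 4 ^ (n - i) * (\<Sum>m\<le>A. L m * (T ^^ i) e m) \<le> 36 * D * (K * s) * 4 ^ (A + n) * \<kappa> A" .
      qed
      also have "\<dots> = 36 * D * (K * s) * 4 ^ (A + n) * (real n * \<kappa> A)" by simp
      \<comment> \<open>the \<open>n\<close> letters, each paying \<open>A^(-3/2)\<close>, contribute at most \<open>A^(-1/2)\<close> as \<open>n \<le> A\<close>\<close>
      also have "\<dots> \<le> 36 * D * (K * s) * 4 ^ (A + n) * (1 / a)"
      proof (intro mult_left_mono)
        have "real n * \<kappa> A \<le> real (Suc A) * \<kappa> A"
          using n \<kappa>_pos[of A] by (intro mult_right_mono) auto
        then show "real n * \<kappa> A \<le> 1 / a" by (simp only: \<kappa>_mult a_def)
      qed (use D K s in auto)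
      finally show ?thesis by (simp add: mult_ac)
    qed
    finally have "(\<Sum>zs\<in>words n. \<bar>block_weight A B zs - 2 ^ n * R (A + B) 0\<bar>)
        \<le> 36 * D * (4 ^ (A + n) * K * s / a) + 4 * C2 * (4 ^ (A + n) * K * s / a)" by simp
    also have "\<dots> = (4 * C2 + 36 * D) * (4 ^ (A + n) * K * s / a)" by (simp only: distrib_right add.commute)
    also have "\<dots> = E * (s / a) * (4 ^ (A + n + B) * \<kappa> B)" by (simp add: K_def E_def power_add mult_ac)
    \<comment> \<open>\<open>B\<close> is comparable with \<open>A + n + B\<close>: this is where \<open>A \<le> B\<close> enters\<close>
    also have "\<dots> \<le> E * (s / a) * (4 ^ (A + n + B) * (3 powr (3/2) * \<kappa> (A + n + B)))"
      using E s \<sigma> n AB by (intro mult_left_mono \<kappa>_comparable) auto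
    also have "\<dots> = C * (s / a) * (c0 * (4 ^ (A + n + B) * \<kappa> (A + n + B)))"
      using c0 by (simp add: C_def mult_ac)
    also have "\<dots> \<le> C * (s / a) * R (A + n + B) 0"
      using E c0(1) s \<sigma> by (intro mult_left_mono c0(2)) (auto simp: C_def)
    finally show ?thesis by (simp add: s_def a_def real_sqrt_divide)
  qed
  moreover have "0 < C" using E c0 by (simp add: C_def)
  ultimately show ?thesis by blast
qed

end

section \<open>The matrix product measure is the stationary distribution\<close>

definition site_word :: "nat \<Rightarrow> nat \<Rightarrow> (nat \<Rightarrow> bool) \<Rightarrow> bool list" where
  "site_word i j \<eta> = map \<eta> [i..<j]"

lemma bij_betw_site_word: "bij_betw (site_word i j) (configs {i..<j}) (words (j - i))"
proof (rule bij_betwI)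
  show "site_word i j \<in> configs {i..<j} \<rightarrow> words (j - i)" by (auto simp: site_word_def words_def)
  show "(\<lambda>xs x. if i \<le> x \<and> x < j then xs ! (x - i) else False) \<in> words (j - i) \<rightarrow> configs {i..<j}"
    by (auto simp: configs_def PiE_dflt_def)
  show "(\<lambda>x. if i \<le> x \<and> x < j then site_word i j \<eta> ! (x - i) else False) = \<eta>" if "\<eta> \<in> configs {i..<j}" for \<eta>
    using that by (auto simp: fun_eq_iff site_word_def configs_def PiE_dflt_def)
  show "site_word i j (\<lambda>x. if i \<le> x \<and> x < j then xs ! (x - i) else False) = xs" if "xs \<in> words (j - i)" for xs
    using that by (intro nth_equalityI) (auto simp: words_def site_word_def)
qed

lemma swap_swap: "swap_sites x y (swap_sites x y \<eta>) = \<eta>"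
  by (auto simp: swap_sites_def)

lemma flip_flip: "flip_site x (flip_site x \<eta>) = \<eta>"
  by (auto simp: flip_site_def)

lemma sum_configs_swap:
  assumes "x \<in> S" "y \<in> S"
  shows "(\<Sum>\<eta>\<in>configs S. F (swap_sites x y \<eta>)) = (\<Sum>\<eta>\<in>configs S. F \<eta>)"
  by (rule sum.reindex_bij_witness[of _ "swap_sites x y" "swap_sites x y"])
     (auto simp: swap_swap swap_sites_in_configs assms)

lemma sum_configs_flip:
  assumes "x \<in> S"
  shows "(\<Sum>\<eta>\<in>configs S. F (flip_site x \<eta>)) = (\<Sum>\<eta>\<in>configs S. F \<eta>)"
  by (rule sum.reindex_bij_witness[of _ "flip_site x" "flip_site x"])
     (auto simp: flip_flip flip_site_in_configs assms)

definition bond_rate :: "real \<Rightarrow> nat \<Rightarrow> (nat \<Rightarrow> bool) \<Rightarrow> real" where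
  "bond_rate q x \<eta> = of_bool (\<eta> x) * (1 - of_bool (\<eta> (x + 1)))
                     + q * of_bool (\<eta> (x + 1)) * (1 - of_bool (\<eta> x))"

lemma asep_gen_eq:
  "asep_gen N q \<alpha> \<beta> f \<eta> = (\<Sum>x\<in>{1..<N}. bond_rate q x \<eta> * (f (swap_sites x (x + 1) \<eta>) - f \<eta>))
     + \<alpha> * (1 - of_bool (\<eta> 1)) * (f (flip_site 1 \<eta>) - f \<eta>)
     + \<beta> * of_bool (\<eta> N) * (f (flip_site N \<eta>) - f \<eta>)"
  by (simp add: asep_gen_def bond_rate_def)

lemma sum_asep_gen_eq:
  assumes N: "1 \<le> N"
  shows "(\<Sum>\<eta>\<in>configs {1..N}. p \<eta> * asep_gen N q \<alpha> \<beta> f \<eta>)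
    = (\<Sum>\<eta>\<in>configs {1..N}. f \<eta> *
        ((\<Sum>x\<in>{1..<N}. p (swap_sites x (x + 1) \<eta>) * bond_rate q x (swap_sites x (x + 1) \<eta>) - p \<eta> * bond_rate q x \<eta>)
         + \<alpha> * (p (flip_site 1 \<eta>) * of_bool (\<eta> 1) - p \<eta> * (1 - of_bool (\<eta> 1)))
         + \<beta> * (p (flip_site N \<eta>) * (1 - of_bool (\<eta> N)) - p \<eta> * of_bool (\<eta> N))))"
    (is "?lhs = ?rhs")
proof -
  let ?s = "\<lambda>x. swap_sites x (x + 1)"
  let ?\<Omega> = "configs {1..N}"
  have swap: "(\<Sum>\<eta>\<in>?\<Omega>. p \<eta> * bond_rate q x \<eta> * f (?s x \<eta>))
      = (\<Sum>\<eta>\<in>?\<Omega>. p (?s x \<eta>) * bond_rate q x (?s x \<eta>) * f \<eta>)"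
    if "x \<in> {1..<N}" for x
    using sum_configs_swap[of x "{1..N}" "x + 1"
        "\<lambda>\<eta>. p (?s x \<eta>) * bond_rate q x (?s x \<eta>) * f \<eta>"] that
    by (simp add: swap_swap)
  have left: "(\<Sum>\<eta>\<in>?\<Omega>. p \<eta> * (1 - of_bool (\<eta> 1)) * f (flip_site 1 \<eta>))
      = (\<Sum>\<eta>\<in>?\<Omega>. p (flip_site 1 \<eta>) * of_bool (\<eta> 1) * f \<eta>)"
  proof -
    have "(\<Sum>\<eta>\<in>?\<Omega>. p (flip_site 1 \<eta>) * of_bool (\<eta> 1) * f \<eta>)
        = (\<Sum>\<eta>\<in>?\<Omega>. p (flip_site 1 (flip_site 1 \<eta>)) * of_bool (flip_site 1 \<eta> 1) * f (flip_site 1 \<eta>))"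
      using N by (intro sum_configs_flip[symmetric]) auto
    also have "\<dots> = (\<Sum>\<eta>\<in>?\<Omega>. p \<eta> * (1 - of_bool (\<eta> 1)) * f (flip_site 1 \<eta>))"
      unfolding flip_flip by (intro sum.cong refl) (simp add: flip_site_def)
    finally show ?thesis ..
  qed
  have right: "(\<Sum>\<eta>\<in>?\<Omega>. p \<eta> * of_bool (\<eta> N) * f (flip_site N \<eta>))
      = (\<Sum>\<eta>\<in>?\<Omega>. p (flip_site N \<eta>) * (1 - of_bool (\<eta> N)) * f \<eta>)"
  proof -
    have "(\<Sum>\<eta>\<in>?\<Omega>. p (flip_site N \<eta>) * (1 - of_bool (\<eta> N)) * f \<eta>)
        = (\<Sum>\<eta>\<in>?\<Omega>. p (flip_site N (flip_site N \<eta>)) * (1 - of_bool (flip_site N \<eta> N)) * f (flip_site N \<eta>))"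
      using N by (intro sum_configs_flip[symmetric]) auto
    also have "\<dots> = (\<Sum>\<eta>\<in>?\<Omega>. p \<eta> * of_bool (\<eta> N) * f (flip_site N \<eta>))"
      unfolding flip_flip by (intro sum.cong refl) (simp add: flip_site_def)
    finally show ?thesis ..
  qed
  have "?lhs = (\<Sum>\<eta>\<in>?\<Omega>. (\<Sum>x\<in>{1..<N}. p \<eta> * bond_rate q x \<eta> * f (?s x \<eta>))
      - (\<Sum>x\<in>{1..<N}. p \<eta> * bond_rate q x \<eta> * f \<eta>)
      + (\<alpha> * (p \<eta> * (1 - of_bool (\<eta> 1)) * f (flip_site 1 \<eta>)) - \<alpha> * (p \<eta> * (1 - of_bool (\<eta> 1)) * f \<eta>))
      + (\<beta> * (p \<eta> * of_bool (\<eta> N) * f (flip_site N \<eta>)) - \<beta> * (p \<eta> * of_bool (\<eta> N) * f \<eta>)))"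
    unfolding asep_gen_eq
    by (intro sum.cong refl)
       (simp only: distrib_left sum_distrib_left right_diff_distrib sum_subtractf mult_ac)
  also have "\<dots> = (\<Sum>x\<in>{1..<N}. \<Sum>\<eta>\<in>?\<Omega>. p \<eta> * bond_rate q x \<eta> * f (?s x \<eta>))
      - (\<Sum>x\<in>{1..<N}. \<Sum>\<eta>\<in>?\<Omega>. p \<eta> * bond_rate q x \<eta> * f \<eta>)
      + (\<alpha> * (\<Sum>\<eta>\<in>?\<Omega>. p \<eta> * (1 - of_bool (\<eta> 1)) * f (flip_site 1 \<eta>)) - \<alpha> * (\<Sum>\<eta>\<in>?\<Omega>. p \<eta> * (1 - of_bool (\<eta> 1)) * f \<eta>))
      + (\<beta> * (\<Sum>\<eta>\<in>?\<Omega>. p \<eta> * of_bool (\<eta> N) * f (flip_site N \<eta>)) - \<beta> * (\<Sum>\<eta>\<in>?\<Omega>. p \<eta> * of_bool (\<eta> N) * f \<eta>))"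
    by (simp only: sum.distrib sum_subtractf sum_distrib_left[symmetric] sum.swap[of _ _ ?\<Omega>])
  also have "(\<Sum>x\<in>{1..<N}. \<Sum>\<eta>\<in>?\<Omega>. p \<eta> * bond_rate q x \<eta> * f (?s x \<eta>))
     = (\<Sum>x\<in>{1..<N}. \<Sum>\<eta>\<in>?\<Omega>. p (?s x \<eta>) * bond_rate q x (?s x \<eta>) * f \<eta>)"
    by (intro sum.cong refl swap)
  also have "\<dots> - (\<Sum>x\<in>{1..<N}. \<Sum>\<eta>\<in>?\<Omega>. p \<eta> * bond_rate q x \<eta> * f \<eta>)
     = (\<Sum>\<eta>\<in>?\<Omega>. \<Sum>x\<in>{1..<N}. p (?s x \<eta>) * bond_rate q x (?s x \<eta>) * f \<eta>
         - p \<eta> * bond_rate q x \<eta> * f \<eta>)"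
    by (simp only: sum_subtractf sum.swap[of _ "{1..<N}"])
  finally show ?thesis
    unfolding left right
    by (simp only: distrib_left right_diff_distrib sum.distrib sum_subtractf sum_distrib_left mult_ac)
qed

lemma upt_split:
  assumes "i \<le> x" "x < j"
  shows "[i..<j] = [i..<x] @ x # [Suc x..<j]"
proof -
  have "[i..<x + (j - x)] = [i..<x] @ [x..<x + (j - x)]" by (rule upt_add_eq_append) (rule assms)
  then have "[i..<j] = [i..<x] @ [x..<j]" using assms(2) by simp
  then show ?thesis by (simp only: upt_conv_Cons[OF assms(2)])
qed

context asep_matrices
begin

text \<open>
  The two-site imbalances of the matrix product weights are differences of weights with one
  site deleted, so they telescope along the bonds, and the boundary terms cancel the two ends.
\<close>

definition hop :: "nat \<Rightarrow> nat \<Rightarrow> (nat \<Rightarrow> bool) \<Rightarrow> real" where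
  "hop N x \<eta> = (1 - q) * (if \<eta> x then - 1 else 1) * weight (map \<eta> ([1..<x] @ [Suc x..<Suc N]))"

lemma bulk_balance:
  assumes "x \<in> {1..<N}"
  shows "weight (site_word 1 (Suc N) (swap_sites x (x + 1) \<eta>)) * bond_rate q x (swap_sites x (x + 1) \<eta>)
      - weight (site_word 1 (Suc N) \<eta>) * bond_rate q x \<eta> = hop N x \<eta> - hop N (Suc x) \<eta>"
proof -
  define xs where "xs = map \<eta> [1..<x]"
  define ys where "ys = map \<eta> [Suc (Suc x)..<Suc N]"
  have x: "1 \<le> x" "x < N" using assms by auto
  have u2: "[Suc x..<Suc N] = Suc x # [Suc (Suc x)..<Suc N]"
    by (rule upt_conv_Cons) (use x in simp)
  have u1: "[1..<Suc N] = [1..<x] @ x # Suc x # [Suc (Suc x)..<Suc N]"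
    unfolding u2[symmetric] by (rule upt_split) (use x in auto)
  have u3: "[1..<Suc x] = [1..<x] @ [x]" by (rule upt_Suc_append) (rule x)
  define \<zeta> where "\<zeta> = swap_sites x (x + 1) \<eta>"
  have \<zeta>_x: "\<zeta> x = \<eta> (Suc x)" by (simp add: \<zeta>_def swap_sites_def)
  have \<zeta>_Suc: "\<zeta> (Suc x) = \<eta> x" by (simp add: \<zeta>_def swap_sites_def)
  have \<zeta>_else: "\<zeta> y = \<eta> y" if "y \<noteq> x" "y \<noteq> Suc x" for y
    using that by (simp add: \<zeta>_def swap_sites_def)
  have "map \<zeta> [1..<x] = xs" unfolding xs_def map_eq_conv by (intro ballI \<zeta>_else) auto
  moreover have "map \<zeta> [Suc (Suc x)..<Suc N] = ys" unfolding ys_def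
  proof (rule map_cong[OF refl])
    fix y assume "y \<in> set [Suc (Suc x)..<Suc N]"
    then have "Suc x < y" by (simp only: set_upt atLeastLessThan_iff Suc_le_eq)
    then have "y \<noteq> x" "y \<noteq> Suc x" by linarith+
    then show "\<zeta> y = \<eta> y" by (rule \<zeta>_else)
  qed
  ultimately have words: "site_word 1 (Suc N) \<zeta> = xs @ \<eta> (Suc x) # \<eta> x # ys"
    unfolding site_word_def u1 by (simp only: map_append list.map \<zeta>_x \<zeta>_Suc)
  have words': "site_word 1 (Suc N) \<eta> = xs @ \<eta> x # \<eta> (Suc x) # ys"
    unfolding site_word_def u1 by (simp only: map_append list.map xs_def ys_def)
  have hops: "hop N x \<eta> = (1 - q) * (if \<eta> x then - 1 else 1) * weight (xs @ \<eta> (Suc x) # ys)"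
    "hop N (Suc x) \<eta> = (1 - q) * (if \<eta> (Suc x) then - 1 else 1) * weight (xs @ \<eta> x # ys)"
    unfolding hop_def u2 u3 xs_def ys_def by simp_all
  have rates: "bond_rate q x \<eta> = of_bool (\<eta> x) * (1 - of_bool (\<eta> (Suc x))) + q * of_bool (\<eta> (Suc x)) * (1 - of_bool (\<eta> x))"
    "bond_rate q x \<zeta> = of_bool (\<eta> (Suc x)) * (1 - of_bool (\<eta> x)) + q * of_bool (\<eta> x) * (1 - of_bool (\<eta> (Suc x)))"
    by (simp_all add: bond_rate_def \<zeta>_x \<zeta>_Suc)
  have "weight (xs @ b # a # ys) * (of_bool b * (1 - of_bool a) + q * of_bool a * (1 - of_bool b))
      - weight (xs @ a # b # ys) * (of_bool a * (1 - of_bool b) + q * of_bool b * (1 - of_bool a))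
      = (1 - q) * (if a then - 1 else 1) * weight (xs @ b # ys)
        - (1 - q) * (if b then - 1 else 1) * weight (xs @ a # ys)" for a b
  proof (cases "a = b")
    case False
    then consider "a" "\<not> b" | "\<not> a" "b" by auto
    then show ?thesis
    proof cases
      case 1
      then have ab: "a = True" "b = False" by auto
      show ?thesis unfolding ab using weight_bulk[of xs ys] by (simp add: algebra_simps)
    next
      case 2
      then have ab: "a = False" "b = True" by auto
      show ?thesis unfolding ab using weight_bulk[of xs ys] by (simp add: algebra_simps)
    qed
  qed simp
  then show ?thesis unfolding \<zeta>_def[symmetric] words words' hops rates .
qed

lemma weight_stationary:
  assumes N: "1 \<le> N" and \<alpha>: "\<alpha> * (1 + u) = 1 - q" and \<beta>: "\<beta> * (1 + v) = 1 - q"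
  shows "(\<Sum>\<eta>\<in>configs {1..N}. weight (site_word 1 (Suc N) \<eta>) * asep_gen N q \<alpha> \<beta> f \<eta>) = 0"
proof -
  define p where "p \<eta> = weight (site_word 1 (Suc N) \<eta>)" for \<eta>
  have bulk: "(\<Sum>x\<in>{1..<N}. p (swap_sites x (x + 1) \<eta>) * bond_rate q x (swap_sites x (x + 1) \<eta>) - p \<eta> * bond_rate q x \<eta>)
      = hop N 1 \<eta> - hop N N \<eta>" for \<eta>
  proof -
    have "(\<Sum>x\<in>{1..<N}. p (swap_sites x (x + 1) \<eta>) * bond_rate q x (swap_sites x (x + 1) \<eta>) - p \<eta> * bond_rate q x \<eta>)
      = (\<Sum>x\<in>{1..<N}. hop N x \<eta> - hop N (Suc x) \<eta>)"
      unfolding p_def by (intro sum.cong refl bulk_balance) auto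
    also have "\<dots> = hop N 1 \<eta> - hop N N \<eta>"
      using sum_Suc_diff'[of 1 N "\<lambda>x. - hop N x \<eta>"] N by simp
    finally show ?thesis .
  qed
  have left: "\<alpha> * (p (flip_site 1 \<eta>) * of_bool (\<eta> 1) - p \<eta> * (1 - of_bool (\<eta> 1))) = - hop N 1 \<eta>" for \<eta>
  proof -
    have u1: "[1..<Suc N] = 1 # [Suc 1..<Suc N]" using N by (simp add: upt_conv_Cons)
    define ys where "ys = map \<eta> [Suc 1..<Suc N]"
    have "site_word 1 (Suc N) \<eta> = \<eta> 1 # ys" unfolding site_word_def u1 ys_def by simp
    moreover have "site_word 1 (Suc N) (flip_site 1 \<eta>) = (\<not> \<eta> 1) # ys"
      unfolding site_word_def u1 ys_def by (simp add: flip_site_def)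
    moreover have "map \<eta> ([1..<1] @ [Suc 1..<Suc N]) = ys" by (simp add: ys_def)
    ultimately show ?thesis
      unfolding p_def hop_def by (cases "\<eta> 1") (simp_all add: weight_left \<alpha>[symmetric])
  qed
  have right: "\<beta> * (p (flip_site N \<eta>) * (1 - of_bool (\<eta> N)) - p \<eta> * of_bool (\<eta> N)) = hop N N \<eta>" for \<eta>
  proof -
    have u1: "[1..<Suc N] = [1..<N] @ [N]" using N by simp
    define xs where "xs = map \<eta> [1..<N]"
    have "site_word 1 (Suc N) \<eta> = xs @ [\<eta> N]" unfolding site_word_def u1 xs_def by simp
    moreover have "site_word 1 (Suc N) (flip_site N \<eta>) = xs @ [\<not> \<eta> N]"
      unfolding site_word_def u1 xs_def by (simp add: flip_site_def)
    moreover have "map \<eta> ([1..<N] @ [Suc N..<Suc N]) = xs" by (simp add: xs_def)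
    ultimately show ?thesis
      unfolding p_def hop_def by (cases "\<eta> N") (simp_all add: weight_right \<beta>[symmetric])
  qed
  have "(\<Sum>\<eta>\<in>configs {1..N}. p \<eta> * asep_gen N q \<alpha> \<beta> f \<eta>) = 0"
    unfolding sum_asep_gen_eq[OF N] bulk left right by simp
  then show ?thesis by (simp add: p_def)
qed

end

definition empty_config :: "nat \<Rightarrow> bool" where "empty_config = (\<lambda>_. False)"

definition left_mass :: "nat \<Rightarrow> (nat \<Rightarrow> bool) \<Rightarrow> nat" where
  "left_mass N \<eta> = (\<Sum>x\<in>{1..N}. x * of_bool (\<eta> x))"

definition right_mass :: "nat \<Rightarrow> (nat \<Rightarrow> bool) \<Rightarrow> nat" where
  "right_mass N \<eta> = (\<Sum>x\<in>{1..N}. (Suc N - x) * of_bool (\<eta> x))"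

lemma sum_swap_sites_less:
  fixes h :: "nat \<Rightarrow> nat"
  assumes "finite S" "x \<in> S" "y \<in> S" "\<eta> x" "\<not> \<eta> y" "h y < h x"
  shows "(\<Sum>s\<in>S. h s * of_bool (swap_sites x y \<eta> s)) < (\<Sum>s\<in>S. h s * of_bool (\<eta> s))"
proof -
  have xy: "x \<noteq> y" using assms by auto
  have split: "(\<Sum>s\<in>S. F s) = F x + (F y + (\<Sum>s\<in>S - {x} - {y}. F s))" for F :: "nat \<Rightarrow> nat"
    using assms xy by (simp add: sum.remove[of S x] sum.remove[of "S - {x}" y])
  have "(\<Sum>s\<in>S - {x} - {y}. h s * of_bool (swap_sites x y \<eta> s)) = (\<Sum>s\<in>S - {x} - {y}. h s * of_bool (\<eta> s))"
    by (intro sum.cong) (auto simp: swap_sites_def)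
  then show ?thesis
    unfolding split using assms xy by (simp add: swap_sites_def)
qed

lemma sum_flip_site_less:
  fixes h :: "nat \<Rightarrow> nat"
  assumes "finite S" "x \<in> S" "\<eta> x" "0 < h x"
  shows "(\<Sum>s\<in>S. h s * of_bool (flip_site x \<eta> s)) < (\<Sum>s\<in>S. h s * of_bool (\<eta> s))"
  using assms by (intro sum_strict_mono_ex1) (auto simp: flip_site_def)

text \<open>
  Uniqueness of the stationary distribution. The zero set of a non-negative solution of the
  stationarity equations is closed under predecessors. From any configuration one reaches the
  empty one backwards by moving the first particle to the left until it leaves through site \<open>1\<close>;
  and from the empty one every configuration is reached backwards, because moving the last
  particle to the right until it leaves through site \<open>N\<close> empties any configuration. Only jumps
  to the right, entrances and exits are used, so \<open>q = 0\<close> is covered.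
\<close>

locale nonneg_stationary =
  fixes N :: nat and q \<alpha> \<beta> :: real and \<nu> :: "(nat \<Rightarrow> bool) \<Rightarrow> real"
  assumes N: "1 \<le> N" and q0: "0 \<le> q" and \<alpha>0: "0 < \<alpha>" and \<beta>0: "0 < \<beta>"
    and nonneg: "\<And>\<eta>. \<eta> \<in> configs {1..N} \<Longrightarrow> 0 \<le> \<nu> \<eta>"
    and balance: "\<And>f. (\<Sum>\<eta>\<in>configs {1..N}. \<nu> \<eta> * asep_gen N q \<alpha> \<beta> f \<eta>) = 0"
begin

lemma jump_rate_nonneg:
  assumes "\<eta> \<noteq> \<xi>"
  shows "0 \<le> (\<Sum>x\<in>{1..<N}. bond_rate q x \<eta> * (of_bool (swap_sites x (x + 1) \<eta> = \<xi>) - of_bool (\<eta> = \<xi>)))"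
    "0 \<le> \<alpha> * (1 - of_bool (\<eta> 1)) * (of_bool (flip_site 1 \<eta> = \<xi>) - of_bool (\<eta> = \<xi>))"
    "0 \<le> \<beta> * of_bool (\<eta> N) * (of_bool (flip_site N \<eta> = \<xi>) - of_bool (\<eta> = \<xi>))"
  using assms q0 \<alpha>0 \<beta>0 by (auto simp: bond_rate_def intro!: sum_nonneg)

lemma zero_backward:
  assumes \<xi>: "\<xi> \<in> configs {1..N}" "\<nu> \<xi> = 0" and \<eta>: "\<eta> \<in> configs {1..N}"
    and rate: "0 < asep_gen N q \<alpha> \<beta> (\<lambda>\<zeta>. of_bool (\<zeta> = \<xi>)) \<eta>"
  shows "\<nu> \<eta> = 0"
proof -
  let ?h = "\<lambda>\<eta>. \<nu> \<eta> * asep_gen N q \<alpha> \<beta> (\<lambda>\<zeta>. of_bool (\<zeta> = \<xi>)) \<eta>"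
  have "0 \<le> ?h \<zeta>" if "\<zeta> \<in> configs {1..N}" for \<zeta>
  proof (cases "\<zeta> = \<xi>")
    case False
    then have "0 \<le> asep_gen N q \<alpha> \<beta> (\<lambda>\<zeta>. of_bool (\<zeta> = \<xi>)) \<zeta>"
      unfolding asep_gen_eq by (intro add_nonneg_nonneg jump_rate_nonneg)
    then show ?thesis using nonneg[OF that] by simp
  qed (use \<xi> in simp)
  then have "?h \<eta> = 0"
    using balance[of "\<lambda>\<zeta>. of_bool (\<zeta> = \<xi>)"] \<eta>
    by (subst (asm) sum_nonneg_eq_0_iff) (auto intro: finite_configs)
  with rate show ?thesis by simp
qed

lemma zero_before_hop:
  assumes "\<eta> \<in> configs {1..N}" "x \<in> {1..<N}" "\<eta> x" "\<not> \<eta> (x + 1)" "\<nu> (swap_sites x (x + 1) \<eta>) = 0"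
  shows "\<nu> \<eta> = 0"
proof (rule zero_backward[OF _ assms(5) assms(1)])
  let ?\<xi> = "swap_sites x (x + 1) \<eta>"
  show "?\<xi> \<in> configs {1..N}" using assms by (intro swap_sites_in_configs) auto
  have ne: "\<eta> \<noteq> ?\<xi>" using assms by (auto simp: swap_sites_def fun_eq_iff)
  have "0 < (\<Sum>y\<in>{1..<N}. bond_rate q y \<eta> * (of_bool (swap_sites y (y + 1) \<eta> = ?\<xi>) - of_bool (\<eta> = ?\<xi>)))"
    by (rule sum_pos2[OF _ assms(2)]) (use assms ne q0 in \<open>auto simp: bond_rate_def\<close>)
  then show "0 < asep_gen N q \<alpha> \<beta> (\<lambda>\<zeta>. of_bool (\<zeta> = ?\<xi>)) \<eta>"
    unfolding asep_gen_eq by (intro add_pos_nonneg jump_rate_nonneg ne)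
qed

lemma zero_before_entry:
  assumes "\<eta> \<in> configs {1..N}" "\<not> \<eta> 1" "\<nu> (flip_site 1 \<eta>) = 0"
  shows "\<nu> \<eta> = 0"
proof (rule zero_backward[OF _ assms(3) assms(1)])
  let ?\<xi> = "flip_site 1 \<eta>"
  show "?\<xi> \<in> configs {1..N}" using assms N by (intro flip_site_in_configs) auto
  have ne: "\<eta> \<noteq> ?\<xi>" by (auto simp: flip_site_def fun_eq_iff)
  show "0 < asep_gen N q \<alpha> \<beta> (\<lambda>\<zeta>. of_bool (\<zeta> = ?\<xi>)) \<eta>"
    unfolding asep_gen_eq
    by (intro add_pos_nonneg add_nonneg_pos jump_rate_nonneg ne) (use assms ne \<alpha>0 in auto)
qed

lemma zero_before_exit:
  assumes "\<eta> \<in> configs {1..N}" "\<eta> N" "\<nu> (flip_site N \<eta>) = 0"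
  shows "\<nu> \<eta> = 0"
proof (rule zero_backward[OF _ assms(3) assms(1)])
  let ?\<xi> = "flip_site N \<eta>"
  show "?\<xi> \<in> configs {1..N}" using assms N by (intro flip_site_in_configs) auto
  have ne: "\<eta> \<noteq> ?\<xi>" by (auto simp: flip_site_def fun_eq_iff)
  show "0 < asep_gen N q \<alpha> \<beta> (\<lambda>\<zeta>. of_bool (\<zeta> = ?\<xi>)) \<eta>"
    unfolding asep_gen_eq
    by (intro add_nonneg_pos add_nonneg_nonneg jump_rate_nonneg ne) (use assms ne \<beta>0 in auto)
qed

lemma zero_at_empty:
  "\<xi> \<in> configs {1..N} \<Longrightarrow> \<nu> \<xi> = 0 \<Longrightarrow> \<nu> empty_config = 0"
proof (induction "left_mass N \<xi>" arbitrary: \<xi> rule: less_induct)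
  case less
  show ?case
  proof (cases "\<xi> = empty_config")
    case False
    then have ex: "\<exists>x. \<xi> x" by (auto simp: empty_config_def fun_eq_iff)
    define x where "x = (LEAST x. \<xi> x)"
    have x: "\<xi> x" "\<And>y. y < x \<Longrightarrow> \<not> \<xi> y"
      unfolding x_def using LeastI_ex[OF ex] by (auto dest: not_less_Least)
    have xN: "x \<in> {1..N}" using x(1) less.prems(1) by (auto simp: configs_def PiE_dflt_def)
    show ?thesis
    proof (cases "x = 1")
      case True
      have \<xi>1: "\<xi> 1" using x(1) True by simp
      have mem: "flip_site 1 \<xi> \<in> configs {1..N}"
        using N by (intro flip_site_in_configs less.prems) simp
      have "\<nu> (flip_site 1 \<xi>) = 0"
      proof (rule zero_before_entry[OF mem])
        show "\<not> flip_site 1 \<xi> 1" using \<xi>1 by (simp add: flip_site_def)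
        show "\<nu> (flip_site 1 (flip_site 1 \<xi>)) = 0" unfolding flip_flip by (rule less.prems)
      qed
      moreover have "left_mass N (flip_site 1 \<xi>) < left_mass N \<xi>"
        unfolding left_mass_def using N \<xi>1 by (intro sum_flip_site_less[where h = "\<lambda>x. x"]) simp_all
      ultimately show ?thesis using less.hyps mem by blast
    next
      case False
      define y where "y = x - 1"
      have xy: "x = y + 1" and y: "y \<in> {1..<N}" using False xN by (auto simp: y_def)
      have vac: "\<not> \<xi> y" using x(2)[of y] xy by simp
      let ?\<eta> = "swap_sites y (y + 1) \<xi>"
      have \<eta>: "?\<eta> \<in> configs {1..N}"
        by (intro swap_sites_in_configs less.prems) (use y in auto)
      have "\<nu> ?\<eta> = 0"
      proof (rule zero_before_hop[OF \<eta> y])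
        show "?\<eta> y" using x(1) xy by (simp add: swap_sites_def)
        show "\<not> ?\<eta> (y + 1)" using vac by (simp add: swap_sites_def)
        show "\<nu> (swap_sites y (y + 1) ?\<eta>) = 0" unfolding swap_swap by (rule less.prems)
      qed
      moreover have "left_mass N (swap_sites x y \<xi>) < left_mass N \<xi>"
        unfolding left_mass_def
        by (rule sum_swap_sites_less[where h = "\<lambda>x. x"]) (use y xy vac x(1) xN in simp_all)
      moreover have "swap_sites x y \<xi> = ?\<eta>" unfolding xy by (auto simp: swap_sites_def fun_eq_iff)
      ultimately show ?thesis using less.hyps \<eta> by metis
    qed
  qed (use less in auto)
qed

lemma zero_everywhere:
  assumes "\<nu> empty_config = 0"
  shows "\<eta> \<in> configs {1..N} \<Longrightarrow> \<nu> \<eta> = 0"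
proof (induction "right_mass N \<eta>" arbitrary: \<eta> rule: less_induct)
  case less
  show ?case
  proof (cases "\<eta> = empty_config")
    case False
    then obtain z where z: "\<eta> z" by (auto simp: empty_config_def fun_eq_iff)
    define X where "X = {x. \<eta> x}"
    have X: "X \<subseteq> {1..N}" using less.prems by (auto simp: X_def configs_def PiE_dflt_def)
    then have fin: "finite X" by (rule finite_subset) simp
    define x where "x = Max X"
    have x: "\<eta> x" "\<And>y. x < y \<Longrightarrow> \<not> \<eta> y"
      using Max_in[OF fin] Max_ge[OF fin] z by (auto simp: x_def X_def leD)
    have xN: "x \<in> {1..N}" using x(1) X by (auto simp: X_def)
    show ?thesis
    proof (cases "x = N")
      case True
      have \<eta>N: "\<eta> N" using x(1) True by simp
      have "right_mass N (flip_site N \<eta>) < right_mass N \<eta>"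
        unfolding right_mass_def using N \<eta>N
        by (intro sum_flip_site_less[where h = "\<lambda>x. Suc N - x"]) simp_all
      moreover have "flip_site N \<eta> \<in> configs {1..N}"
        using N by (intro flip_site_in_configs less.prems) simp
      ultimately have "\<nu> (flip_site N \<eta>) = 0" using less.hyps by blast
      then show ?thesis by (rule zero_before_exit[OF less.prems \<eta>N])
    next
      case False
      then have xN': "x \<in> {1..<N}" using xN by simp
      have vac: "\<not> \<eta> (x + 1)" using x(2)[of "x + 1"] by simp
      have "right_mass N (swap_sites x (x + 1) \<eta>) < right_mass N \<eta>"
        unfolding right_mass_def
        by (rule sum_swap_sites_less[where h = "\<lambda>x. Suc N - x"]) (use x(1) vac xN' in \<open>simp_all add: Suc_diff_le\<close>)
      moreover have "swap_sites x (x + 1) \<eta> \<in> configs {1..N}"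
        by (intro swap_sites_in_configs less.prems) (use xN' in auto)
      ultimately have "\<nu> (swap_sites x (x + 1) \<eta>) = 0" using less.hyps by blast
      then show ?thesis by (rule zero_before_hop[OF less.prems xN' x(1) vac])
    qed
  qed (use assms in simp)
qed

end

text \<open>
  Subtract the largest multiple of \<open>p\<close> that keeps \<open>\<mu>\<close> non-negative. The difference vanishes
  somewhere, hence everywhere.
\<close>

lemma stationary_unique:
  fixes p :: "(nat \<Rightarrow> bool) \<Rightarrow> real"
  assumes N: "1 \<le> N" and rates: "0 \<le> q" "0 < \<alpha>" "0 < \<beta>"
    and \<mu>: "asep_stationary N q \<alpha> \<beta> \<mu>"
    and p: "\<And>\<eta>. \<eta> \<in> configs {1..N} \<Longrightarrow> 0 < p \<eta>"
      "\<And>f. (\<Sum>\<eta>\<in>configs {1..N}. p \<eta> * asep_gen N q \<alpha> \<beta> f \<eta>) = 0"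
    and \<eta>: "\<eta> \<in> configs {1..N}"
  shows "pmf \<mu> \<eta> = p \<eta> / (\<Sum>\<zeta>\<in>configs {1..N}. p \<zeta>)"
proof -
  let ?\<Omega> = "configs {1..N}"
  have fin: "finite ?\<Omega>" by (rule finite_configs) simp
  have sup: "set_pmf \<mu> \<subseteq> ?\<Omega>" and gen: "\<And>f. measure_pmf.expectation \<mu> (asep_gen N q \<alpha> \<beta> f) = 0"
    using \<mu> unfolding asep_stationary_iff_gen[OF N] by auto
  have gen': "(\<Sum>\<eta>\<in>?\<Omega>. pmf \<mu> \<eta> * asep_gen N q \<alpha> \<beta> f \<eta>) = 0" for f
    using integral_measure_pmf_real[OF fin, of \<mu> "asep_gen N q \<alpha> \<beta> f"] sup gen[of f]
    by (auto simp: mult.commute)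
  have one: "(\<Sum>\<eta>\<in>?\<Omega>. pmf \<mu> \<eta>) = 1" by (rule sum_pmf_eq_1[OF fin sup])
  define t where "t = Min ((\<lambda>\<zeta>. pmf \<mu> \<zeta> / p \<zeta>) ` ?\<Omega>)"
  have ne: "?\<Omega> \<noteq> {}" using \<eta> by auto
  have "t \<in> (\<lambda>\<zeta>. pmf \<mu> \<zeta> / p \<zeta>) ` ?\<Omega>"
    unfolding t_def by (rule Min_in) (use fin ne in auto)
  then obtain \<xi> where \<xi>: "\<xi> \<in> ?\<Omega>" "t = pmf \<mu> \<xi> / p \<xi>" by blast
  have t_le: "t * p \<zeta> \<le> pmf \<mu> \<zeta>" if "\<zeta> \<in> ?\<Omega>" for \<zeta>
  proof -
    have "t \<le> pmf \<mu> \<zeta> / p \<zeta>" unfolding t_def using that fin by (intro Min_le) auto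
    then show ?thesis using p(1)[OF that] by (simp add: field_simps)
  qed
  interpret nonneg_stationary N q \<alpha> \<beta> "\<lambda>\<zeta>. pmf \<mu> \<zeta> - t * p \<zeta>"
  proof
    fix f
    have "(\<Sum>\<eta>\<in>?\<Omega>. (pmf \<mu> \<eta> - t * p \<eta>) * asep_gen N q \<alpha> \<beta> f \<eta>)
        = (\<Sum>\<eta>\<in>?\<Omega>. pmf \<mu> \<eta> * asep_gen N q \<alpha> \<beta> f \<eta>) - t * (\<Sum>\<eta>\<in>?\<Omega>. p \<eta> * asep_gen N q \<alpha> \<beta> f \<eta>)"
      by (simp only: left_diff_distrib sum_subtractf sum_distrib_left mult.assoc)
    then show "(\<Sum>\<eta>\<in>?\<Omega>. (pmf \<mu> \<eta> - t * p \<eta>) * asep_gen N q \<alpha> \<beta> f \<eta>) = 0"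
      by (simp only: gen' p(2))
  qed (use N rates t_le in auto)
  have "pmf \<mu> \<xi> - t * p \<xi> = 0" using \<xi> p(1)[OF \<xi>(1)] by simp
  then have eq: "pmf \<mu> \<zeta> = t * p \<zeta>" if "\<zeta> \<in> ?\<Omega>" for \<zeta>
    using zero_everywhere[OF zero_at_empty[OF \<xi>(1)] that] by simp
  have "t * (\<Sum>\<zeta>\<in>?\<Omega>. p \<zeta>) = 1"
    using one by (simp add: sum_distrib_left eq)
  moreover from this have "(\<Sum>\<zeta>\<in>?\<Omega>. p \<zeta>) \<noteq> 0" by (metis mult_zero_right zero_neq_one)
  ultimately have "t = 1 / (\<Sum>\<zeta>\<in>?\<Omega>. p \<zeta>)" by (simp add: nonzero_eq_divide_eq)
  then show ?thesis using eq[OF \<eta>] by simp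
qed

section \<open>Total variation distance to the uniform measure\<close>

lemma pmf_Ber_half:
  assumes "finite I" "\<xi> \<in> configs I"
  shows "pmf (Ber I (1 / 2)) \<xi> = (1 / 2) ^ card I"
proof -
  have "pmf (bernoulli_pmf (1 / 2)) b = 1 / 2" for b by (cases b) simp_all
  then show ?thesis
    using assms by (simp add: Ber_def pmf_Pi configs_def PiE_dflt_def)
qed

context asep_matrices
begin

lemma stationary_pmf:
  assumes N: "1 \<le> N" and rates: "0 < \<alpha>" "0 < \<beta>" "\<alpha> * (1 + u) = 1 - q" "\<beta> * (1 + v) = 1 - q"
    and \<mu>: "asep_stationary N q \<alpha> \<beta> \<mu>" and \<eta>: "\<eta> \<in> configs {1..N}"
  shows "pmf \<mu> \<eta> = weight (site_word 1 (Suc N) \<eta>) / R N 0"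
proof -
  have "{1..N} = {1..<Suc N}" by auto
  then have "(\<Sum>\<zeta>\<in>configs {1..N}. weight (site_word 1 (Suc N) \<zeta>)) = (\<Sum>xs\<in>words N. weight xs)"
    using sum.reindex_bij_betw[OF bij_betw_site_word[of 1 "Suc N"], of weight] by simp
  then show ?thesis
    using stationary_unique[OF N q(1) rates(1,2) \<mu> weight_pos weight_stationary[OF N rates(3,4)] \<eta>]
    by (simp add: sum_weight)
qed

lemma marginal_pmf:
  assumes ab: "1 \<le> a" "a \<le> b" "b \<le> N"
    and rates: "0 < \<alpha>" "0 < \<beta>" "\<alpha> * (1 + u) = 1 - q" "\<beta> * (1 + v) = 1 - q"
    and \<mu>: "asep_stationary N q \<alpha> \<beta> \<mu>" and \<xi>: "\<xi> \<in> configs {a..b}"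
  shows "pmf (marginal {a..b} \<mu>) \<xi> = block_weight (a - 1) (N - b) (site_word a (Suc b) \<xi>) / R N 0"
proof -
  let ?fibre = "(\<lambda>\<eta> x. if x \<in> {a..b} then \<eta> x else False) -` {\<xi>}"
  let ?\<Omega> = "configs {1..N}"
  define A n B where "A = a - 1" and "n = Suc b - a" and "B = N - b"
  have AnB: "N = A + (n + B)" using ab by (simp add: A_def n_def B_def)
  have N: "1 \<le> N" using ab by simp
  have sup: "set_pmf \<mu> \<subseteq> ?\<Omega>" using \<mu> by (simp add: asep_stationary_def)
  define zs where "zs = site_word a (Suc b) \<xi>"
  have "pmf (marginal {a..b} \<mu>) \<xi> = measure_pmf.expectation \<mu> (indicator ?fibre)"
    unfolding marginal_def pmf_map by simp
  also have "\<dots> = (\<Sum>\<eta>\<in>?\<Omega>. indicator ?fibre \<eta> * pmf \<mu> \<eta>)"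
    by (rule integral_measure_pmf_real) (use sup in \<open>auto intro: finite_configs\<close>)
  also have "\<dots> = (\<Sum>\<eta>\<in>?\<Omega>. of_bool (take n (drop A (site_word 1 (Suc N) \<eta>)) = zs) * weight (site_word 1 (Suc N) \<eta>) / R N 0)"
  proof (rule sum.cong[OF refl])
    fix \<eta> assume \<eta>: "\<eta> \<in> ?\<Omega>"
    have "take n (drop A (site_word 1 (Suc N) \<eta>)) = site_word a (Suc b) \<eta>"
    proof (rule nth_equalityI)
      show "length (take n (drop A (site_word 1 (Suc N) \<eta>))) = length (site_word a (Suc b) \<eta>)"
      proof -
        have "n \<le> N - A" using AnB by simp
        then show ?thesis by (simp add: site_word_def n_def[symmetric] del: upt_Suc)
      qed
      fix i assume "i < length (take n (drop A (site_word 1 (Suc N) \<eta>)))"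
      then have "i < n" "A + i < N" using AnB by (simp_all add: site_word_def)
      then show "take n (drop A (site_word 1 (Suc N) \<eta>)) ! i = site_word a (Suc b) \<eta> ! i"
        using ab by (simp add: site_word_def A_def n_def del: upt_Suc)
    qed
    moreover have "(\<lambda>x. if x \<in> {a..b} then \<eta> x else False) = \<xi> \<longleftrightarrow> site_word a (Suc b) \<eta> = zs"
      using \<xi> unfolding zs_def site_word_def map_eq_conv
      by (auto simp: fun_eq_iff configs_def PiE_dflt_def)
    ultimately show "indicator ?fibre \<eta> * pmf \<mu> \<eta>
        = of_bool (take n (drop A (site_word 1 (Suc N) \<eta>)) = zs) * weight (site_word 1 (Suc N) \<eta>) / R N 0"
      by (simp add: indicator_def stationary_pmf[OF N rates \<mu> \<eta>])
  qed
  also have "\<dots> = (\<Sum>l\<in>words N. of_bool (take n (drop A l) = zs) * weight l / R N 0)"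
  proof -
    have "{1..N} = {1..<Suc N}" by auto
    then show ?thesis
      using sum.reindex_bij_betw[OF bij_betw_site_word[of 1 "Suc N"],
          of "\<lambda>l. of_bool (take n (drop A l) = zs) * weight l / R N 0"] by simp
  qed
  also have "\<dots> = (\<Sum>l\<in>words N. of_bool (take n (drop A l) = zs) * weight l) / R N 0"
    by (simp add: sum_divide_distrib)
  also have "(\<Sum>l\<in>words N. of_bool (take n (drop A l) = zs) * weight l)
      = (\<Sum>xs\<in>words A. \<Sum>zs'\<in>words n. \<Sum>ys\<in>words B. of_bool (zs' = zs) * weight (xs @ zs' @ ys))"
    unfolding AnB sum_words_add by (intro sum.cong refl) (auto simp: words_def)
  also have "\<dots> = (\<Sum>xs\<in>words A. \<Sum>ys\<in>words B. weight (xs @ zs @ ys))"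
  proof (rule sum.cong[OF refl])
    fix xs
    have "zs \<in> words n" by (simp add: zs_def site_word_def words_def n_def del: upt_Suc)
    have "(\<Sum>zs'\<in>words n. \<Sum>ys\<in>words B. of_bool (zs' = zs) * weight (xs @ zs' @ ys))
        = (\<Sum>zs'\<in>words n. if zs' = zs then \<Sum>ys\<in>words B. weight (xs @ zs' @ ys) else 0)"
      by (intro sum.cong refl) simp
    also have "\<dots> = (\<Sum>ys\<in>words B. weight (xs @ zs @ ys))"
      using \<open>zs \<in> words n\<close> by (simp add: finite_words)
    finally show "(\<Sum>zs'\<in>words n. \<Sum>ys\<in>words B. of_bool (zs' = zs) * weight (xs @ zs' @ ys))
        = (\<Sum>ys\<in>words B. weight (xs @ zs @ ys))" .
  qed
  finally show ?thesis by (simp add: block_weight_def zs_def A_def B_def)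
qed

lemma tv_dist_eq:
  assumes ab: "1 \<le> a" "a \<le> b" "b \<le> N"
    and rates: "0 < \<alpha>" "0 < \<beta>" "\<alpha> * (1 + u) = 1 - q" "\<beta> * (1 + v) = 1 - q"
    and \<mu>: "asep_stationary N q \<alpha> \<beta> \<mu>"
  shows "tv_dist {a..b} (marginal {a..b} \<mu>) (Ber {a..b} (1 / 2))
    = 1 / 2 * (\<Sum>zs\<in>words (Suc b - a). \<bar>block_weight (a - 1) (N - b) zs / R N 0 - (1 / 2) ^ (Suc b - a)\<bar>)"
proof -
  let ?d = "\<lambda>zs. \<bar>block_weight (a - 1) (N - b) zs / R N 0 - (1 / 2) ^ (Suc b - a)\<bar>"
  have "{a..b} = {a..<Suc b}" by auto
  then have "(\<Sum>\<xi>\<in>configs {a..b}. ?d (site_word a (Suc b) \<xi>)) = (\<Sum>zs\<in>words (Suc b - a). ?d zs)"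
    using sum.reindex_bij_betw[OF bij_betw_site_word[of a "Suc b"], of ?d] by simp
  moreover have "(\<Sum>\<xi>\<in>configs {a..b}. \<bar>pmf (marginal {a..b} \<mu>) \<xi> - pmf (Ber {a..b} (1 / 2)) \<xi>\<bar>)
      = (\<Sum>\<xi>\<in>configs {a..b}. ?d (site_word a (Suc b) \<xi>))"
    by (intro sum.cong refl) (simp add: marginal_pmf[OF ab rates \<mu>] pmf_Ber_half)
  ultimately show ?thesis by (simp add: tv_dist_def)
qed

lemma R_0_pos: "0 < R k 0"
  using R_0_ge \<kappa>_pos[of k] by (metis less_le_trans mult_pos_pos zero_less_numeral zero_less_power)

text \<open>
  The average of the block weights is the total weight divided by \<open>2^n\<close>, so it is no further
  from a reference value \<open>P\<close> than the block weights are on average.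
\<close>

lemma deviation_from_uniform:
  "(\<Sum>zs\<in>words n. \<bar>block_weight A B zs / R (A + n + B) 0 - (1 / 2) ^ n\<bar>)
     \<le> 2 * (\<Sum>zs\<in>words n. \<bar>block_weight A B zs - P\<bar>) / R (A + n + B) 0"
proof -
  define Z where "Z = R (A + n + B) 0"
  define d where "d = (\<Sum>zs\<in>words n. \<bar>block_weight A B zs - P\<bar>)"
  have Z: "0 < Z" by (simp add: Z_def R_0_pos)
  have "Z - 2 ^ n * P = (\<Sum>zs\<in>words n. block_weight A B zs - P)"
    by (simp add: sum_subtractf sum_block_weight card_words Z_def)
  then have mean: "\<bar>Z - 2 ^ n * P\<bar> \<le> d" unfolding d_def using sum_abs by metis
  have "(\<Sum>zs\<in>words n. \<bar>block_weight A B zs / Z - (1 / 2) ^ n\<bar>)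
      \<le> (\<Sum>zs\<in>words n. \<bar>block_weight A B zs - P\<bar> / Z + (1 / 2) ^ n * \<bar>Z - 2 ^ n * P\<bar> / Z)"
  proof (rule sum_mono)
    fix zs
    have "block_weight A B zs / Z - (1 / 2) ^ n = (block_weight A B zs - P) / Z - (1 / 2) ^ n * (Z - 2 ^ n * P) / Z"
      using Z by (simp add: field_simps power_divide)
    also have "\<bar>\<dots>\<bar> \<le> \<bar>(block_weight A B zs - P) / Z\<bar> + \<bar>(1 / 2) ^ n * (Z - 2 ^ n * P) / Z\<bar>"
      by (rule abs_triangle_ineq4)
    also have "\<dots> = \<bar>block_weight A B zs - P\<bar> / Z + (1 / 2) ^ n * \<bar>Z - 2 ^ n * P\<bar> / Z"
      using Z by (simp add: abs_mult)
    finally show "\<bar>block_weight A B zs / Z - (1 / 2) ^ n\<bar> \<le> \<bar>block_weight A B zs - P\<bar> / Z + (1 / 2) ^ n * \<bar>Z - 2 ^ n * P\<bar> / Z" .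
  qed
  also have "\<dots> = d / Z + \<bar>Z - 2 ^ n * P\<bar> / Z"
    by (simp add: sum.distrib card_words d_def sum_divide_distrib power_divide)
  also have "\<dots> \<le> d / Z + d / Z" using mean Z by (intro add_left_mono divide_right_mono) auto
  finally show ?thesis by (simp add: Z_def d_def)
qed

lemma uniform_deviation_le:
  "\<exists>C>0. \<forall>A B n. 1 \<le> n \<and> n \<le> A \<and> A \<le> B \<longrightarrow>
     (\<Sum>zs\<in>words n. \<bar>block_weight A B zs / R (A + n + B) 0 - (1 / 2) ^ n\<bar>) \<le> C * sqrt (real n / real (Suc A))"
proof -
  obtain C where C: "C > 0" "\<And>A B n. 1 \<le> n \<and> n \<le> A \<and> A \<le> B \<Longrightarrow>
     (\<Sum>zs\<in>words n. \<bar>block_weight A B zs - 2 ^ n * R (A + B) 0\<bar>) \<le> C * sqrt (real n / real (Suc A)) * R (A + n + B) 0"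
    using block_weight_nearly_constant by blast
  have "(\<Sum>zs\<in>words n. \<bar>block_weight A B zs / R (A + n + B) 0 - (1 / 2) ^ n\<bar>) \<le> 2 * C * sqrt (real n / real (Suc A))"
    if "1 \<le> n \<and> n \<le> A \<and> A \<le> B" for A B n
  proof -
    have Z: "0 < R (A + n + B) 0" by (rule R_0_pos)
    have "2 * (\<Sum>zs\<in>words n. \<bar>block_weight A B zs - 2 ^ n * R (A + B) 0\<bar>) / R (A + n + B) 0
        \<le> 2 * (C * sqrt (real n / real (Suc A)) * R (A + n + B) 0) / R (A + n + B) 0"
      using Z by (intro divide_right_mono mult_left_mono C(2)[OF that]) auto
    also have "\<dots> = 2 * C * sqrt (real n / real (Suc A))" using Z by simp
    finally show ?thesis using deviation_from_uniform[where n = n and A = A and B = B and P = "2 ^ n * R (A + B) 0"] by linarith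
  qed
  then show ?thesis using C(1) by (intro exI[of _ "2 * C"]) auto
qed

lemma R_0_symmetric: "R n 0 = swap.R n 0"
proof -
  have "R n 0 = (\<Sum>xs\<in>words n. swap.weight (rev (map Not xs)))"
    unfolding sum_weight[symmetric] by (intro sum.cong refl weight_symmetric)
  then show ?thesis by (simp only: sum_words_rev_Not swap.sum_weight)
qed

end

context asep_matrices
begin

theorem uniform_deviation_two_sided:
  "\<exists>C>0. \<forall>A B n. 1 \<le> n \<and> n \<le> min A B \<longrightarrow>
     (\<Sum>zs\<in>words n. \<bar>block_weight A B zs / R (A + n + B) 0 - (1 / 2) ^ n\<bar>) \<le> C * sqrt (real n / real (Suc (min A B)))"
proof -
  obtain C1 where C1: "C1 > 0" "\<And>A B n. 1 \<le> n \<and> n \<le> A \<and> A \<le> B \<Longrightarrow>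
     (\<Sum>zs\<in>words n. \<bar>block_weight A B zs / R (A + n + B) 0 - (1 / 2) ^ n\<bar>) \<le> C1 * sqrt (real n / real (Suc A))"
    using uniform_deviation_le by blast
  obtain C2 where C2: "C2 > 0" "\<And>A B n. 1 \<le> n \<and> n \<le> A \<and> A \<le> B \<Longrightarrow>
     (\<Sum>zs\<in>words n. \<bar>swap.block_weight A B zs / swap.R (A + n + B) 0 - (1 / 2) ^ n\<bar>) \<le> C2 * sqrt (real n / real (Suc A))"
    using swap.uniform_deviation_le by blast
  have "(\<Sum>zs\<in>words n. \<bar>block_weight A B zs / R (A + n + B) 0 - (1 / 2) ^ n\<bar>)
      \<le> max C1 C2 * sqrt (real n / real (Suc (min A B)))" if n: "1 \<le> n \<and> n \<le> min A B" for A B n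
  proof (cases "A \<le> B")
    case True
    have "(\<Sum>zs\<in>words n. \<bar>block_weight A B zs / R (A + n + B) 0 - (1 / 2) ^ n\<bar>) \<le> C1 * sqrt (real n / real (Suc A))"
      using n True by (intro C1) auto
    also have "\<dots> \<le> max C1 C2 * sqrt (real n / real (Suc A))" by (intro mult_right_mono) auto
    finally show ?thesis using True by (simp add: min_absorb1)
  next
    case False
    have "(\<Sum>zs\<in>words n. \<bar>block_weight A B zs / R (A + n + B) 0 - (1 / 2) ^ n\<bar>)
        = (\<Sum>zs\<in>words n. \<bar>swap.block_weight B A (rev (map Not zs)) / swap.R (B + n + A) 0 - (1 / 2) ^ n\<bar>)"
      by (simp add: block_weight_symmetric[of A B] R_0_symmetric add_ac)
    also have "\<dots> = (\<Sum>zs\<in>words n. \<bar>swap.block_weight B A zs / swap.R (B + n + A) 0 - (1 / 2) ^ n\<bar>)"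
      by (rule sum_words_rev_Not)
    also have "\<dots> \<le> C2 * sqrt (real n / real (Suc B))"
      using n False by (intro C2) auto
    also have "\<dots> \<le> max C1 C2 * sqrt (real n / real (Suc B))" by (intro mult_right_mono) auto
    finally show ?thesis using False by (simp add: min_absorb2)
  qed
  moreover have "0 < max C1 C2" using C1 by simp
  ultimately show ?thesis by blast
qed

end

theorem theorem1p2:
  fixes q \<alpha> \<beta> u v :: real
    and \<mu> :: "nat \<Rightarrow> (nat \<Rightarrow> bool) pmf"
    and a b :: "nat \<Rightarrow> nat"
    and I :: "nat \<Rightarrow> nat set"
  assumes "0 \<le> q" and "q < 1" and "\<alpha> > 0" and "\<beta> > 0"
    and "u = (1 - q) / \<alpha> - 1" and "v = (1 - q) / \<beta> - 1"
    and "max u v < 1"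
    and "\<And>N. N \<ge> 1 \<Longrightarrow> asep_stationary N q \<alpha> \<beta> (\<mu> N)"
    and "\<And>N. I N = {a N..b N}"
    and "\<And>N. N \<ge> 1 \<Longrightarrow> 1 \<le> a N \<and> a N \<le> b N \<and> b N \<le> N"
    and "much_greater (\<lambda>N. min (real (a N)) (real N - real (b N)))
                      (\<lambda>N. max (real (card (I N))) ((ln (real N))\<^sup>2))"
  shows "(\<lambda>N. tv_dist (I N) (marginal (I N) (\<mu> N)) (Ber (I N) (1 / 2))) \<longlonglongrightarrow> 0"
proof -
  have rates: "\<alpha> * (1 + u) = 1 - q" "\<beta> * (1 + v) = 1 - q" using assms by simp_all
  have "0 < (1 - q) / \<alpha>" "0 < (1 - q) / \<beta>" using assms by simp_all
  then interpret asep_matrices q u v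
    by unfold_locales (use assms in \<open>auto simp: abs_less_iff\<close>)
  obtain C where C: "C > 0" "\<And>A B n. 1 \<le> n \<and> n \<le> min A B \<Longrightarrow>
     (\<Sum>zs\<in>words n. \<bar>block_weight A B zs / R (A + n + B) 0 - (1 / 2) ^ n\<bar>) \<le> C * sqrt (real n / real (Suc (min A B)))"
    using uniform_deviation_two_sided by blast
  let ?tv = "\<lambda>N. tv_dist (I N) (marginal (I N) (\<mu> N)) (Ber (I N) (1 / 2))"
  show ?thesis
  proof (rule LIMSEQ_I)
    fix e :: real assume e: "0 < e"
    define K where "K = max 2 ((C / e)\<^sup>2)"
    have K: "2 \<le> K" "(C / e)\<^sup>2 \<le> K" by (simp_all add: K_def)
    have "((\<lambda>N. ereal (min (real (a N)) (real N - real (b N)) / max (real (card (I N))) ((ln (real N))\<^sup>2))) \<longlongrightarrow> \<infinity>) sequentially"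
      using assms(11) unfolding much_greater_def by (simp add: Liminf_PInfty)
    then have "\<forall>\<^sub>F N in sequentially. ereal K < ereal (min (real (a N)) (real N - real (b N)) / max (real (card (I N))) ((ln (real N))\<^sup>2))"
      unfolding tendsto_PInfty by blast
    then obtain N0 where N0: "\<And>N. N0 \<le> N \<Longrightarrow> K < min (real (a N)) (real N - real (b N)) / max (real (card (I N))) ((ln (real N))\<^sup>2)"
      by (auto simp: eventually_sequentially)
    have "norm (?tv N - 0) < e" if N: "max 1 N0 \<le> N" for N
    proof -
      define A n B where "A = a N - 1" and "n = Suc (b N) - a N" and "B = N - b N"
      have N1: "1 \<le> N" using N by simp
      note ab = assms(10)[OF N1, THEN conjunct1] assms(10)[OF N1, THEN conjunct2, THEN conjunct1]
        assms(10)[OF N1, THEN conjunct2, THEN conjunct2]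
      have AnB: "A + n + B = N" and n1: "1 \<le> n" using ab by (simp_all add: A_def n_def B_def)
      have card: "card (I N) = n" by (simp add: assms(9) n_def)
      have AB: "real (a N) = real (Suc A)" "real N - real (b N) = real B"
        using ab by (simp_all add: A_def B_def)
      have Kn: "K * real n < min (real (Suc A)) (real B)"
      proof -
        let ?M = "max (real (card (I N))) ((ln (real N))\<^sup>2)"
        have M: "real n \<le> ?M" "0 < ?M" using n1 by (auto simp: card less_max_iff_disj)
        have "K < min (real (Suc A)) (real B) / ?M" using N0[of N] N AB by simp
        then have "K * ?M < min (real (Suc A)) (real B)" using M(2) by (simp add: pos_less_divide_eq)
        moreover have "K * real n \<le> K * ?M" using M K by (intro mult_left_mono) auto
        ultimately show ?thesis by linarith
      qed
      have "2 * real n \<le> K * real n" using K by (intro mult_right_mono) auto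
      then have "2 * real n < real (Suc A)" "2 * real n < real B" using Kn by linarith+
      then have n: "1 \<le> n \<and> n \<le> min A B" using n1 by simp
      have "?tv N
          = 1 / 2 * (\<Sum>zs\<in>words n. \<bar>block_weight A B zs / R (A + n + B) 0 - (1 / 2) ^ n\<bar>)"
        unfolding assms(9) AnB unfolding A_def B_def n_def
        by (rule tv_dist_eq[OF ab assms(3,4) rates assms(8)[OF N1]])
      also have "\<dots> \<le> 1 / 2 * (C * sqrt (real n / real (Suc (min A B))))"
        by (intro mult_left_mono C(2) n) simp
      also have "\<dots> \<le> 1 / 2 * e"
      proof (rule mult_left_mono)
        have "(C / e)\<^sup>2 * real n \<le> K * real n" using K by (intro mult_right_mono) auto
        also have "\<dots> \<le> real (Suc (min A B))" using Kn by (simp add: min_def split: if_splits)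
        finally have "C\<^sup>2 * (real n / real (Suc (min A B))) \<le> e\<^sup>2"
          using e by (simp add: field_simps power_divide)
        then have "sqrt (C\<^sup>2 * (real n / real (Suc (min A B)))) \<le> e" using e by (intro real_le_lsqrt) auto
        then show "C * sqrt (real n / real (Suc (min A B))) \<le> e"
          using C(1) by (simp only: real_sqrt_mult real_sqrt_abs)
      qed simp
      finally have "?tv N < e" using e by linarith
      moreover have "0 \<le> ?tv N"
        unfolding tv_dist_def by (simp add: sum_nonneg)
      ultimately show ?thesis by simp
    qed
    then show "\<exists>no. \<forall>N\<ge>no. norm (?tv N - 0) < e" by blast
  qed
qed

end
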